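(* The first return map of the geodesic flow on $T_1\mathbb{D}/V_P(S_O)$ (which is the hyperbolic billiard flow in the triangle $\mathscr{F}$) to the cross section $\mathscr{S}$ is conjugated to the map $\hat F$.
   Context: Matrices: $$\gamma=\begin{pmatrix}-1&2(1+\sqrt2)\\0&1\end{pmatrix},\quad \nu_0=\begin{pmatrix}1&0\\0&1\end{pmatrix},\ \nu_1=\tfrac1{\sqrt2}\begin{pmatrix}1&1\\1&-1\end{pmatrix},\ \nu_2=\tfrac1{\sqrt2}\begin{pmatrix}1&1\\-1&1\end{pmatrix},\ \nu_3=\begin{pmatrix}0&1\\1&0\end{pmatrix},$$ $$\nu_4=\begin{pmatrix}0&1\\-1&0\end{pmatrix},\ \nu_5=\tfrac1{\sqrt2}\begin{pmatrix}-1&1\\1&1\end{pmatrix},\ \nu_6=\tfrac1{\sqrt2}\begin{pmatrix}-1&1\\-1&-1\end{pmatrix},\ \nu_7=\begin{pmatrix}-1&0\\0&1\end{pmatrix}.$$ The map $\hat F$. Points of $\mathbb{RP}^1$ are given by the inverse slope coordinate $u=x/y\in\mathbb{R}\cup\{\infty\}$ or the angle $\theta$, $u=\cot\theta$; a matrix $L=\begin{pmatrix}a&b\\c&d\end{pmatrix}$ acts by $L[u]=\frac{au+b}{cu+d}$. $\Sigma_i$ is the sector with angles $[i\pi/8,(i+1)\pi/8)$, $0\le i\le 7$, $\Sigma=\Sigma_1\cup\dots\cup\Sigma_7$, and $\hat F$ is defined on $\Sigma\times\Sigma_0$ by $\hat F(u,v)=(\gamma\nu_i[u],\gamma\nu_i[v])$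 if $u\in\Sigma_i$, $1\le i\le7$. Hyperbolic plane and group. $S_O$ is the translation surface obtained from the regular octagon by identifying opposite parallel sides by translations. The disk $\mathbb{D}$ is identified with the upper half-plane $\mathbb{H}$ by $\phi(z)=\frac{z-i}{z+i}$. A matrix $\nu=\begin{pmatrix}a&b\\c&d\end{pmatrix}$ of determinant $\pm1$ acts on the right on $\mathbb{H}$ by $z\nu=\frac{az+c}{bz+d}$ if $\det\nu=1$, and $z\nu=\frac{a\bar z+c}{b\bar z+d}$ if $\det\nu=-1$. $V_P(S_O)\subset PGL(2,\mathbb{R})$ (the image in $PGL(2,\mathbb{R})$ of the group of derivatives of affine automorphisms of $S_O$, orientation-reversing ones included) is generated by $\alpha=\begin{pmatrix}1&0\\0&-1\end{pmatrix}$, $\beta=\nu_1$ and $\gamma$; these act as reflections in the sides of the hyperbolic triangle $\mathscr{F}$ with vertices $\sqrt{-1}$ (angle $\pi/4$; it corresponds to the center of $\mathbb{D}$), $0$ and $1-\sqrt2$ (ideal), which is a strict fundamental domain for $V_P(S_O)$. $E_0$ is the geodesic with endpoints $0$ and $1-\sqrt2$, $E_i=E_0\nu_i$, and $\mathscr{O}$ is the ideal octagon bounded by $E_0,\dots,E_7$ and containing $\sqrt{-1}$. $\mathscr{E}_i$ is the closed boundary arc lying under $E_i$, i.e. the arc of $\partial\mathbb{H}=\mathbb{R}\cup\{\infty\}$ (identified with $\partial\mathbb{D}$) bounded by the endpoints of $E_i$ and containing no other endpoints of sides of $\mathscr{O}$, and $\mathscr{E}=\mathscr{E}_1\cup\dots\cup\mathscr{E}_7$.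 Cross section. $\tilde{\mathscr{S}}$ is the set of unit tangent vectors $(z,w)\in T_1\mathbb{D}$ with $z\in E_0$ such that the geodesic through $z$ in direction $w$ has backward endpoint $g_-\in\mathscr{E}_0$ and forward endpoint $g_+\in\mathscr{E}$; it is parametrized by $(g_+,g_-)\in\mathscr{E}\times\mathscr{E}_0$. $\mathscr{S}$ is its projection to $T_1\mathbb{D}/V_P(S_O)$. Geodesics in the quotient are projections of hyperbolic geodesics.
   Formalization: The conjugacy is stated off the V_P-orbit of the ideal vertices; elsewhere, coordinates are a homeomorphism off vectors tangent to E_0, a point returns iff g_+ is not an octagon vertex, and returning points satisfy the relation; literally it fails at sector endpoints (u=1). *)

theory Defs
  imports "HOL-Analysis.Analysis"
begin

section \<open>Matrices and their actions\<close>

definition mat22 :: "real \<Rightarrow> real \<Rightarrow> real \<Rightarrow> real \<Rightarrow> real^2^2" where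
  "mat22 a b c d = vector [vector [a, b], vector [c, d]]"

definition alpha :: "real^2^2" where
  "alpha = mat22 1 0 0 (-1)"

definition gamma :: "real^2^2" where
  "gamma = mat22 (-1) (2 * (1 + sqrt 2)) 0 1"

definition nu :: "nat \<Rightarrow> real^2^2" where
  "nu i =
    [mat22 1 0 0 1,
     (1 / sqrt 2) *\<^sub>R mat22 1 1 1 (-1),
     (1 / sqrt 2) *\<^sub>R mat22 1 1 (-1) 1,
     mat22 0 1 1 0,
     mat22 0 1 (-1) 0,
     (1 / sqrt 2) *\<^sub>R mat22 (-1) 1 1 1,
     (1 / sqrt 2) *\<^sub>R mat22 (-1) 1 (-1) (-1),
     mat22 (-1) 0 0 1] ! i"

definition beta :: "real^2^2" where
  "beta = nu 1"

text \<open>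
  The group \<open>V\<^sub>P(S\<^sub>O)\<close> of the regular octagon surface (derivatives of its affine
  automorphisms, up to sign), given by its known generators. Its elements are represented by matrices of determinant \<open>1\<close> or \<open>-1\<close>. The matrix \<open>-1\<close> acts
  trivially on the hyperbolic plane, so orbits below are orbits of the image of
  this group in \<open>PGL(2, \<real>)\<close>.
\<close>
inductive_set V_P :: "(real^2^2) set" where
  one: "mat 1 \<in> V_P"
| gen: "g \<in> {alpha, beta, gamma} \<Longrightarrow> g \<in> V_P"
| mult: "g \<in> V_P \<Longrightarrow> h \<in> V_P \<Longrightarrow> g ** h \<in> V_P"
| inv: "g \<in> V_P \<Longrightarrow> matrix_inv g \<in> V_P"

text \<open>
  Both \<open>\<real>\<P>\<^sup>1\<close> (in the inverse slope coordinate) and the boundary \<open>\<real> \<union> {\<infinity>}\<close> of the upper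
  half-plane are represented by \<^typ>\<open>real option\<close>, where \<^const>\<open>None\<close> is \<open>\<infinity>\<close>; the topology
  is that of the one-point compactification of the line.
\<close>
definition RP1 :: "real option topology" where
  "RP1 = Alexandroff_compactification euclideanreal"

fun mobius :: "real^2^2 \<Rightarrow> real option \<Rightarrow> real option" where
  "mobius L None = (if L$2$1 = 0 then None else Some (L$1$1 / L$2$1))"
| "mobius L (Some u) =
    (if L$2$1 * u + L$2$2 = 0 then None
     else Some ((L$1$1 * u + L$1$2) / (L$2$1 * u + L$2$2)))"

definition hyp_act :: "complex \<Rightarrow> real^2^2 \<Rightarrow> complex" where
  "hyp_act z n =
    (let w = (if det n = 1 then z else cnj z)
     in (of_real (n$1$1) * w + of_real (n$2$1)) / (of_real (n$1$2) * w + of_real (n$2$2)))"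

text \<open>The extension of \<^const>\<open>hyp_act\<close> to the boundary is \<open>x \<mapsto> (a x + c) / (b x + d)\<close>.\<close>
definition bdry_act :: "real option \<Rightarrow> real^2^2 \<Rightarrow> real option" where
  "bdry_act x n = mobius (transpose n) x"

definition tangent_act :: "complex \<times> complex \<Rightarrow> real^2^2 \<Rightarrow> complex \<times> complex" where
  "tangent_act p n =
    (hyp_act (fst p) n, frechet_derivative (\<lambda>z. hyp_act z n) (at (fst p)) (snd p))"


section \<open>The map on pairs of directions\<close>

definition direction :: "real \<Rightarrow> real option" where
  "direction \<theta> = (if sin \<theta> = 0 then None else Some (cot \<theta>))"

definition sector :: "nat \<Rightarrow> real option set" where
  "sector i = direction ` {real i * pi / 8 ..< real (i + 1) * pi / 8}"

definition Sigma_sectors :: "real option set" where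
  "Sigma_sectors = (\<Union>i\<in>{1..7}. sector i)"

definition F_hat :: "real option \<times> real option \<Rightarrow> real option \<times> real option" where
  "F_hat p =
    (let i = (THE i. i \<in> {1..7} \<and> fst p \<in> sector i)
     in (mobius (gamma ** nu i) (fst p), mobius (gamma ** nu i) (snd p)))"


section \<open>Hyperbolic plane and geodesic flow\<close>

text \<open>
  The disk is replaced throughout by the upper half-plane, to which it is isometric via
  \<open>z \<mapsto> (z - i) / (z + i)\<close>.
\<close>
definition hyp_dist :: "complex \<Rightarrow> complex \<Rightarrow> real" where
  "hyp_dist z w = arcosh (1 + (cmod (z - w))\<^sup>2 / (2 * Im z * Im w))"

definition geodesic :: "(real \<Rightarrow> complex) \<Rightarrow> bool" where
  "geodesic c \<longleftrightarrow> (\<forall>t. Im (c t) > 0) \<and> (\<forall>s t. hyp_dist (c s) (c t) = \<bar>s - t\<bar>)"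

text \<open>The hyperbolic length of a tangent vector \<open>w\<close> at \<open>z\<close> is \<open>\<bar>w\<bar> / Im z\<close>.\<close>
definition T1 :: "(complex \<times> complex) set" where
  "T1 = {(z, w). Im z > 0 \<and> cmod w = Im z}"

definition geodesic_of :: "complex \<times> complex \<Rightarrow> real \<Rightarrow> complex" where
  "geodesic_of p =
    (THE c. geodesic c \<and> c 0 = fst p \<and> (c has_vector_derivative snd p) (at 0))"

definition geod_flow :: "real \<Rightarrow> complex \<times> complex \<Rightarrow> complex \<times> complex" where
  "geod_flow t p = (geodesic_of p t, vector_derivative (geodesic_of p) (at t))"

fun tends_to_bdry :: "(real \<Rightarrow> complex) \<Rightarrow> real filter \<Rightarrow> real option \<Rightarrow> bool" where
  "tends_to_bdry c F None \<longleftrightarrow> filterlim c at_infinity F"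
| "tends_to_bdry c F (Some x) \<longleftrightarrow> (c \<longlongrightarrow> complex_of_real x) F"

definition fwd_end :: "complex \<times> complex \<Rightarrow> real option" where
  "fwd_end p = (THE x. tends_to_bdry (geodesic_of p) at_top x)"

definition bwd_end :: "complex \<times> complex \<Rightarrow> real option" where
  "bwd_end p = (THE x. tends_to_bdry (geodesic_of p) at_bot x)"

definition geodesic_line :: "real option \<Rightarrow> real option \<Rightarrow> complex set" where
  "geodesic_line x y =
    {z. \<exists>c. geodesic c \<and> tends_to_bdry c at_bot x \<and> tends_to_bdry c at_top y \<and> z \<in> range c}"


section \<open>The quotient of the unit tangent bundle\<close>

definition proj :: "complex \<times> complex \<Rightarrow> (complex \<times> complex) set" where
  "proj p = tangent_act p ` V_P"

definition quotient_top :: "(complex \<times> complex) set topology" where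
  "quotient_top = topology (\<lambda>U. U \<subseteq> proj ` T1 \<and> openin (top_of_set T1) {p \<in> T1. proj p \<in> U})"

text \<open>
  The flow commutes with isometries, so the image of an orbit is again an orbit.
\<close>
definition quot_flow :: "real \<Rightarrow> (complex \<times> complex) set \<Rightarrow> (complex \<times> complex) set" where
  "quot_flow t x = geod_flow t ` x"


section \<open>The ideal octagon and the cross section\<close>

definition E_ends :: "nat \<Rightarrow> real option set" where
  "E_ends i = (\<lambda>x. bdry_act x (nu i)) ` {Some 0, Some (1 - sqrt 2)}"

definition E_0 :: "complex set" where
  "E_0 = geodesic_line (Some 0) (Some (1 - sqrt 2))"

definition oct_vertices :: "real option set" where
  "oct_vertices = (\<Union>i\<in>{0..7}. E_ends i)"

text \<open>
  The closed arc from the first to the second point, in the direction of increasing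
  reals, for distinct points; two distinct points bound two arcs.
\<close>
fun bdry_arc :: "real option \<Rightarrow> real option \<Rightarrow> real option set" where
  "bdry_arc (Some a) (Some b) =
    (if a \<le> b then Some ` {a..b} else insert None (Some ` ({a..} \<union> {..b})))"
| "bdry_arc (Some a) None = insert None (Some ` {a..})"
| "bdry_arc None (Some b) = insert None (Some ` {..b})"
| "bdry_arc None None = {None}"

definition E_arc :: "nat \<Rightarrow> real option set" where
  "E_arc i = (THE A. (\<exists>x y. E_ends i = {x, y} \<and> A = bdry_arc x y) \<and>
                     A \<inter> oct_vertices = E_ends i)"

definition lifted_section :: "(complex \<times> complex) set" where
  "lifted_section =
    {p \<in> T1. fst p \<in> E_0 \<and> bwd_end p \<in> E_arc 0 \<and> fwd_end p \<in> (\<Union>i\<in>{1..7}. E_arc i)}"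

definition cross_section :: "(complex \<times> complex) set set" where
  "cross_section = proj ` lifted_section"

definition lift :: "(complex \<times> complex) set \<Rightarrow> complex \<times> complex" where
  "lift x = (THE p. p \<in> lifted_section \<and> proj p = x)"

text \<open>
  A boundary point \<open>x\<close> corresponds to the direction with inverse slope \<open>-1 / x\<close>. With this
  identification, right multiplication by \<open>\<nu>\<close> on the boundary is the action of \<open>\<nu>\<^sup>-\<^sup>1\<close> on
  directions, and the arc under \<open>E\<^sub>i\<close> is the closure of the sector \<open>\<Sigma>\<^sub>i\<close>.
\<close>
definition bdry_direction :: "real option \<Rightarrow> real option" where
  "bdry_direction = mobius (mat22 0 (-1) 1 0)"

definition endpoint_coords :: "(complex \<times> complex) set \<Rightarrow> real option \<times> real option" where
  "endpoint_coords x = (bdry_direction (fwd_end (lift x)), bdry_direction (bwd_end (lift x)))"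

text \<open>
  Boundary points have to be excluded on both sides of the conjugacy: the half-open
  sectors are not respected by the orientation-reversing \<open>\<nu>\<^sub>i\<close>, a vector of the
  section with an endpoint in common with \<open>E\<^sub>0\<close> is tangent to \<open>E\<^sub>0\<close>, and a geodesic ending
  in a vertex of the octagon does not return. Here \<open>N\<close> is a set of excluded endpoints.
\<close>
definition section_avoiding :: "real option set \<Rightarrow> (complex \<times> complex) set set" where
  "section_avoiding N = proj ` {p \<in> lifted_section. fwd_end p \<notin> N \<and> bwd_end p \<notin> N}"

definition domain_avoiding :: "real option set \<Rightarrow> (real option \<times> real option) set" where
  "domain_avoiding N =
    {(u, v) \<in> Sigma_sectors \<times> sector 0. u \<notin> bdry_direction ` N \<and> v \<notin> bdry_direction ` N}"

text \<open>The orbit of the ideal vertices, a countable set.\<close>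
definition cusps :: "real option set" where
  "cusps = {bdry_act x g | x g. x \<in> E_ends 0 \<and> g \<in> V_P}"


section \<open>First returns and conjugacies\<close>

definition first_return_time :: "(real \<Rightarrow> 'a \<Rightarrow> 'a) \<Rightarrow> 'a set \<Rightarrow> 'a \<Rightarrow> real \<Rightarrow> bool" where
  "first_return_time \<phi> S x t \<longleftrightarrow> 0 < t \<and> \<phi> t x \<in> S \<and> (\<forall>s. 0 < s \<and> s < t \<longrightarrow> \<phi> s x \<notin> S)"

definition returns :: "(real \<Rightarrow> 'a \<Rightarrow> 'a) \<Rightarrow> 'a set \<Rightarrow> 'a \<Rightarrow> bool" where
  "returns \<phi> S x \<longleftrightarrow> (\<exists>t. first_return_time \<phi> S x t)"

definition first_return :: "(real \<Rightarrow> 'a \<Rightarrow> 'a) \<Rightarrow> 'a set \<Rightarrow> 'a \<Rightarrow> 'a" where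
  "first_return \<phi> S x = \<phi> (THE t. first_return_time \<phi> S x t) x"

definition conjugacy ::
  "('a \<Rightarrow> 'b) \<Rightarrow> 'a topology \<Rightarrow> ('a \<Rightarrow> 'a) \<Rightarrow> 'b topology \<Rightarrow> ('b \<Rightarrow> 'b) \<Rightarrow> bool" where
  "conjugacy h X f Y g \<longleftrightarrow>
    homeomorphic_map X Y h \<and> f \<in> topspace X \<rightarrow> topspace X \<and> g \<in> topspace Y \<rightarrow> topspace Y \<and>
    (\<forall>x\<in>topspace X. h (f x) = g (h x))"


section \<open>The billiard in the triangle\<close>

text \<open>
  The closed triangle with vertices \<open>i\<close>, \<open>0\<close> and \<open>1 - \<surd>2\<close>. Its sides lie on the fixed lines
  \<open>Re z = 0\<close> of \<open>\<alpha>\<close>, \<open>\<bar>z - 1\<bar>\<^sup>2 = 2\<close> of \<open>\<beta>\<close>, and \<open>(1 + \<surd>2) \<bar>z\<bar>\<^sup>2 + Re z = 0\<close> of \<open>\<gamma>\<close>, the last being \<open>E\<^sub>0\<close>.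
\<close>
definition triangle :: "complex set" where
  "triangle =
    {z. Im z > 0 \<and> Re z \<le> 0 \<and> (cmod (z - 1))\<^sup>2 \<le> 2 \<and> (1 + sqrt 2) * (cmod z)\<^sup>2 + Re z \<ge> 0}"

definition T1_triangle :: "(complex \<times> complex) set" where
  "T1_triangle = {p \<in> T1. fst p \<in> triangle}"

text \<open>
  \<open>billiard p t q\<close>: the billiard flow moves \<open>p\<close> to \<open>q\<close> in time \<open>t\<close>. At a point of a side a
  vector is identified with its reflection in that side; at the vertex \<open>i\<close>, whose angle
  is \<open>\<pi>/4\<close>, both reflections are available and the trajectory continues accordingly.
\<close>
inductive billiard :: "complex \<times> complex \<Rightarrow> real \<Rightarrow> complex \<times> complex \<Rightarrow> bool" where
  glide: "p \<in> T1_triangle \<Longrightarrow> t \<ge> 0 \<Longrightarrow> (\<forall>s. 0 \<le> s \<and> s \<le> t \<longrightarrow> geod_flow s p \<in> T1_triangle)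
    \<Longrightarrow> billiard p t (geod_flow t p)"
| bounce: "p \<in> T1_triangle \<Longrightarrow> r \<in> {alpha, beta, gamma} \<Longrightarrow> hyp_act (fst p) r = fst p
    \<Longrightarrow> billiard p 0 (tangent_act p r)"
| comp: "billiard p s q \<Longrightarrow> billiard q t r \<Longrightarrow> billiard p (s + t) r"

text \<open>
  The flow on the quotient is the billiard flow: every point of the quotient is
  represented by a vector over the triangle, and a representative moves to another one
  under the billiard flow exactly if the flow on the quotient moves the represented points.
\<close>
definition quot_flow_is_billiard :: bool where
  "quot_flow_is_billiard \<longleftrightarrow>
    proj ` T1_triangle = proj ` T1 \<and>
    (\<forall>p\<in>T1_triangle. \<forall>q\<in>T1_triangle. \<forall>t\<ge>0.
      billiard p t q \<longleftrightarrow> quot_flow t (proj p) = proj q)"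

end

theory Submission
  imports Defs
begin

text \<open>
  Let \<open>N\<close> be a real matrix of determinant \<open>1\<close> or \<open>-1\<close> with rows \<open>r\<^sub>1 = (m, n)\<close> and \<open>r\<^sub>2 = (k, l)\<close>. It
  stands for the unit vector at time \<open>0\<close> on the geodesic from \<open>k / l\<close> to \<open>m / n\<close>, with a
  normalization of the rows that fixes the base point. All unit vectors arise in this way, and all
  objects of the theorem turn into matrix products: the geodesic flow multiplies \<open>r\<^sub>1\<close> by
  \<open>e\<^sup>t\<^sup>/\<^sup>2\<close> and \<open>r\<^sub>2\<close> by its inverse, the group acts by multiplication from the right, for
  orientation reversing elements as well, and the ends of the geodesic are the rows up to scaling.
  A geodesic line is the zero set of a function \<open>(a \<bar>z\<bar>\<^sup>2 + b Re z + c) / Im z\<close>. At the point given by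
  \<open>N\<close> this is \<open>q(r\<^sub>1) + q(r\<^sub>2)\<close> with \<open>q(x, y) = a x\<^sup>2 + b x y + c y\<^sup>2\<close>, and after time \<open>t\<close> it is
  \<open>e\<^sup>t q(r\<^sub>1) + e\<^sup>-\<^sup>t q(r\<^sub>2)\<close>. So the sides that a geodesic crosses, and their order, can be read off from the
  signs of quadratic forms at its two ends. This is why the return map is a map of end points.

  \<^emph>\<open>The group.\<close> \<open>V\<^sub>P\<close> is generated by the dihedral group \<open>{\<plusminus>\<nu>\<^sub>i}\<close> of \<open>\<alpha>\<close>, \<open>\<beta>\<close> and by the
  reflection \<open>\<gamma>\<close> in \<open>E\<^sub>0\<close>. If \<open>q\<close> is the form of \<open>E\<^sub>0\<close>, then \<open>q(r) + q(r d)\<close> is a positive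
  semidefinite form for every dihedral \<open>d \<noteq> \<plusminus>1\<close>; in other words, the half planes beyond the sides of
  the octagon are disjoint. Playing ping-pong with them on reduced words \<open>d\<^sub>0 \<gamma> d\<^sub>1 \<gamma> \<dots> d\<^sub>k\<close> shows that the
  triangle is a strict fundamental domain, and that the stabilizer of a point of it is generated by the
  reflections in the sides through that point (\<open>strict_fundamental_domain\<close>). Each orbit meets the
  triangle because a reflection of a point beyond \<open>E\<^sub>0\<close> in \<open>E\<^sub>0\<close> decreases its distance from \<open>\<i>\<close>, and
  does so by a definite amount unless it leads into the octagon (\<open>octagon_reached\<close>).

  \<^emph>\<open>The first return.\<close> A vector of the section that is not tangent to \<open>E\<^sub>0\<close> enters the octagon. No
  translate of \<open>E\<^sub>0\<close> meets the interior of the octagon, so the flow returns exactly when the geodesic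
  leaves the octagon through some \<open>E\<^sub>i\<close>, and \<open>i\<close> is given by the sector that contains the forward end.
  There \<open>\<nu>\<^sub>i\<^sup>-\<^sup>1 \<gamma>\<close> moves the vector back to the section. In the coordinate \<open>-1/x\<close> this is the action of
  \<open>\<gamma> \<nu>\<^sub>i\<close>, hence \<open>F_hat\<close> (\<open>first_return_section\<close>). A geodesic that ends in a vertex
  either stays in the octagon for ever or is \<open>E\<^sub>0\<close> itself, and then it never leaves the section; in both
  cases there is no first return.

  \<^emph>\<open>The topology.\<close> A vector of the section that is not tangent to \<open>E\<^sub>0\<close> is a continuous function
  of its two ends, which gives one direction of the homeomorphism. For the other one a small neighbourhood of a vector transverse to
  \<open>E\<^sub>0\<close> has to be moved by \<open>V\<^sub>P\<close>: by strictness only \<open>\<plusminus>1\<close> and \<open>\<plusminus>\<gamma>\<close> can lead back to the section, and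
  \<open>\<gamma>\<close> leads to vectors that point out of the octagon (\<open>section_neighbourhood\<close>).

  \<^emph>\<open>The billiard.\<close> The sign of \<open>e\<^sup>t a + e\<^sup>-\<^sup>t b\<close> is constant for small \<open>t > 0\<close>. Therefore a geodesic stays in
  one translate of the triangle for a short time after, and before, each of its points, and by compactness
  a segment is a finite chain of pieces in translates of the triangle. Consecutive translates have a point
  in common and differ by its stabilizer, that is, by a sequence of bounces (\<open>billiard_follows_flow\<close>).
\<close>

section \<open>Frames\<close>

lemma mat22_nth [simp]:
  "mat22 a b c d $ 1 $ 1 = a" "mat22 a b c d $ 1 $ 2 = b"
  "mat22 a b c d $ 2 $ 1 = c" "mat22 a b c d $ 2 $ 2 = d"
  by (simp_all add: mat22_def)

lemma matrix_mult_nth: "(M ** N) $ i $ j = M$i$1 * N$1$j + M$i$2 * N$2$j"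
  for M N :: "real^2^2"
  by (simp add: matrix_matrix_mult_def sum_2)

lemma vector_mult_nth: "(r v* M) $ j = r$1 * M$1$j + r$2 * M$2$j"
  for r :: "real^2" and M :: "real^2^2"
  by (simp add: vector_matrix_mult_def sum_2 mult.commute)

lemma row_mult: "(M ** N) $ i = M $ i v* N" for M N :: "real^2^2"
  by (simp add: vec_eq_iff matrix_mult_nth vector_mult_nth)

lemma matrix_eq_iff: "M = N \<longleftrightarrow> M$1$1 = N$1$1 \<and> M$1$2 = N$1$2 \<and> M$2$1 = N$2$1 \<and> M$2$2 = N$2$2"
  for M N :: "real^2^2"
  by (auto simp: vec_eq_iff forall_2)

lemma mat22_mult: "mat22 a b c d ** mat22 a' b' c' d' =
    mat22 (a * a' + b * c') (a * b' + b * d') (c * a' + d * c') (c * b' + d * d')"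
  by (simp add: matrix_eq_iff matrix_mult_nth)

definition unimodular :: "real^2^2 \<Rightarrow> bool" where
  "unimodular N \<longleftrightarrow> \<bar>det N\<bar> = 1"

lemma unimodular_mult: "unimodular M \<Longrightarrow> unimodular N \<Longrightarrow> unimodular (M ** N)"
  by (simp add: unimodular_def det_mul abs_mult)

lemma unimodular_iff: "unimodular N \<longleftrightarrow> det N = 1 \<or> det N = -1"
  by (auto simp: unimodular_def)

lemma unimodular_square: "unimodular N \<longleftrightarrow> (N$1$1 * N$2$2 - N$1$2 * N$2$1)\<^sup>2 = 1"
  by (simp add: unimodular_iff det_2 power2_eq_1_iff)

text \<open>
  The value at a row is the value of the form at the boundary point that it represents, up to a positive
  factor. Adding the values at both rows gives \<open>a A + b B + c D\<close> for the hyperboloid coordinates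
  \<open>A = \<bar>z\<bar>\<^sup>2 / Im z\<close>, \<open>B = Re z / Im z\<close>, \<open>D = 1 / Im z\<close> of the base point, see \<open>coord_pt\<close> below.
\<close>
definition form :: "real \<Rightarrow> real \<Rightarrow> real \<Rightarrow> real^2 \<Rightarrow> real" where
  "form a b c r = a * (r$1)\<^sup>2 + b * r$1 * r$2 + c * (r$2)\<^sup>2"

definition Form :: "real \<Rightarrow> real \<Rightarrow> real \<Rightarrow> real^2^2 \<Rightarrow> real" where
  "Form a b c N = form a b c (N$1) + form a b c (N$2)"

abbreviation "form_A \<equiv> form 1 0 0"
abbreviation "form_B \<equiv> form 0 1 0"
abbreviation "form_D \<equiv> form 0 0 1"
abbreviation "Form_A \<equiv> Form 1 0 0"
abbreviation "Form_B \<equiv> Form 0 1 0"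
abbreviation "Form_D \<equiv> Form 0 0 1"

lemma Form_expand: "Form a b c N = a * Form_A N + b * Form_B N + c * Form_D N"
  by (simp add: Form_def form_def algebra_simps)

text \<open>
  For determinant \<open>\<plusminus>1\<close> this is the equation \<open>A D - B\<^sup>2 = 1\<close> of the hyperboloid.
\<close>
lemma Form_det: "Form_A N * Form_D N - (Form_B N)\<^sup>2 = (N$1$1 * N$2$2 - N$1$2 * N$2$1)\<^sup>2"
  by (simp add: Form_def form_def power2_eq_square algebra_simps)

lemma Form_unimodular: "unimodular N \<Longrightarrow> Form_A N * Form_D N = (Form_B N)\<^sup>2 + 1"
  using Form_det[of N] by (simp add: unimodular_square)

lemma Form_pos: assumes "unimodular N" shows "Form_A N > 0" "Form_D N > 0"
proof -
  have "Form_A N \<ge> 0" "Form_D N \<ge> 0" by (auto simp: Form_def form_def)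
  moreover have "Form_A N * Form_D N > 0"
    using Form_unimodular[OF assms] by (smt (verit) zero_le_power2)
  ultimately show "Form_A N > 0" "Form_D N > 0"
    by (auto simp: zero_less_mult_iff)
qed

text \<open>
  The image \<open>(m \<i> + k) / (n \<i> + l)\<close> of \<open>\<i>\<close>, with \<open>-\<i>\<close> in place of \<open>\<i>\<close> if the determinant is negative.
  This formula in the coordinates \<open>B\<close> and \<open>D\<close> makes no distinction between the two cases.
\<close>
definition pt :: "real^2^2 \<Rightarrow> complex" where
  "pt N = Complex (Form_B N / Form_D N) (1 / Form_D N)"

definition flow_mat :: "real \<Rightarrow> real^2^2" where
  "flow_mat t = mat22 (exp (t/2)) 0 0 (exp (-t/2))"

definition geo :: "real^2^2 \<Rightarrow> real \<Rightarrow> complex" where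
  "geo N t = pt (flow_mat t ** N)"

lemma exp_half_square: "(exp (t/2))\<^sup>2 = exp (t::real)"
  by (simp add: power2_eq_square flip: exp_add)

lemma form_flow:
  "form a b c ((flow_mat t ** N)$1) = exp t * form a b c (N$1)"
  "form a b c ((flow_mat t ** N)$2) = exp (-t) * form a b c (N$2)"
proof -
  have *: "form a b c r = e\<^sup>2 * form a b c r'" if "r = e *\<^sub>R r'" for e r r'
    by (simp add: that form_def power2_eq_square algebra_simps)
  have "(flow_mat t ** N)$1 = exp (t/2) *\<^sub>R (N$1)" "(flow_mat t ** N)$2 = exp (-t/2) *\<^sub>R (N$2)"
    by (simp_all add: vec_eq_iff matrix_mult_nth flow_mat_def)
  from this[THEN *] show "form a b c ((flow_mat t ** N)$1) = exp t * form a b c (N$1)"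
    "form a b c ((flow_mat t ** N)$2) = exp (-t) * form a b c (N$2)"
    using exp_half_square[of t] exp_half_square[of "-t"] by simp_all
qed

lemma Form_flow: "Form a b c (flow_mat t ** N) = exp t * form a b c (N$1) + exp (-t) * form a b c (N$2)"
  by (simp add: Form_def form_flow)

lemma unimodular_flow [simp]: "unimodular (flow_mat t)"
  by (simp add: unimodular_iff det_2 flow_mat_def flip: exp_add)

lemma flow_mat_0 [simp]: "flow_mat 0 = mat 1"
  by (simp add: flow_mat_def matrix_eq_iff mat_def)

lemma flow_mat_add: "flow_mat s ** flow_mat t = flow_mat (s + t)"
  by (simp add: flow_mat_def mat22_mult add_divide_distrib diff_divide_distrib flip: exp_add)

lemma geo_0 [simp]: "geo N 0 = pt N"
  by (simp add: geo_def)

text \<open>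
  The base point and the velocity of \<open>geo N\<close> at time \<open>0\<close>. In hyperboloid coordinates a geodesic is \<open>e\<^sup>t P + e\<^sup>-\<^sup>t Q\<close>, where \<open>P\<close> and
  \<open>Q\<close> are the null vectors \<open>(m\<^sup>2, m n, n\<^sup>2)\<close> and \<open>(k\<^sup>2, k l, l\<^sup>2)\<close> of the two rows, so the velocity is \<open>P - Q\<close>,
  here translated back to the half-plane.
\<close>
definition frame :: "real^2^2 \<Rightarrow> complex \<times> complex" where
  "frame N = (pt N,
    let B' = form_B (N$1) - form_B (N$2); D' = form_D (N$1) - form_D (N$2)
    in Complex ((B' * Form_D N - Form_B N * D') / (Form_D N)\<^sup>2) (- D' / (Form_D N)\<^sup>2))"

lemma fst_frame [simp]: "fst (frame N) = pt N"
  by (simp add: frame_def)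

lemma geo_derivative:
  assumes "unimodular N"
  shows "(geo N has_vector_derivative snd (frame (flow_mat t ** N))) (at t)"
proof -
  let ?B = "\<lambda>t. exp t * form_B (N$1) + exp (-t) * form_B (N$2)"
  let ?D = "\<lambda>t. exp t * form_D (N$1) + exp (-t) * form_D (N$2)"
  have D: "?D t \<noteq> 0"
    using Form_pos(2)[OF unimodular_mult[OF unimodular_flow assms, of t]] by (simp add: Form_flow)
  have g: "geo N = (\<lambda>t. Complex (?B t / ?D t) (1 / ?D t))"
    by (simp add: geo_def pt_def Form_flow fun_eq_iff)
  show ?thesis
    unfolding g has_vector_derivative_complex_iff frame_def Let_def snd_conv
    using D
    by (auto simp: Form_flow form_flow power2_eq_square intro!: derivative_eq_intros)
qed

section \<open>Geodesics\<close>

definition coordA :: "complex \<Rightarrow> real" where "coordA z = (cmod z)\<^sup>2 / Im z"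
definition coordB :: "complex \<Rightarrow> real" where "coordB z = Re z / Im z"
definition coordD :: "complex \<Rightarrow> real" where "coordD z = 1 / Im z"

lemma coord_det: "Im z > 0 \<Longrightarrow> coordA z * coordD z - (coordB z)\<^sup>2 = 1"
  unfolding coordA_def coordB_def coordD_def cmod_power2 by (simp add: field_simps power2_eq_square)

lemma coord_pos: "Im z > 0 \<Longrightarrow> coordA z > 0" "Im z > 0 \<Longrightarrow> coordD z > 0"
  by (auto simp: coordA_def coordD_def complex_eq_iff)

lemma coord_inject:
  assumes "Im z > 0" "Im w > 0" "coordB z = coordB w" "coordD z = coordD w"
  shows "z = w"
  using assms by (auto simp: coordB_def coordD_def complex_eq_iff field_simps)

lemma coord_pt:
  assumes "unimodular N"
  shows "coordA (pt N) = Form_A N" "coordB (pt N) = Form_B N" "coordD (pt N) = Form_D N" "Im (pt N) > 0"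
proof -
  note pos = Form_pos[OF assms] and un = Form_unimodular[OF assms]
  show "coordA (pt N) = Form_A N"
  proof -
    have "((Form_B N / Form_D N)\<^sup>2 + (1 / Form_D N)\<^sup>2) * Form_D N = ((Form_B N)\<^sup>2 + 1) / Form_D N"
      using pos by (simp add: field_simps power2_eq_square)
    also have "\<dots> = Form_A N" using pos un by (simp add: field_simps)
    finally show ?thesis unfolding coordA_def cmod_power2 using pos by (simp add: pt_def)
  qed
  show "coordB (pt N) = Form_B N" "coordD (pt N) = Form_D N" "Im (pt N) > 0"
    using pos by (simp_all add: coordB_def coordD_def pt_def)
qed

lemma pt_eqI:
  assumes "unimodular M" "unimodular N" "Form_B M = Form_B N" "Form_A M = Form_A N \<or> Form_D M = Form_D N"
  shows "pt M = pt N"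
proof -
  have "Form_D M = Form_D N"
    using Form_unimodular[OF assms(1)] Form_unimodular[OF assms(2)] assms(3,4) Form_pos[OF assms(1)]
    by (metis mult_left_cancel less_irrefl)
  thus ?thesis using assms(3) by (simp add: pt_def)
qed

text \<open>
  The Lorentz form of the hyperboloid model, for which \<open>cosh\<close> of the distance is the pairing.
\<close>
definition pairing :: "complex \<Rightarrow> complex \<Rightarrow> real" where
  "pairing z w = (coordA z * coordD w + coordD z * coordA w) / 2 - coordB z * coordB w"

lemma hyp_dist_pairing:
  assumes "Im z > 0" "Im w > 0"
  shows "hyp_dist z w = arcosh (pairing z w)" "pairing z w \<ge> 1"
proof -
  have eq: "pairing z w = 1 + (cmod (z - w))\<^sup>2 / (2 * Im z * Im w)"
    using assms unfolding pairing_def coordA_def coordB_def coordD_def cmod_power2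
    by (simp add: field_simps power2_eq_square)
  show "hyp_dist z w = arcosh (pairing z w)" by (simp add: hyp_dist_def eq)
  show "pairing z w \<ge> 1" using assms by (simp add: eq)
qed

lemma geodesic_iff:
  "geodesic c \<longleftrightarrow> (\<forall>t. Im (c t) > 0) \<and> (\<forall>s t. pairing (c s) (c t) = cosh (s - t))"
proof -
  have "hyp_dist (c s) (c t) = \<bar>s - t\<bar> \<longleftrightarrow> pairing (c s) (c t) = cosh (s - t)"
    if "\<forall>t. Im (c t) > 0" for s t
  proof -
    have *: "hyp_dist (c s) (c t) = arcosh (pairing (c s) (c t))" "pairing (c s) (c t) \<ge> 1"
      using hyp_dist_pairing that by auto
    have "cosh \<bar>s - t\<bar> = cosh (s - t)" by (simp add: abs_if flip: cosh_minus[of "s-t"])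
    thus ?thesis using *
      by (metis abs_ge_zero arcosh_cosh_real cosh_arcosh_real)
  qed
  thus ?thesis by (auto simp: geodesic_def)
qed

lemma geodesic_geo: assumes "unimodular N" shows "geodesic (geo N)"
proof -
  have u: "unimodular (flow_mat t ** N)" for t using assms by (simp add: unimodular_mult)
  have "pairing (geo N s) (geo N t) = cosh (s - t)" for s t
  proof -
    have e: "exp (s - t) = exp s * exp (-t)" "exp (t - s) = exp t * exp (-s)"
      "exp (-s) * exp s = 1" "exp (-t) * exp t = 1"
      by (simp_all flip: exp_add)
    let ?d = "(N$1$1 * N$2$2 - N$1$2 * N$2$1)\<^sup>2"
    have "pairing (geo N s) (geo N t) =
      ((exp s * exp (-t) + exp t * exp (-s)) * ?d) / 2"
      unfolding pairing_def geo_def coord_pt[OF u] Form_flow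
      by (simp add: form_def power2_eq_square algebra_simps)
    also have "\<dots> = cosh (s - t)"
      using assms by (simp add: unimodular_square cosh_def flip: exp_add)
    finally show ?thesis .
  qed
  thus ?thesis using coord_pt(4)[OF u] by (simp add: geodesic_iff geo_def)
qed

text \<open>
  A null vector on the same side as a point of the hyperboloid lies on the closed forward light cone, and
  there it is a square. The bound \<open>2 \<bar>b B\<bar> \<le> \<bar>a\<bar> D + \<bar>d\<bar> A\<close> excludes the backward cone.
\<close>
lemma null_vector_square:
  fixes A B D a b d :: real
  assumes X: "A > 0" "D > 0" "A * D - B\<^sup>2 = 1" and P: "a * d = b\<^sup>2" "a * D + d * A - 2 * b * B > 0"
  shows "\<exists>m n. a = m\<^sup>2 \<and> b = m * n \<and> d = n\<^sup>2"
proof -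
  have le: "2 * \<bar>b * B\<bar> \<le> \<bar>a\<bar> * D + \<bar>d\<bar> * A"
  proof (rule power2_le_imp_le)
    have "\<bar>a\<bar> * \<bar>d\<bar> = b\<^sup>2" using P(1) by (metis abs_mult abs_power2)
    moreover have "B\<^sup>2 \<le> A * D" using X(3) by simp
    ultimately have "b\<^sup>2 * B\<^sup>2 \<le> (\<bar>a\<bar> * \<bar>d\<bar>) * (A * D)"
      by (simp add: mult_left_mono)
    hence "b\<^sup>2 * B\<^sup>2 \<le> (\<bar>a\<bar> * D) * (\<bar>d\<bar> * A)"
      by (simp only: mult_ac)
    moreover have "4 * ((\<bar>a\<bar> * D) * (\<bar>d\<bar> * A)) \<le> (\<bar>a\<bar> * D + \<bar>d\<bar> * A)\<^sup>2"
      using zero_le_power2[of "\<bar>a\<bar> * D - \<bar>d\<bar> * A"]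
      by (simp add: power2_eq_square algebra_simps)
    ultimately show "(2 * \<bar>b * B\<bar>)\<^sup>2 \<le> (\<bar>a\<bar> * D + \<bar>d\<bar> * A)\<^sup>2"
      by (simp add: power_mult_distrib)
    show "0 \<le> \<bar>a\<bar> * D + \<bar>d\<bar> * A" using X by simp
  qed
  have "a \<ge> 0 \<and> d \<ge> 0"
  proof (rule ccontr)
    assume "\<not> ?thesis"
    moreover have "a * d \<ge> 0" using P(1) by simp
    ultimately have "a \<le> 0 \<and> d \<le> 0"
      by (auto simp: zero_le_mult_iff)
    hence "a * D + d * A + 2 * \<bar>b * B\<bar> \<le> 0" using le by simp
    thus False using P(2) by (simp add: abs_if split: if_splits)
  qed
  hence "a = (sqrt a)\<^sup>2" "d = (sgn b * sqrt d)\<^sup>2 \<or> b = 0" "d = (sqrt d)\<^sup>2"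
    "\<bar>b\<bar> = sqrt a * sqrt d"
    using P(1) by (auto simp: power_mult_distrib sgn_if simp flip: real_sqrt_mult)
  then show ?thesis
  proof (cases "b \<ge> 0")
    case True
    with \<open>a \<ge> 0 \<and> d \<ge> 0\<close> \<open>\<bar>b\<bar> = sqrt a * sqrt d\<close> show ?thesis
      by (intro exI[of _ "sqrt a"] exI[of _ "sqrt d"]) auto
  next
    case False
    with \<open>a \<ge> 0 \<and> d \<ge> 0\<close> \<open>\<bar>b\<bar> = sqrt a * sqrt d\<close> show ?thesis
      by (intro exI[of _ "sqrt a"] exI[of _ "- sqrt d"]) auto
  qed
qed

text \<open>
  Both existence statements for frames, for geodesics and for unit vectors, come down to writing a point
  of the hyperboloid as the sum of two null vectors.
\<close>
lemma frame_of_null_vectors: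
  fixes a b d a' b' d' :: real
  assumes X: "a + a' > 0" "d + d' > 0" "(a + a') * (d + d') - (b + b')\<^sup>2 = 1"
    and P: "a * d = b\<^sup>2" and Q: "a' * d' = b'\<^sup>2"
  obtains N where "unimodular N"
    "form_A (N$1) = a" "form_B (N$1) = b" "form_D (N$1) = d"
    "form_A (N$2) = a'" "form_B (N$2) = b'" "form_D (N$2) = d'"
proof -
  have PQ: "a * d' + a' * d - 2 * b * b' = 1"
    using X(3) P Q by (simp add: power2_eq_square algebra_simps)
  have "a * (d + d') + d * (a + a') - 2 * b * (b + b') = 1"
    "a' * (d + d') + d' * (a + a') - 2 * b' * (b + b') = 1"
    using PQ P Q by (simp_all add: power2_eq_square algebra_simps)
  then obtain m n k l where *: "a = m\<^sup>2" "b = m * n" "d = n\<^sup>2" "a' = k\<^sup>2" "b' = k * l" "d' = l\<^sup>2"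
    using null_vector_square[OF X P] null_vector_square[OF X Q] by force
  show ?thesis
  proof (rule that[of "mat22 m n k l"])
    show "unimodular (mat22 m n k l)"
      using PQ by (simp add: unimodular_square * power2_eq_square algebra_simps)
  qed (simp_all add: * form_def)
qed

text \<open>
  The definition of a geodesic is metric, so its explicit form has to be derived. The points at times
  \<open>0\<close> and \<open>1\<close> span a Lorentz plane, in which two null vectors \<open>P\<close>, \<open>Q\<close> are chosen so that \<open>e\<^sup>t P + e\<^sup>-\<^sup>t Q\<close> agrees
  with the geodesic at these times. The distances from these two points determine the component of
  the point at time \<open>t\<close> in the plane. What remains is a null vector orthogonal to a timelike
  vector, hence zero.
\<close>
lemma geodesic_is_geo:
  assumes "geodesic c"
  obtains N where "unimodular N" "c = geo N"
proof -
  have im: "Im (c t) > 0" and pair: "pairing (c s) (c t) = cosh (s - t)" for s t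
    using assms by (auto simp: geodesic_iff)
  define A B D where "A t = coordA (c t)" and "B t = coordB (c t)" and "D t = coordD (c t)" for t
  have I: "A s * D t + D s * A t - 2 * B s * B t = exp (s - t) + exp (t - s)" for s t
    using pair[of s t] by (simp add: pairing_def A_def B_def D_def cosh_def field_simps)
  have det: "A t * D t - (B t)\<^sup>2 = 1" for t by (simp add: A_def B_def D_def coord_det im)
  have pos: "A t > 0" "D t > 0" for t by (simp_all add: A_def D_def coord_pos im)
  define e f where "e = exp (1::real)" and "f = exp (-1::real)"
  have ef: "e * f = 1" by (simp add: e_def f_def flip: exp_add)
  define k where "k = e - f"
  have "e > f" by (simp add: e_def f_def)
  hence k0: "k \<noteq> 0" by (simp add: k_def)
  \<comment> \<open>The null vectors \<open>P\<close> and \<open>Q\<close>, obtained by solving \<open>P + Q\<close> and \<open>e P + Q / e\<close> for the given points.\<close>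
  define a b d where "a = (A 1 - f * A 0) / k" and "b = (B 1 - f * B 0) / k" and "d = (D 1 - f * D 0) / k"
  define a' b' d' where "a' = (e * A 0 - A 1) / k" and "b' = (e * B 0 - B 1) / k" and "d' = (e * D 0 - D 1) / k"
  have ks: "k * a = A 1 - f * A 0" "k * b = B 1 - f * B 0" "k * d = D 1 - f * D 0"
    "k * a' = e * A 0 - A 1" "k * b' = e * B 0 - B 1" "k * d' = e * D 0 - D 1"
    using k0 by (simp_all add: a_def b_def d_def a'_def b'_def d'_def)
  have sums: "X 0 = p + p' \<and> X 1 = e * p + f * p'"
    if "k * p = X 1 - f * X 0" "k * p' = e * X 0 - X 1" for p p' and X :: "real \<Rightarrow> real"
  proof -
    have "k * (p + p') = k * X 0" using that by (simp add: k_def distrib_left left_diff_distrib)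
    moreover have "k * (e * p + f * p') = e * (k * p) + f * (k * p')" by (simp add: algebra_simps)
    hence "k * (e * p + f * p') = e * X 1 - (e * f) * X 0 + (e * f) * X 0 - f * X 1"
      unfolding that by (simp add: algebra_simps)
    hence "k * (e * p + f * p') = k * X 1" by (simp add: k_def algebra_simps)
    ultimately show ?thesis using k0 by simp
  qed
  have sum0: "A 0 = a + a'" "B 0 = b + b'" "D 0 = d + d'"
    and sum1: "A 1 = e * a + f * a'" "B 1 = e * b + f * b'" "D 1 = e * d + f * d'"
    using sums[of a A a'] sums[of b B b'] sums[of d D d'] ks by auto
  have I01: "A 0 * D 1 + D 0 * A 1 - 2 * B 0 * B 1 = e + f"
    using I[of 0 1] by (simp add: e_def f_def)
  have null: "(x * A 1 - y * A 0) * (x * D 1 - y * D 0) - (x * B 1 - y * B 0)\<^sup>2 = x\<^sup>2 + y\<^sup>2 - x * y * (e + f)"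
    for x y
  proof -
    have "(x * A 1 - y * A 0) * (x * D 1 - y * D 0) - (x * B 1 - y * B 0)\<^sup>2 =
        x\<^sup>2 * (A 1 * D 1 - (B 1)\<^sup>2) + y\<^sup>2 * (A 0 * D 0 - (B 0)\<^sup>2)
        - x * y * (A 0 * D 1 + D 0 * A 1 - 2 * B 0 * B 1)"
      by (simp add: power2_eq_square algebra_simps)
    thus ?thesis by (simp add: det I01)
  qed
  have null': "p * r = q\<^sup>2" if "(k * p) * (k * r) - (k * q)\<^sup>2 = 0" for p q r
  proof -
    have "(k * p) * (k * r) - (k * q)\<^sup>2 = k\<^sup>2 * (p * r - q\<^sup>2)" by (simp add: power2_eq_square algebra_simps)
    thus ?thesis using that k0 by simp
  qed
  have "1\<^sup>2 + f\<^sup>2 - 1 * f * (e + f) = 0" "1\<^sup>2 + e\<^sup>2 - 1 * e * (e + f) = 0"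
    using ef by (simp_all add: power2_eq_square algebra_simps)
  hence 0: "(A 1 - f * A 0) * (D 1 - f * D 0) - (B 1 - f * B 0)\<^sup>2 = 0"
    "(A 1 - e * A 0) * (D 1 - e * D 0) - (B 1 - e * B 0)\<^sup>2 = 0"
    using null[of 1 f] null[of 1 e] by simp_all
  have P: "a * d = b\<^sup>2" by (rule null') (simp only: ks 0)
  have Q: "a' * d' = b'\<^sup>2"
    by (rule null', simp only: ks) (use 0(2) in \<open>simp add: power2_eq_square algebra_simps\<close>)
  have PQ: "a * d' + a' * d - 2 * b * b' = 1"
    using det[of 0] P Q by (simp add: sum0 power2_eq_square algebra_simps)
  have main: "A t = exp t * a + exp (-t) * a'" "B t = exp t * b + exp (-t) * b'"
     "D t = exp t * d + exp (-t) * d'" for t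
  proof -
    define x y where "x = exp t" and "y = exp (-t)"
    have xy: "x * y = 1" by (simp add: x_def y_def flip: exp_add)
    have et: "exp (t - 1) = x * f" "exp (1 - t) = y * e"
      by (simp_all add: x_def y_def e_def f_def flip: exp_add)
    \<comment> \<open>The deviation from the explicit geodesic; \<open>o0\<close> and \<open>o1\<close> say that it is orthogonal to the
      points at times \<open>0\<close> and \<open>1\<close>.\<close>
    define u v w where "u = A t - (x * a + y * a')" and "v = B t - (x * b + y * b')"
      and "w = D t - (x * d + y * d')"
    have A: "A t = u + x * a + y * a'" and B: "B t = v + x * b + y * b'" and D: "D t = w + x * d + y * d'"
      by (simp_all add: u_def v_def w_def)
    have "A t * D 0 + D t * A 0 - 2 * B t * B 0 = x + y"
      using I[of t 0] by (simp add: x_def y_def)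
    moreover have "A t * D 0 + D t * A 0 - 2 * B t * B 0 =
       (u * D 0 + w * A 0 - 2 * v * B 0) + x * (2 * (a * d - b\<^sup>2)) + (x + y) * (a * d' + a' * d - 2 * b * b')
        + (2 * (a' * d' - b'\<^sup>2)) * y"
      unfolding A B D sum0 by (simp add: algebra_simps power2_eq_square)
    ultimately have o0: "u * D 0 + w * A 0 - 2 * v * B 0 = 0"
      using P Q PQ by simp
    have "A t * D 1 + D t * A 1 - 2 * B t * B 1 = x * f + y * e"
      using I[of t 1] et by simp
    moreover have "A t * D 1 + D t * A 1 - 2 * B t * B 1 =
       (u * D 1 + w * A 1 - 2 * v * B 1) + x * e * (2 * (a * d - b\<^sup>2)) + (x * f + y * e) * (a * d' + a' * d - 2 * b * b')
        + (2 * (a' * d' - b'\<^sup>2)) * (y * f)"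
      unfolding A B D sum1 by (simp add: algebra_simps power2_eq_square)
    ultimately have o1: "u * D 1 + w * A 1 - 2 * v * B 1 = 0"
      unfolding P Q PQ by simp
    have oP: "u * d + w * a - 2 * v * b = 0"
    proof -
      have "k * (u * d + w * a - 2 * v * b) = u * (k * d) + w * (k * a) - 2 * v * (k * b)"
        by (simp add: algebra_simps)
      also have "\<dots> = (u * D 1 + w * A 1 - 2 * v * B 1) - f * (u * D 0 + w * A 0 - 2 * v * B 0)"
        unfolding ks by (simp add: algebra_simps)
      finally show ?thesis using o0 o1 k0 by simp
    qed
    have oQ: "u * d' + w * a' - 2 * v * b' = 0"
      using o0 oP by (simp add: sum0 algebra_simps)
    have "A t * D t - (B t)\<^sup>2 = (u * w - v\<^sup>2) + x * (u * d + w * a - 2 * v * b) + y * (u * d' + w * a' - 2 * v * b')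
       + x\<^sup>2 * (a * d - b\<^sup>2) + (x * y) * (a * d' + a' * d - 2 * b * b') + y\<^sup>2 * (a' * d' - b'\<^sup>2)"
      unfolding A B D by (simp add: algebra_simps power2_eq_square)
    hence uvw: "u * w = v\<^sup>2" using det[of t] oP oQ P Q PQ xy by simp
    have s: "u * D 0 + w * A 0 = 2 * v * B 0" using o0 by simp
    have "(u * D 0 - w * A 0)\<^sup>2 = (u * D 0 + w * A 0)\<^sup>2 - 4 * (u * w) * (A 0 * D 0)"
      by (simp add: power2_eq_square algebra_simps)
    also have "\<dots> = 4 * v\<^sup>2 * ((B 0)\<^sup>2 - A 0 * D 0)" unfolding s uvw
      by (simp add: power_mult_distrib algebra_simps)
    also have "\<dots> = - 4 * v\<^sup>2" using det[of 0] by (simp add: algebra_simps)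
    finally have sq: "(u * D 0 - w * A 0)\<^sup>2 = - 4 * v\<^sup>2" .
    hence "v\<^sup>2 = 0" using zero_le_power2[of v] zero_le_power2[of "u * D 0 - w * A 0"] by linarith
    hence v: "v = 0" by simp
    hence "u * D 0 - w * A 0 = 0" "u * D 0 + w * A 0 = 0" using sq s by simp_all
    hence "u * D 0 = 0" "w * A 0 = 0" by linarith+
    hence "u = 0" "w = 0" using pos[of 0] by auto
    with v show "A t = exp t * a + exp (-t) * a'" "B t = exp t * b + exp (-t) * b'"
      "D t = exp t * d + exp (-t) * d'"
      using A B D by (simp_all add: x_def y_def)
  qed
  obtain N where N: "unimodular N" "form_A (N$1) = a" "form_B (N$1) = b" "form_D (N$1) = d"
    "form_A (N$2) = a'" "form_B (N$2) = b'" "form_D (N$2) = d'"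
    using frame_of_null_vectors[of a a' d d' b b'] pos[of 0] det[of 0] P Q unfolding sum0 by metis
  have "c t = geo N t" for t
  proof (rule coord_inject)
    have u: "unimodular (flow_mat t ** N)" using N(1) by (simp add: unimodular_mult)
    show "Im (c t) > 0" "Im (geo N t) > 0" using im coord_pt(4)[OF u] by (auto simp: geo_def)
    show "coordB (c t) = coordB (geo N t)" "coordD (c t) = coordD (geo N t)"
      using main[of t] N by (simp_all add: geo_def coord_pt[OF u] Form_flow B_def D_def)
  qed
  with that[OF N(1)] show ?thesis by blast
qed

section \<open>The unit tangent bundle and the flow in terms of frames\<close>

lemma frame_T1: assumes "unimodular N" shows "frame N \<in> T1"
proof -
  define m n k l where "m = N$1$1" and "n = N$1$2" and "k = N$2$1" and "l = N$2$2"
  have u: "(m * l - n * k)\<^sup>2 = 1"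
    using assms by (simp add: unimodular_square m_def n_def k_def l_def)
  have D: "Form_D N = n\<^sup>2 + l\<^sup>2" "Form_D N > 0"
    using Form_pos(2)[OF assms] by (simp_all add: Form_def form_def n_def l_def)
  have B: "Form_B N = m * n + k * l" by (simp add: Form_def form_def m_def n_def k_def l_def)
  define p q where "p = (m * n - k * l) * Form_D N - Form_B N * (n\<^sup>2 - l\<^sup>2)" and "q = n\<^sup>2 - l\<^sup>2"
  have "p = 2 * n * l * (m * l - n * k)"
    unfolding p_def D B by (simp add: power2_eq_square algebra_simps)
  hence "p\<^sup>2 = 4 * n\<^sup>2 * l\<^sup>2" using u by (simp add: power_mult_distrib)
  hence pq: "p\<^sup>2 + q\<^sup>2 = (Form_D N)\<^sup>2" unfolding q_def D(1) by (simp add: power2_eq_square algebra_simps)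
  have "snd (frame N) = Complex (p / (Form_D N)\<^sup>2) (- q / (Form_D N)\<^sup>2)"
    unfolding frame_def Let_def p_def q_def by (simp add: form_def m_def n_def k_def l_def)
  hence "(cmod (snd (frame N)))\<^sup>2 = (p\<^sup>2 + q\<^sup>2) / ((Form_D N)\<^sup>2)\<^sup>2"
    by (simp add: cmod_power2 power_divide add_divide_distrib)
  also have "\<dots> = (1 / Form_D N)\<^sup>2"
    unfolding pq using D(2) by (simp add: power2_eq_square)
  finally have sq: "(cmod (snd (frame N)))\<^sup>2 = (1 / Form_D N)\<^sup>2" .
  have "1 / Form_D N \<ge> 0" using D(2) by simp
  from power2_eq_imp_eq[OF sq norm_ge_zero this] have "cmod (snd (frame N)) = 1 / Form_D N" .
  thus ?thesis using coord_pt(4)[OF assms]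
    by (simp add: T1_def frame_def pt_def)
qed

text \<open>
  The hyperboloid coordinates of the base point and their derivative along the vector are \<open>P + Q\<close> and
  \<open>P - Q\<close>.
\<close>
lemma T1_frame:
  assumes "p \<in> T1" obtains N where "unimodular N" "p = frame N"
proof -
  obtain x y w1 w2 where p: "p = (Complex x y, Complex w1 w2)" and y: "y > 0" and w: "w1\<^sup>2 + w2\<^sup>2 = y\<^sup>2"
  proof -
    obtain z w where "p = (z, w)" "Im z > 0" "cmod w = Im z" using assms by (auto simp: T1_def)
    thus ?thesis
      using that[of "Re z" "Im z" "Re w" "Im w"] by (metis cmod_power2 complex.collapse)
  qed
  \<comment> \<open>With \<open>j\<close> for \<open>1 / y\<close> the identities below are polynomial.\<close>
  define j where "j = 1 / y"
  have jy: "j * y = 1" "j > 0" using y by (auto simp: j_def)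
  have wj: "w1\<^sup>2 * j\<^sup>2 + w2\<^sup>2 * j\<^sup>2 = 1"
    using w jy(1) by (metis distrib_right power_mult_distrib mult.commute power_one)
  define A B D where "A = (x\<^sup>2 + y\<^sup>2) * j" and "B = x * j" and "D = j"
  define A' B' D' where "A' = 2 * (x * w1 + y * w2) * j - (x\<^sup>2 + y\<^sup>2) * w2 * j\<^sup>2"
    and "B' = w1 * j - x * w2 * j\<^sup>2" and "D' = - w2 * j\<^sup>2"
  have X: "A * D - B\<^sup>2 = 1"
  proof -
    have "A * D - B\<^sup>2 = (j * y)\<^sup>2" by (simp add: A_def B_def D_def power2_eq_square algebra_simps)
    thus ?thesis by (simp add: jy)
  qed
  have e1: "A * D' + D * A' - 2 * B * B' = 0"
  proof -
    have "A * D' + D * A' - 2 * B * B' = 2 * w2 * (y * j\<^sup>2 * (1 - j * y))"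
      by (simp add: A_def B_def D_def A'_def B'_def D'_def power2_eq_square algebra_simps)
    thus ?thesis by (simp add: jy)
  qed
  have e2: "A' * D' - B'\<^sup>2 = -1"
  proof -
    have "A' * D' - B'\<^sup>2 = - (w1\<^sup>2 * j\<^sup>2 + w2\<^sup>2 * j\<^sup>2 * (2 * (j * y) - (j * y)\<^sup>2))"
      by (simp add: A_def B_def D_def A'_def B'_def D'_def power2_eq_square algebra_simps)
    thus ?thesis using wj by (simp add: jy)
  qed
  obtain N where N: "unimodular N"
    "form_A (N$1) = (A + A')/2" "form_B (N$1) = (B + B')/2" "form_D (N$1) = (D + D')/2"
    "form_A (N$2) = (A - A')/2" "form_B (N$2) = (B - B')/2" "form_D (N$2) = (D - D')/2"
  proof (rule frame_of_null_vectors[of "(A + A')/2" "(A - A')/2" "(D + D')/2" "(D - D')/2" "(B + B')/2" "(B - B')/2"])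
    have "0 < x\<^sup>2 + y\<^sup>2" using y by (simp add: sum_power2_gt_zero_iff)
    thus "(A + A')/2 + (A - A')/2 > 0" "(D + D')/2 + (D - D')/2 > 0"
      using jy by (simp_all add: A_def D_def flip: add_divide_distrib)
    show "((A + A')/2 + (A - A')/2) * ((D + D')/2 + (D - D')/2) - ((B + B')/2 + (B - B')/2)\<^sup>2 = 1"
      using X by (simp flip: add_divide_distrib)
    have "(A + A') * (D + D') - (B + B')\<^sup>2 = (A * D - B\<^sup>2) + (A * D' + D * A' - 2 * B * B') + (A' * D' - B'\<^sup>2)"
      "(A - A') * (D - D') - (B - B')\<^sup>2 = (A * D - B\<^sup>2) - (A * D' + D * A' - 2 * B * B') + (A' * D' - B'\<^sup>2)"
      by (simp_all add: power2_eq_square algebra_simps)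
    hence "(A + A') * (D + D') = (B + B')\<^sup>2" "(A - A') * (D - D') = (B - B')\<^sup>2"
      using X e1 e2 by simp_all
    thus "(A + A')/2 * ((D + D')/2) = ((B + B')/2)\<^sup>2" "(A - A')/2 * ((D - D')/2) = ((B - B')/2)\<^sup>2"
      by (simp_all add: power_divide)
  qed auto
  have f: "Form_B N = B" "Form_D N = D" "form_B (N$1) - form_B (N$2) = B'" "form_D (N$1) - form_D (N$2) = D'"
    unfolding Form_def N by (simp_all add: field_simps)
  have "B / D = x" "1 / D = y" using jy by (auto simp: B_def D_def field_simps)
  moreover have "(B' * D - B * D') / D\<^sup>2 = w1" "- D' / D\<^sup>2 = w2"
    using jy(2) by (simp_all add: B_def D_def B'_def D'_def field_simps power2_eq_square)
  ultimately have "p = frame N" unfolding p frame_def pt_def f Let_def by simp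
  with N(1) that show ?thesis by blast
qed

text \<open>
  Frames determine the rows only up to sign.
\<close>
lemma frame_eq_iff:
  assumes "unimodular M" "unimodular N"
  shows "frame M = frame N \<longleftrightarrow> (\<forall>i. form_B (M$i) = form_B (N$i) \<and> form_D (M$i) = form_D (N$i))"
proof
  assume eq: "frame M = frame N"
  hence "pt M = pt N" by (simp add: frame_def)
  hence B: "Form_B M = Form_B N" and D: "Form_D M = Form_D N"
    using coord_pt(2,3)[OF assms(1)] coord_pt(2,3)[OF assms(2)] by simp_all
  have D0: "Form_D N > 0" by (rule Form_pos[OF assms(2)])
  from eq have "form_D (M$1) - form_D (M$2) = form_D (N$1) - form_D (N$2)"
    using D0 by (simp add: frame_def Let_def D)
  moreover from this eq have "form_B (M$1) - form_B (M$2) = form_B (N$1) - form_B (N$2)"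
    using D0 by (simp add: frame_def Let_def D B)
  ultimately show "\<forall>i. form_B (M$i) = form_B (N$i) \<and> form_D (M$i) = form_D (N$i)"
    using B D by (simp add: Form_def forall_2)
next
  assume "\<forall>i. form_B (M$i) = form_B (N$i) \<and> form_D (M$i) = form_D (N$i)"
  thus "frame M = frame N" by (simp add: frame_def pt_def Form_def)
qed

lemma geodesic_of_frame:
  assumes "unimodular N" shows "geodesic_of (frame N) = geo N"
  unfolding geodesic_of_def
proof (rule the_equality)
  have "(geo N has_vector_derivative snd (frame N)) (at 0)"
    using geo_derivative[OF assms, of 0] by simp
  thus "geodesic (geo N) \<and> geo N 0 = fst (frame N) \<and> (geo N has_vector_derivative snd (frame N)) (at 0)"
    using assms by (simp add: geodesic_geo)
next
  fix c assume c: "geodesic c \<and> c 0 = fst (frame N) \<and> (c has_vector_derivative snd (frame N)) (at 0)"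
  then obtain M where M: "unimodular M" "c = geo M" using geodesic_is_geo by blast
  have "(geo M has_vector_derivative snd (frame M)) (at 0)"
    using geo_derivative[OF M(1), of 0] by simp
  hence "snd (frame M) = snd (frame N)"
    using c M(2) vector_derivative_unique_at by blast
  moreover have "fst (frame M) = fst (frame N)" using c M(2) by simp
  ultimately have "frame M = frame N" by (simp add: prod_eq_iff)
  hence "\<forall>i. form_B (M$i) = form_B (N$i) \<and> form_D (M$i) = form_D (N$i)"
    using frame_eq_iff[OF M(1) assms] by simp
  thus "c = geo N" by (simp add: M(2) geo_def pt_def Form_flow fun_eq_iff)
qed

lemma geod_flow_frame:
  assumes "unimodular N" shows "geod_flow t (frame N) = frame (flow_mat t ** N)"
  using vector_derivative_at[OF geo_derivative[OF assms, of t]]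
  by (simp add: geod_flow_def geodesic_of_frame[OF assms] prod_eq_iff geo_def)

section \<open>The action of matrices\<close>

lemma hyp_act_denominator:
  assumes "unimodular g" "Im z \<noteq> 0"
  shows "of_real (g$1$2) * z + of_real (g$2$2) \<noteq> 0"
  using assms by (auto simp: complex_eq_iff unimodular_iff det_2)

text \<open>
  The action is right multiplication for both signs of the determinant: replacing \<open>z\<close> by its conjugate is
  the same as replacing \<open>\<i>\<close> by \<open>-\<i>\<close> in the point of \<open>N\<close>.
\<close>
lemma hyp_act_pt:
  assumes N: "unimodular N" and g: "unimodular g"
  shows "hyp_act (pt N) g = pt (N ** g)"
proof -
  define a b c d where "a = g$1$1" and "b = g$1$2" and "c = g$2$1" and "d = g$2$2"
  define A B D where "A = Form_A N" and "B = Form_B N" and "D = Form_D N"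
  have B': "Form_B (N ** g) = a * b * A + (a * d + b * c) * B + c * d * D"
   and D': "Form_D (N ** g) = b\<^sup>2 * A + 2 * b * d * B + d\<^sup>2 * D"
    by (simp_all add: Form_def form_def matrix_mult_nth a_def b_def c_def d_def A_def B_def D_def
        power2_eq_square algebra_simps)
  have D0: "D > 0" and AD: "A * D = B\<^sup>2 + 1"
    using Form_pos[OF N] Form_unimodular[OF N] by (simp_all add: A_def B_def D_def)
  define e where "e = det g"
  have e: "e = 1 \<or> e = -1" "a * d - b * c = e"
    using g by (auto simp: unimodular_iff e_def det_2 a_def b_def c_def d_def)
  define D1 where "D1 = b\<^sup>2 * A + 2 * b * d * B + d\<^sup>2 * D"
  have D1: "D1 > 0" using Form_pos(2)[OF unimodular_mult[OF N g]] by (simp add: D' D1_def)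
  define w where "w = Complex (B / D) (e / D)"
  have w: "(if e = 1 then pt N else cnj (pt N)) = w"
    using e by (auto simp: w_def pt_def B_def D_def complex_eq_iff)
  have w0: "Im w \<noteq> 0" using e D0 by (auto simp: w_def)
  have "of_real D * w = Complex B e" using D0 by (simp add: w_def complex_eq_iff)
  hence num: "of_real D * (of_real a * w + of_real c) = Complex (a * B + c * D) (a * e)"
    and den: "of_real D * (of_real b * w + of_real d) = Complex (b * B + d * D) (b * e)"
    by (simp_all add: complex_eq_iff algebra_simps)
  \<comment> \<open>The real and the imaginary part of the claim, cleared of denominators; \<open>D1\<close> is the coordinate \<open>D\<close> of
    the image.\<close>
  have b1: "(a * b * A + (a * d + b * c) * B + c * d * D) * (b * B + d * D) - e * b
      = D1 * (a * B + c * D)"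
  proof -
    have "(a * b * A + (a * d + b * c) * B + c * d * D) * (b * B + d * D) - D1 * (a * B + c * D)
       = b * (a * d - b * c) * (A * D - B\<^sup>2)"
      unfolding D1_def by (simp add: power2_eq_square algebra_simps)
    hence "(a * b * A + (a * d + b * c) * B + c * d * D) * (b * B + d * D) - D1 * (a * B + c * D) = e * b"
      using AD e(2) by simp
    thus ?thesis by linarith
  qed
  have b2: "(a * b * A + (a * d + b * c) * B + c * d * D) * (b * e) + (b * B + d * D) = D1 * (a * e)"
  proof -
    have "(a * b * A + (a * d + b * c) * B + c * d * D) * (b * e) - D1 * (a * e)
       = - e * (a * d - b * c) * (b * B + d * D)"
      unfolding D1_def by (simp add: power2_eq_square algebra_simps)
    thus ?thesis using e by auto
  qed
  define X where "X = a * b * A + (a * d + b * c) * B + c * d * D"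
  have "of_real D1 * Complex (a * B + c * D) (a * e) = Complex X 1 * Complex (b * B + d * D) (b * e)"
    using b1 b2 unfolding X_def[symmetric] complex_eq_iff by (simp add: mult.commute)
  hence "of_real D * (of_real D1 * (of_real a * w + of_real c))
      = of_real D * (Complex X 1 * (of_real b * w + of_real d))"
    unfolding num[symmetric] den[symmetric] by (simp only: mult.left_commute)
  hence "of_real D1 * (of_real a * w + of_real c) = Complex X 1 * (of_real b * w + of_real d)"
    using D0 by simp
  moreover have "of_real b * w + of_real d \<noteq> 0"
    using hyp_act_denominator[OF g w0] by (simp add: b_def d_def)
  ultimately have "(of_real a * w + of_real c) / (of_real b * w + of_real d)
     = Complex X 1 / of_real D1"
    using D1 by (subst frac_eq_eq) (simp_all add: mult.commute)
  also have "\<dots> = pt (N ** g)"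
    unfolding pt_def B' D' D1_def[symmetric] X_def[symmetric] using D1 by (simp add: complex_eq_iff)
  finally show ?thesis
    unfolding hyp_act_def Let_def e_def[symmetric] w a_def b_def c_def d_def .
qed

lemma hyp_act_has_derivative:
  assumes g: "unimodular g" and z: "Im z \<noteq> 0"
  shows "((\<lambda>z. hyp_act z g) has_derivative
     (\<lambda>h. if det g = 1 then h / (of_real (g$1$2) * z + of_real (g$2$2))\<^sup>2
          else - cnj h / (of_real (g$1$2) * cnj z + of_real (g$2$2))\<^sup>2)) (at z)"
proof -
  define a b c d where "a = g$1$1" and "b = g$1$2" and "c = g$2$1" and "d = g$2$2"
  have hol: "((\<lambda>w. (of_real a * w + of_real c) / (of_real b * w + of_real d)) has_field_derivative
     of_real (det g) / (of_real b * w + of_real d)\<^sup>2) (at w)" if "Im w \<noteq> 0" for w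
  proof -
    have nz: "of_real b * w + of_real d \<noteq> 0"
      using hyp_act_denominator[OF g that] by (simp add: b_def d_def)
    have dg: "det g = a * d - b * c" by (simp add: det_2 a_def b_def c_def d_def)
    have n: "((\<lambda>w. of_real a * w + of_real c) has_field_derivative of_real a) (at w)"
      and d: "((\<lambda>w. of_real b * w + of_real d) has_field_derivative of_real b) (at w)" for w :: complex
      by (auto intro!: derivative_eq_intros)
    show ?thesis
      by (rule DERIV_cong[OF DERIV_divide[OF n d nz]]) (simp add: dg power2_eq_square algebra_simps)
  qed
  show ?thesis
  proof (cases "det g = 1")
    case True
    have "(\<lambda>z. hyp_act z g) = (\<lambda>w. (of_real a * w + of_real c) / (of_real b * w + of_real d))"
      by (simp add: hyp_act_def True a_def b_def c_def d_def)
    moreover have "(*) (of_real (det g) / (of_real b * z + of_real d)\<^sup>2) = (\<lambda>h. h / (of_real b * z + of_real d)\<^sup>2)"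
      by (simp add: True fun_eq_iff)
    ultimately show ?thesis using hol[OF z] True
      by (simp add: has_field_derivative_def flip: b_def d_def)
  next
    case False
    hence dg: "det g = -1" using g by (simp add: unimodular_iff)
    have eq: "(\<lambda>z. hyp_act z g) = (\<lambda>w. (of_real a * w + of_real c) / (of_real b * w + of_real d)) \<circ> cnj"
      by (simp add: hyp_act_def Let_def dg a_def b_def c_def d_def fun_eq_iff)
    have "(cnj has_derivative cnj) (at z)"
      by (rule bounded_linear_imp_has_derivative[OF bounded_linear_cnj])
    from diff_chain_at[OF this] hol[of "cnj z"] z
    have "((\<lambda>z. hyp_act z g) has_derivative
      (*) (of_real (det g) / (of_real b * cnj z + of_real d)\<^sup>2) \<circ> cnj) (at z)"
      unfolding eq has_field_derivative_def by simp
    moreover have "(*) (of_real (det g) / (of_real b * cnj z + of_real d)\<^sup>2) \<circ> cnj =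
        (\<lambda>h. - cnj h / (of_real b * cnj z + of_real d)\<^sup>2)"
      by (simp add: dg fun_eq_iff)
    ultimately show ?thesis by (simp add: dg flip: b_def d_def)
  qed
qed

lemma tangent_act_eq:
  assumes "unimodular g" "Im (fst p) \<noteq> 0"
  shows "tangent_act p g = (hyp_act (fst p) g,
     if det g = 1 then snd p / (of_real (g$1$2) * fst p + of_real (g$2$2))\<^sup>2
     else - cnj (snd p) / (of_real (g$1$2) * cnj (fst p) + of_real (g$2$2))\<^sup>2)"
  unfolding tangent_act_def
  using frechet_derivative_at[OF hyp_act_has_derivative[OF assms], symmetric] by simp

lemma geo_mult: "unimodular N \<Longrightarrow> unimodular g \<Longrightarrow> hyp_act (geo N t) g = geo (N ** g) t"
  by (simp add: geo_def hyp_act_pt unimodular_mult matrix_mul_assoc)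

text \<open>
  An isometry maps the geodesic of \<open>N\<close> to the geodesic of \<open>N g\<close>, and the claim is the chain rule at time \<open>0\<close>.
\<close>
lemma tangent_act_frame:
  assumes N: "unimodular N" and g: "unimodular g"
  shows "tangent_act (frame N) g = frame (N ** g)"
proof -
  have im: "Im (pt N) \<noteq> 0" using coord_pt(4)[OF N] by simp
  have "(geo N has_vector_derivative snd (frame N)) (at 0)"
    using geo_derivative[OF N, of 0] by simp
  hence 1: "(geo N has_derivative (\<lambda>t. t *\<^sub>R snd (frame N))) (at 0)"
    by (simp add: has_vector_derivative_def)
  have "(\<lambda>z. hyp_act z g) differentiable at (geo N 0)"
    using hyp_act_has_derivative[OF g im] by (auto simp: differentiable_def)
  hence "((\<lambda>z. hyp_act z g) has_derivative frechet_derivative (\<lambda>z. hyp_act z g) (at (pt N))) (at (geo N 0))"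
    by (simp add: frechet_derivative_works)
  from diff_chain_at[OF 1 this] have
    "((\<lambda>z. hyp_act z g) \<circ> geo N has_derivative
      frechet_derivative (\<lambda>z. hyp_act z g) (at (pt N)) \<circ> (\<lambda>t. t *\<^sub>R snd (frame N))) (at 0)" .
  moreover have "(\<lambda>z. hyp_act z g) \<circ> geo N = geo (N ** g)"
    using geo_mult[OF N g] by (simp add: fun_eq_iff)
  moreover have "frechet_derivative (\<lambda>z. hyp_act z g) (at (pt N)) \<circ> (\<lambda>t. t *\<^sub>R snd (frame N)) =
     (\<lambda>t. t *\<^sub>R frechet_derivative (\<lambda>z. hyp_act z g) (at (pt N)) (snd (frame N)))"
    using linear_frechet_derivative[of "\<lambda>z. hyp_act z g" "at (pt N)"]
      differentiableI[OF hyp_act_has_derivative[OF g im]]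
    by (auto simp: fun_eq_iff linear_scale)
  ultimately have "(geo (N ** g) has_vector_derivative
     frechet_derivative (\<lambda>z. hyp_act z g) (at (pt N)) (snd (frame N))) (at 0)"
    by (simp add: has_vector_derivative_def)
  moreover have "(geo (N ** g) has_vector_derivative snd (frame (N ** g))) (at 0)"
    using geo_derivative[OF unimodular_mult[OF N g], of 0] by simp
  ultimately have "frechet_derivative (\<lambda>z. hyp_act z g) (at (pt N)) (snd (frame N)) = snd (frame (N ** g))"
    by (rule vector_derivative_unique_at)
  thus ?thesis by (simp add: tangent_act_def prod_eq_iff hyp_act_pt[OF N g])
qed

section \<open>End points\<close>

text \<open>
  The boundary point with homogeneous coordinates \<open>r\<close>.
\<close>
definition bpt :: "real^2 \<Rightarrow> real option" where
  "bpt r = (if r$2 = 0 then None else Some (r$1 / r$2))"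

lemma tends_to_bdry_unique:
  assumes "tends_to_bdry c F x" "tends_to_bdry c F y" "F \<noteq> bot" shows "x = y"
proof (cases x; cases y)
  fix a b assume "x = Some a" "y = Some b"
  thus ?thesis using assms tendsto_unique[OF assms(3)] by fastforce
qed (use assms not_tendsto_and_filterlim_at_infinity in \<open>auto\<close>)

lemma unimodular_row_nonzero:
  assumes "unimodular N" shows "N$i$1 \<noteq> 0 \<or> N$i$2 \<noteq> 0"
  using assms exhaust_2[of i] by (auto simp: unimodular_iff det_2)

lemma geo_tendsto_at_top:
  assumes "unimodular N" shows "tends_to_bdry (geo N) at_top (bpt (N$1))"
proof -
  define m n k l where "m = N$1$1" and "n = N$1$2" and "k = N$2$1" and "l = N$2$2"
  have g: "geo N t = Complex ((exp t * (m * n) + exp (-t) * (k * l)) / (exp t * n\<^sup>2 + exp (-t) * l\<^sup>2))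
        (1 / (exp t * n\<^sup>2 + exp (-t) * l\<^sup>2))" for t
    by (simp add: geo_def pt_def Form_flow form_def m_def n_def k_def l_def)
  have e0: "((\<lambda>t. exp (-t)) \<longlongrightarrow> (0::real)) at_top"
    by (rule filterlim_compose[OF exp_at_bot filterlim_uminus_at_bot_at_top])
  show ?thesis
  proof (cases "n = 0")
    case False
    have n2: "n\<^sup>2 + exp (-t) * exp (-t) * l\<^sup>2 > 0" for t
      using False by (intro add_pos_nonneg) auto
    have ee: "exp t * exp (-t) = 1" for t :: real by (simp flip: exp_add)
    have g2: "geo N t = Complex ((m * n + exp (-t) * exp (-t) * (k * l)) / (n\<^sup>2 + exp (-t) * exp (-t) * l\<^sup>2))
        (exp (-t) / (n\<^sup>2 + exp (-t) * exp (-t) * l\<^sup>2))" for t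
    proof -
      have "exp t * n\<^sup>2 + exp (-t) * l\<^sup>2 = exp t * (n\<^sup>2 + exp (-t) * exp (-t) * l\<^sup>2)"
        "exp t * (m * n) + exp (-t) * (k * l) = exp t * (m * n + exp (-t) * exp (-t) * (k * l))"
        "1 = exp t * exp (-t)"
        using ee[of t] by (simp_all add: distrib_left flip: mult.assoc)
      thus ?thesis unfolding g by (metis (no_types, lifting) exp_not_eq_zero mult_divide_mult_cancel_left)
    qed
    have "(geo N \<longlongrightarrow> Complex ((m * n + 0 * 0 * (k * l)) / (n\<^sup>2 + 0 * 0 * l\<^sup>2)) (0 / (n\<^sup>2 + 0 * 0 * l\<^sup>2))) at_top"
      unfolding g2[abs_def] by (intro tendsto_intros e0) (use False in auto)
    also have "Complex ((m * n + 0 * 0 * (k * l)) / (n\<^sup>2 + 0 * 0 * l\<^sup>2)) (0 / (n\<^sup>2 + 0 * 0 * l\<^sup>2)) = of_real (m / n)"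
      using False by (simp add: complex_eq_iff power2_eq_square)
    finally show ?thesis using False by (simp add: bpt_def m_def n_def)
  next
    case True
    hence l0: "l \<noteq> 0" using assms by (auto simp: unimodular_iff det_2 m_def n_def l_def k_def)
    have le: "exp t / l\<^sup>2 \<le> cmod (geo N t)" for t
    proof -
      have "Im (geo N t) = exp t / l\<^sup>2" using True by (simp add: g exp_minus field_simps)
      thus ?thesis by (metis abs_Im_le_cmod abs_le_D1)
    qed
    have "filterlim (\<lambda>t. (1 / l\<^sup>2) * exp t) at_top at_top"
      by (rule filterlim_tendsto_pos_mult_at_top[OF tendsto_const _ exp_at_top]) (use l0 in auto)
    hence "filterlim (\<lambda>t. cmod (geo N t)) at_top at_top"
      by (rule filterlim_at_top_mono) (use le in auto)
    hence "filterlim (geo N) at_infinity at_top" by (rule filterlim_norm_at_top_imp_at_infinity)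
    thus ?thesis using True by (simp add: bpt_def n_def)
  qed
qed

text \<open>
  Exchanging the rows reverses the direction of the geodesic.
\<close>
definition swap_mat :: "real^2^2" where "swap_mat = mat22 0 1 1 0"

lemma swap_rows [simp]: "(swap_mat ** N)$1 = N$2" "(swap_mat ** N)$2 = N$1" for N :: "real^2^2"
  by (simp_all only: vec_eq_iff forall_2 matrix_mult_nth swap_mat_def mat22_nth) simp_all

lemma unimodular_swap [simp]: "unimodular swap_mat"
  by (simp add: unimodular_iff det_2 swap_mat_def)

lemma geo_swap: "geo (swap_mat ** N) t = geo N (-t)"
  by (simp add: geo_def pt_def Form_flow add.commute)

lemma geo_tendsto_at_bot:
  assumes "unimodular N" shows "tends_to_bdry (geo N) at_bot (bpt (N$2))"
proof -
  have "tends_to_bdry (geo (swap_mat ** N)) at_top (bpt (N$2))"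
    using geo_tendsto_at_top[OF unimodular_mult[OF unimodular_swap assms]] by simp
  hence *: "tends_to_bdry (\<lambda>t. geo N (-t)) at_top (bpt (N$2))"
    by (simp add: geo_swap[abs_def])
  thus ?thesis by (cases "bpt (N$2)") (simp_all add: filterlim_at_bot_mirror)
qed

lemma fwd_end_frame: "unimodular N \<Longrightarrow> fwd_end (frame N) = bpt (N$1)"
  unfolding fwd_end_def geodesic_of_frame
  by (intro the_equality geo_tendsto_at_top tends_to_bdry_unique[OF _ geo_tendsto_at_top]) auto

lemma bwd_end_frame: "unimodular N \<Longrightarrow> bwd_end (frame N) = bpt (N$2)"
  unfolding bwd_end_def geodesic_of_frame
  by (intro the_equality geo_tendsto_at_bot tends_to_bdry_unique[OF _ geo_tendsto_at_bot]) auto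

lemma bdry_act_bpt:
  assumes "r \<noteq> 0" "unimodular g"
  shows "bdry_act (bpt r) g = bpt (r v* g)"
proof (cases "r$2 = 0")
  case True
  hence "r$1 \<noteq> 0" using assms(1) by (auto simp: vec_eq_iff forall_2)
  thus ?thesis using True by (simp add: bdry_act_def bpt_def vector_mult_nth transpose_def)
next
  case False
  have "g$1$2 * (r$1 / r$2) + g$2$2 = (r$1 * g$1$2 + r$2 * g$2$2) / r$2"
    "g$1$1 * (r$1 / r$2) + g$2$1 = (r$1 * g$1$1 + r$2 * g$2$1) / r$2"
    using False by (simp_all add: field_simps)
  thus ?thesis using False
    by (simp add: bdry_act_def bpt_def vector_mult_nth transpose_def)
qed

section \<open>The group and the quotient\<close>

lemma unimodular_inv:
  assumes "unimodular g"
  shows "g ** matrix_inv g = mat 1" "matrix_inv g ** g = mat 1" "unimodular (matrix_inv g)"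
proof -
  have "invertible g" using assms by (auto simp: invertible_det_nz unimodular_iff)
  hence "\<exists>h. g ** h = mat 1 \<and> h ** g = mat 1" by (simp add: invertible_def)
  hence *: "g ** matrix_inv g = mat 1 \<and> matrix_inv g ** g = mat 1"
    unfolding matrix_inv_def by (rule someI_ex)
  thus "g ** matrix_inv g = mat 1" "matrix_inv g ** g = mat 1" by auto
  have "det g * det (matrix_inv g) = 1" using * by (metis det_I det_mul)
  thus "unimodular (matrix_inv g)" using assms by (auto simp: unimodular_iff)
qed

lemma sqrt2_simps [simp]: "sqrt 2 * sqrt 2 = 2" "sqrt 2 * (sqrt 2 * x) = 2 * x"
  by (simp_all flip: mult.assoc)

lemma unimodular_generators [simp]: "unimodular alpha" "unimodular beta" "unimodular gamma"
  by (simp_all add: unimodular_iff det_2 alpha_def beta_def gamma_def nu_def field_simps)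

lemma unimodular_one [simp]: "unimodular (mat 1)"
  by (simp add: unimodular_iff)

lemma V_P_unimodular: "g \<in> V_P \<Longrightarrow> unimodular g"
  by (induction rule: V_P.induct) (auto intro: unimodular_mult unimodular_inv)

lemma proj_frame:
  assumes "unimodular N" shows "proj (frame N) = {frame (N ** g) | g. g \<in> V_P}"
  using tangent_act_frame[OF assms] V_P_unimodular by (auto simp: proj_def image_def)

lemma proj_frame_mult:
  assumes N: "unimodular N" and g: "g \<in> V_P"
  shows "proj (frame (N ** g)) = proj (frame N)"
proof -
  have u: "unimodular g" using g by (rule V_P_unimodular)
  have "\<exists>h'\<in>V_P. N ** h = N ** g ** h'" if "h \<in> V_P" for h
  proof
    show "matrix_inv g ** h \<in> V_P" using that g by (intro V_P.mult V_P.inv)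
    have "g ** (matrix_inv g ** h) = h" by (simp add: matrix_mul_assoc unimodular_inv(1)[OF u])
    thus "N ** h = N ** g ** (matrix_inv g ** h)" by (simp flip: matrix_mul_assoc)
  qed
  hence "{frame (N ** h) | h. h \<in> V_P} \<subseteq> {frame (N ** g ** h) | h. h \<in> V_P}"
    by fastforce
  moreover have "{frame (N ** g ** h) | h. h \<in> V_P} \<subseteq> {frame (N ** h) | h. h \<in> V_P}"
  proof (rule subsetI)
    fix p assume "p \<in> {frame (N ** g ** h) | h. h \<in> V_P}"
    then obtain h where h: "p = frame (N ** g ** h)" "h \<in> V_P"
      by blast
    hence "p = frame (N ** (g ** h)) \<and> g ** h \<in> V_P"
      using V_P.mult[OF g] by (simp add: matrix_mul_assoc)
    thus "p \<in> {frame (N ** h) | h. h \<in> V_P}" by blast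
  qed
  ultimately show ?thesis
    unfolding proj_frame[OF N] proj_frame[OF unimodular_mult[OF N u]] by blast
qed

lemma proj_frame_eq_iff:
  assumes "unimodular M" "unimodular N"
  shows "proj (frame M) = proj (frame N) \<longleftrightarrow> (\<exists>g\<in>V_P. frame M = frame (N ** g))"
proof
  have "frame M \<in> proj (frame M)" unfolding proj_frame[OF assms(1)]
    using V_P.one by (metis (mono_tags, lifting) matrix_mul_rid mem_Collect_eq)
  thus "proj (frame M) = proj (frame N) \<Longrightarrow> \<exists>g\<in>V_P. frame M = frame (N ** g)"
    unfolding proj_frame[OF assms(2)] by auto
next
  assume "\<exists>g\<in>V_P. frame M = frame (N ** g)"
  thus "proj (frame M) = proj (frame N)" using proj_frame_mult[OF assms(2)] by auto
qed

lemma quot_flow_proj: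
  assumes "unimodular N" shows "quot_flow t (proj (frame N)) = proj (frame (flow_mat t ** N))"
proof -
  have "geod_flow t (frame (N ** g)) = frame (flow_mat t ** N ** g)" if "g \<in> V_P" for g
    using geod_flow_frame[OF unimodular_mult[OF assms V_P_unimodular[OF that]]]
    by (simp add: matrix_mul_assoc)
  thus ?thesis
    unfolding quot_flow_def proj_frame[OF assms] proj_frame[OF unimodular_mult[OF unimodular_flow assms]]
    by (simp add: setcompr_eq_image image_image)
qed

section \<open>The dihedral group and the octagon\<close>

text \<open>
  The group generated by \<open>\<alpha>\<close> and \<open>\<beta>\<close> inside \<open>O(2)\<close>, dihedral of order \<open>16\<close>. It consists of the matrices
  \<open>\<plusminus>\<nu>\<^sub>i\<close> (\<open>dih_nu_ex\<close>, \<open>nu_dih\<close>), which allows finite case distinctions.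
\<close>
inductive_set dih :: "(real^2^2) set" where
  one: "mat 1 \<in> dih"
| alpha: "d \<in> dih \<Longrightarrow> d ** alpha \<in> dih"
| beta: "d \<in> dih \<Longrightarrow> d ** beta \<in> dih"

lemma nu_nth [simp]:
  "nu 0 $1$1 = 1" "nu 0 $1$2 = 0" "nu 0 $2$1 = 0" "nu 0 $2$2 = 1"
  "nu (Suc 0) $1$1 = 1/sqrt 2" "nu (Suc 0) $1$2 = 1/sqrt 2" "nu (Suc 0) $2$1 = 1/sqrt 2" "nu (Suc 0) $2$2 = -1/sqrt 2"
  "nu 1 $1$1 = 1/sqrt 2" "nu 1 $1$2 = 1/sqrt 2" "nu 1 $2$1 = 1/sqrt 2" "nu 1 $2$2 = -1/sqrt 2"
  "nu 2 $1$1 = 1/sqrt 2" "nu 2 $1$2 = 1/sqrt 2" "nu 2 $2$1 = -1/sqrt 2" "nu 2 $2$2 = 1/sqrt 2"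
  "nu 3 $1$1 = 0" "nu 3 $1$2 = 1" "nu 3 $2$1 = 1" "nu 3 $2$2 = 0"
  "nu 4 $1$1 = 0" "nu 4 $1$2 = 1" "nu 4 $2$1 = -1" "nu 4 $2$2 = 0"
  "nu 5 $1$1 = -1/sqrt 2" "nu 5 $1$2 = 1/sqrt 2" "nu 5 $2$1 = 1/sqrt 2" "nu 5 $2$2 = 1/sqrt 2"
  "nu 6 $1$1 = -1/sqrt 2" "nu 6 $1$2 = 1/sqrt 2" "nu 6 $2$1 = -1/sqrt 2" "nu 6 $2$2 = -1/sqrt 2"
  "nu 7 $1$1 = -1" "nu 7 $1$2 = 0" "nu 7 $2$1 = 0" "nu 7 $2$2 = 1"
  by (simp_all add: nu_def)

lemma generator_nth [simp]:
  "alpha $1$1 = 1" "alpha $1$2 = 0" "alpha $2$1 = 0" "alpha $2$2 = -1"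
  "beta $1$1 = 1/sqrt 2" "beta $1$2 = 1/sqrt 2" "beta $2$1 = 1/sqrt 2" "beta $2$2 = -1/sqrt 2"
  "gamma $1$1 = -1" "gamma $1$2 = 2 * (1 + sqrt 2)" "gamma $2$1 = 0" "gamma $2$2 = 1"
  by (simp_all add: alpha_def beta_def gamma_def)

lemma mat_1_nth [simp]:
  "(mat 1 :: real^2^2) $1$1 = 1" "(mat 1 :: real^2^2) $1$2 = 0"
  "(mat 1 :: real^2^2) $2$1 = 0" "(mat 1 :: real^2^2) $2$2 = 1"
  by (simp_all add: mat_def)

lemma matrix_minus_mult [simp]: "(- M) ** N = - (M ** N)" "M ** (- N) = - (M ** N)" for M N :: "real^2^2"
  by (simp_all add: matrix_eq_iff matrix_mult_nth)

lemma generator_square [simp]: "alpha ** alpha = mat 1" "beta ** beta = mat 1" "gamma ** gamma = mat 1"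
  by (simp_all add: matrix_eq_iff matrix_mult_nth)

lemma nu_alpha: "nu 0 ** alpha = - nu 7" "nu 1 ** alpha = - nu 6" "nu 2 ** alpha = - nu 5" "nu 3 ** alpha = - nu 4"
  "nu 4 ** alpha = - nu 3" "nu 5 ** alpha = - nu 2" "nu 6 ** alpha = - nu 1" "nu 7 ** alpha = - nu 0"
  by (simp_all add: matrix_eq_iff matrix_mult_nth del: One_nat_def)

lemma nu_beta: "nu 0 ** beta = nu 1" "nu 1 ** beta = nu 0" "nu 2 ** beta = - nu 7" "nu 3 ** beta = - nu 6"
  "nu 4 ** beta = - nu 5" "nu 5 ** beta = - nu 4" "nu 6 ** beta = - nu 3" "nu 7 ** beta = - nu 2"
  by (simp_all add: matrix_eq_iff matrix_mult_nth del: One_nat_def)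

lemma le7_cases: "i \<le> (7::nat) \<longleftrightarrow> i = 0 \<or> i = 1 \<or> i = 2 \<or> i = 3 \<or> i = 4 \<or> i = 5 \<or> i = 6 \<or> i = 7"
  by auto

lemma nu_0: "nu 0 = mat 1" by (simp add: matrix_eq_iff)

lemma dih_nu_ex: "d \<in> dih \<Longrightarrow> \<exists>i\<le>7. d = nu i \<or> d = - nu i"
proof (induction rule: dih.induct)
  case one
  show ?case using nu_0 by (metis zero_le)
next
  case (alpha d)
  then obtain i where i: "i \<le> 7" "d = nu i \<or> d = - nu i" by blast
  have "\<exists>j\<le>7. nu i ** alpha = - nu j"
    using i(1) unfolding le7_cases by (elim disjE) (auto simp: nu_alpha simp del: One_nat_def)
  thus ?case using i(2) by auto
next
  case (beta d)
  then obtain i where i: "i \<le> 7" "d = nu i \<or> d = - nu i" by blast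
  have "\<exists>j\<le>7. nu i ** beta = nu j \<or> nu i ** beta = - nu j"
    using i(1) unfolding le7_cases by (elim disjE) (auto simp: nu_beta simp del: One_nat_def)
  thus ?case using i(2) by fastforce
qed

lemma dih_mult: "d \<in> dih \<Longrightarrow> e \<in> dih \<Longrightarrow> d ** e \<in> dih"
  by (rotate_tac, induction rule: dih.induct) (auto simp: matrix_mul_assoc intro: dih.intros)

lemma generators_dih [simp]: "mat 1 \<in> dih" "alpha \<in> dih" "beta \<in> dih"
  using dih.alpha[OF dih.one] dih.beta[OF dih.one] by (simp_all add: dih.one)

lemma nu_products:
  "nu 1 = beta" "nu 2 = alpha ** beta" "nu 3 = beta ** nu 2" "nu 4 = nu 2 ** nu 2"
  "nu 5 = beta ** nu 4" "nu 6 = nu 4 ** nu 2" "nu 7 = beta ** nu 6" "- mat 1 = nu 4 ** nu 4"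
  by (simp_all add: matrix_eq_iff matrix_mult_nth del: One_nat_def)

lemma nu_dih: "i \<le> 7 \<Longrightarrow> nu i \<in> dih"
  and minus_one_dih: "- mat 1 \<in> dih"
proof -
  have 2: "nu 2 \<in> dih" unfolding nu_products by (simp add: dih_mult)
  have 4: "nu 4 \<in> dih" unfolding nu_products(4) using 2 by (simp add: dih_mult)
  have 6: "nu 6 \<in> dih" unfolding nu_products(6) using 2 4 by (simp add: dih_mult)
  have odd: "nu 1 \<in> dih" "nu 3 \<in> dih" "nu 5 \<in> dih" "nu 7 \<in> dih"
    unfolding nu_products(1,3,5,7) using 2 4 6 by (simp_all add: dih_mult)
  show "i \<le> 7 \<Longrightarrow> nu i \<in> dih" using 2 4 6 odd nu_0 unfolding le7_cases by auto
  show "- mat 1 \<in> dih" unfolding nu_products(8) using 4 by (simp add: dih_mult)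
qed

lemma minus_dih: "d \<in> dih \<Longrightarrow> - d \<in> dih"
  using dih_mult[OF _ minus_one_dih] by fastforce

lemma dih_V_P: "d \<in> dih \<Longrightarrow> d \<in> V_P"
  by (induction rule: dih.induct) (auto intro: V_P.intros)

lemma unimodular_dih: "d \<in> dih \<Longrightarrow> unimodular d"
  by (intro V_P_unimodular dih_V_P)

lemma inv_unique:
  assumes "unimodular g" "g ** h = mat 1" shows "matrix_inv g = h"
proof -
  have "matrix_inv g = matrix_inv g ** (g ** h)" using assms(2) by simp
  also have "\<dots> = h" using unimodular_inv(2)[OF assms(1)] by (simp add: matrix_mul_assoc)
  finally show ?thesis .
qed

lemma matrix_inv_mult:
  assumes "unimodular g" "unimodular h" shows "matrix_inv (g ** h) = matrix_inv h ** matrix_inv g"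
proof (rule inv_unique)
  have "g ** h ** (matrix_inv h ** matrix_inv g) = g ** (h ** matrix_inv h) ** matrix_inv g"
    by (simp add: matrix_mul_assoc)
  thus "g ** h ** (matrix_inv h ** matrix_inv g) = mat 1" using assms by (simp add: unimodular_inv)
qed (use assms in \<open>simp add: unimodular_mult\<close>)

lemma matrix_inv_inv: "unimodular g \<Longrightarrow> matrix_inv (matrix_inv g) = g"
  by (intro inv_unique unimodular_inv)

lemma matrix_inv_generators: "matrix_inv alpha = alpha" "matrix_inv beta = beta" "matrix_inv gamma = gamma"
  "matrix_inv (mat 1 :: real^2^2) = mat 1"
  by (simp_all add: inv_unique)

lemma dih_inv: "d \<in> dih \<Longrightarrow> matrix_inv d \<in> dih"
  by (induction rule: dih.induct)
    (simp_all add: matrix_inv_generators matrix_inv_mult unimodular_dih dih_mult)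

lemma form_mult:
  "form a b c (r v* M) = form (a * (M$1$1)\<^sup>2 + b * M$1$1 * M$1$2 + c * (M$1$2)\<^sup>2)
     (2 * a * M$1$1 * M$2$1 + b * (M$1$1 * M$2$2 + M$1$2 * M$2$1) + 2 * c * M$1$2 * M$2$2)
     (a * (M$2$1)\<^sup>2 + b * M$2$1 * M$2$2 + c * (M$2$2)\<^sup>2) r"
  by (simp add: form_def vector_mult_nth power2_eq_square algebra_simps)

lemma Form_mult:
  "Form a b c (N ** M) = Form (a * (M$1$1)\<^sup>2 + b * M$1$1 * M$1$2 + c * (M$1$2)\<^sup>2)
     (2 * a * M$1$1 * M$2$1 + b * (M$1$1 * M$2$2 + M$1$2 * M$2$1) + 2 * c * M$1$2 * M$2$2)
     (a * (M$2$1)\<^sup>2 + b * M$2$1 * M$2$2 + c * (M$2$2)\<^sup>2) N"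
  by (simp add: Form_def row_mult form_mult)

lemma form_minus [simp]: "form a b c (- r) = form a b c r"
  by (simp add: form_def)

lemma vector_mult_minus [simp]: "r v* (- M) = - (r v* M)" for r :: "real^2" and M :: "real^2^2"
  by (simp add: vec_eq_iff vector_mult_nth)

lemma Form_minus [simp]: "Form a b c (- N) = Form a b c N"
  by (simp add: Form_def)

lemma frame_minus [simp]: "frame (- N) = frame N" and pt_minus [simp]: "pt (- N) = pt N"
  by (simp_all add: frame_def pt_def)

text \<open>
  The forms of the sides of the triangle. \<open>wall\<close> and \<open>Wall\<close> belong to \<open>E\<^sub>0\<close>; the triangle lies on the side
  where the values are nonnegative.
\<close>
abbreviation wall :: "real^2 \<Rightarrow> real" where "wall \<equiv> form (1 + sqrt 2) 1 0"
abbreviation Wall :: "real^2^2 \<Rightarrow> real" where "Wall \<equiv> Form (1 + sqrt 2) 1 0"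
abbreviation wall_alpha :: "real^2^2 \<Rightarrow> real" where "wall_alpha \<equiv> Form 0 (-1) 0"
abbreviation wall_beta :: "real^2^2 \<Rightarrow> real" where "wall_beta \<equiv> Form (-1) 2 1"

lemma wall_gamma [simp]: "wall (r v* gamma) = - wall r"
  by (simp add: form_def vector_mult_nth power2_eq_square algebra_simps)

lemma Wall_gamma [simp]: "Wall (N ** gamma) = - Wall N"
  by (simp add: Form_def row_mult)

definition octagon :: "real^2^2 \<Rightarrow> bool" where
  "octagon N \<longleftrightarrow> (\<forall>d\<in>dih. Wall (N ** d) \<ge> 0)"

lemma sqrt2_bounds: "sqrt 2 > 7/5" "sqrt 2 < 3/2"
proof -
  show "sqrt 2 > 7/5" by (rule real_less_rsqrt) (simp add: power2_eq_square)
  show "sqrt 2 < 3/2" by (rule real_less_lsqrt) (simp_all add: power2_eq_square)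
qed

text \<open>
  Two disjoint half planes have normalized forms with a semidefinite sum, which is degenerate precisely
  if the half planes have a common ideal point. As \<open>d\<close> is orthogonal, both forms have trace
  \<open>1 + \<surd>2\<close>.
\<close>
lemma wall_sum_semidefinite:
  assumes "d \<in> dih" "d \<noteq> mat 1" "d \<noteq> - mat 1"
  obtains a b c where "\<And>r. wall r + wall (r v* d) = form a b c r"
    "b\<^sup>2 \<le> 4 * a * c" "a + c = 2 * (1 + sqrt 2)"
proof -
  obtain i where i: "i \<le> 7" "d = nu i \<or> d = - nu i" using dih_nu_ex[OF assms(1)] by blast
  have "wall (r v* d) = wall (r v* nu i)" for r using i(2) by auto
  hence wd: "wall (r v* d) = form ((1 + sqrt 2) * (nu i$1$1)\<^sup>2 + nu i$1$1 * nu i$1$2)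
     (2 * (1 + sqrt 2) * nu i$1$1 * nu i$2$1 + (nu i$1$1 * nu i$2$2 + nu i$1$2 * nu i$2$1))
     ((1 + sqrt 2) * (nu i$2$1)\<^sup>2 + nu i$2$1 * nu i$2$2) r" for r
    by (simp add: form_mult)
  have add: "form a b c r + form a' b' c' r = form (a + a') (b + b') (c + c') r" for a b c a' b' c' r
    by (simp add: form_def algebra_simps)
  have "i \<noteq> 0" using assms(2,3) i(2) nu_0 by metis
  hence "i = 1 \<or> i = 2 \<or> i = 3 \<or> i = 4 \<or> i = 5 \<or> i = 6 \<or> i = 7" using i(1) by auto
  hence num: "(1 + (2 * (1 + sqrt 2) * nu i$1$1 * nu i$2$1 + (nu i$1$1 * nu i$2$2 + nu i$1$2 * nu i$2$1)))\<^sup>2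
    \<le> 4 * ((1 + sqrt 2) + ((1 + sqrt 2) * (nu i$1$1)\<^sup>2 + nu i$1$1 * nu i$1$2)) *
      (0 + ((1 + sqrt 2) * (nu i$2$1)\<^sup>2 + nu i$2$1 * nu i$2$2)) \<and>
   ((1 + sqrt 2) + ((1 + sqrt 2) * (nu i$1$1)\<^sup>2 + nu i$1$1 * nu i$1$2)) +
      (0 + ((1 + sqrt 2) * (nu i$2$1)\<^sup>2 + nu i$2$1 * nu i$2$2)) = 2 * (1 + sqrt 2)"
    using sqrt2_bounds
    by (elim disjE) (simp_all add: power2_eq_square field_simps del: One_nat_def)
  show ?thesis
    by (rule that[OF _ conjunct1[OF num] conjunct2[OF num]]) (simp only: wd add)
qed

lemma semidefinite_form:
  assumes "b\<^sup>2 \<le> 4 * a * c" "a + c > 0"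
  shows "a * x\<^sup>2 + b * x * y + c * y\<^sup>2 \<ge> (0::real)"
proof -
  have "a * c \<ge> 0" using assms(1) zero_le_power2[of b] by linarith
  hence ac: "a \<ge> 0" "c \<ge> 0" using assms(2) by (auto simp: zero_le_mult_iff)
  show ?thesis
  proof (cases "a = 0")
    case True
    hence "b = 0" using assms(1) by simp
    thus ?thesis using True ac by simp
  next
    case False
    have "4 * a * (a * x\<^sup>2 + b * x * y + c * y\<^sup>2) = (2 * a * x + b * y)\<^sup>2 + (4 * a * c - b\<^sup>2) * y\<^sup>2"
      by (simp add: power2_eq_square algebra_simps)
    also have "\<dots> \<ge> 0" using assms by simp
    finally show ?thesis using False ac by (simp add: zero_le_mult_iff)
  qed
qed

text \<open>
  A quantitative version of positivity. The denominator is \<open>2 cosh\<close> of the distance from \<open>\<i>\<close>, so on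
  bounded sets the half planes have a uniform distance from each other in the sense of their forms;
  \<open>octagon_reached\<close> needs this for termination.
\<close>
lemma Form_semidefinite_lower:
  assumes N: "unimodular N" and abc: "b\<^sup>2 \<le> 4 * a * c" "a + c > 0"
  shows "Form a b c N \<ge> (a + c) / (Form_A N + Form_D N)"
proof -
  define A B D where "A = Form_A N" and "B = Form_B N" and "D = Form_D N"
  have pos: "A > 0" "D > 0" "A * D = B\<^sup>2 + 1"
    using Form_pos[OF N] Form_unimodular[OF N] by (simp_all add: A_def B_def D_def)
  have "(a * A + b * B + c * D) * (A + D) =
     (a * A\<^sup>2 + b * A * B + c * B\<^sup>2) + (a * B\<^sup>2 + b * B * D + c * D\<^sup>2) + (a + c) * (A * D - B\<^sup>2)"
    by (simp add: power2_eq_square algebra_simps)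
  also have "\<dots> \<ge> a + c" using semidefinite_form[OF abc, of A B] semidefinite_form[OF abc, of B D] pos(3) by simp
  finally have "(a + c) / (A + D) \<le> a * A + b * B + c * D"
    using pos by (simp add: divide_le_eq)
  thus ?thesis by (subst Form_expand) (simp add: A_def B_def D_def)
qed

lemma wall_disjoint:
  assumes "d \<in> dih" "d \<noteq> mat 1" "d \<noteq> - mat 1"
  shows "wall r + wall (r v* d) \<ge> 0"
    "unimodular N \<Longrightarrow> Wall N + Wall (N ** d) \<ge> 2 * (1 + sqrt 2) / (Form_A N + Form_D N)"
proof -
  obtain a b c where f: "\<And>r. wall r + wall (r v* d) = form a b c r"
    and abc: "b\<^sup>2 \<le> 4 * a * c" "a + c = 2 * (1 + sqrt 2)"
    using wall_sum_semidefinite[OF assms] by blast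
  have pos: "a + c > 0" using abc(2) sqrt2_bounds by simp
  have "form a b c r \<ge> 0" unfolding form_def by (rule semidefinite_form[OF abc(1) pos])
  thus "wall r + wall (r v* d) \<ge> 0" by (simp only: f)
  assume N: "unimodular N"
  have "Wall N + Wall (N ** d) = Form a b c N"
    by (simp add: Form_def row_mult flip: f)
  thus "Wall N + Wall (N ** d) \<ge> 2 * (1 + sqrt 2) / (Form_A N + Form_D N)"
    using Form_semidefinite_lower[OF N abc(1) pos] abc(2) by simp
qed

lemma Wall_disjoint_strict:
  assumes "d \<in> dih" "d \<noteq> mat 1" "d \<noteq> - mat 1" "unimodular N" "Wall N \<le> 0"
  shows "Wall (N ** d) > 0"
proof -
  have "2 * (1 + sqrt 2) / (Form_A N + Form_D N) > 0"
    using Form_pos[OF assms(4)] sqrt2_bounds by (intro divide_pos_pos) auto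
  thus ?thesis using wall_disjoint(2)[OF assms(1-4)] assms(5) by linarith
qed

section \<open>Folding\<close>

lemma Form_alpha: "Form_A (N ** alpha) = Form_A N" "Form_B (N ** alpha) = - Form_B N" "Form_D (N ** alpha) = Form_D N"
  by (simp_all add: Form_def form_def matrix_mult_nth)

lemma Form_beta: "Form_A (N ** beta) = (Form_A N + 2 * Form_B N + Form_D N) / 2"
  "Form_B (N ** beta) = (Form_A N - Form_D N) / 2"
  "Form_D (N ** beta) = (Form_A N - 2 * Form_B N + Form_D N) / 2"
  by (simp_all add: Form_def form_def matrix_mult_nth power2_eq_square field_simps)

text \<open>
  On the coordinates \<open>u = 2 B\<close> and \<open>v = D - A\<close> the reflections \<open>\<alpha>\<close> and \<open>\<beta>\<close> act by \<open>(-u, v)\<close> and \<open>(-v, -u)\<close>, so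
  that some dihedral image lies in the cone \<open>u \<le> 0 \<le> u + v\<close>. The matrix is arbitrary here; with two equal rows
  the lemma also folds boundary points.
\<close>
lemma fold_sector: obtains d where "d \<in> dih" "wall_alpha (N ** d) \<ge> 0" "wall_beta (N ** d) \<ge> 0"
proof -
  define u v where "u = 2 * Form_B N" and "v = Form_D N - Form_A N"
  have *: ?thesis if "d \<in> dih" "2 * Form_B (N ** d) \<le> 0" "2 * Form_B (N ** d) + (Form_D (N ** d) - Form_A (N ** d)) \<ge> 0" for d
    using that(2,3) by (intro that(1)[THEN \<open>\<And>d. \<lbrakk>d \<in> dih; wall_alpha (N ** d) \<ge> 0; wall_beta (N ** d) \<ge> 0\<rbrakk> \<Longrightarrow> thesis\<close>])
      (subst Form_expand, simp)+
  have dih: "alpha ** beta \<in> dih" "beta ** alpha \<in> dih" "alpha ** beta ** alpha \<in> dih"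
    "beta ** alpha ** beta \<in> dih" "alpha ** beta ** alpha ** beta \<in> dih"
    by (simp_all add: dih_mult)
  \<comment> \<open>The dihedral images of \<open>(u, v)\<close> arise by changing signs and exchanging the entries. The entry of larger
    absolute value has to become the second one and nonnegative, the other one nonpositive.\<close>
  consider "v \<ge> \<bar>u\<bar>" "u \<le> 0" | "v \<ge> \<bar>u\<bar>" "u \<ge> 0" | "- v \<ge> \<bar>u\<bar>" "u \<le> 0" | "- v \<ge> \<bar>u\<bar>" "u \<ge> 0"
    | "u \<ge> \<bar>v\<bar>" "v \<ge> 0" | "u \<ge> \<bar>v\<bar>" "v \<le> 0" | "- u \<ge> \<bar>v\<bar>" "v \<ge> 0" | "- u \<ge> \<bar>v\<bar>" "v \<le> 0"
    by linarith
  thus ?thesis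
  proof cases
    case 1 thus ?thesis by (intro *[of "mat 1"]) (auto simp: u_def v_def)
  next
    case 2 thus ?thesis by (intro *[of alpha]) (auto simp: u_def v_def Form_alpha)
  next
    case 3 thus ?thesis by (intro *[OF dih(4)]) (auto simp: u_def v_def Form_alpha Form_beta matrix_mul_assoc field_simps)
  next
    case 4 thus ?thesis by (intro *[OF dih(5)]) (auto simp: u_def v_def Form_alpha Form_beta matrix_mul_assoc field_simps)
  next
    case 5 thus ?thesis by (intro *[OF dih(1)]) (auto simp: u_def v_def Form_alpha Form_beta matrix_mul_assoc field_simps)
  next
    case 6 thus ?thesis by (intro *[OF dih(3)]) (auto simp: u_def v_def Form_alpha Form_beta matrix_mul_assoc field_simps)
  next
    case 7 thus ?thesis by (intro *[of beta]) (auto simp: u_def v_def Form_alpha Form_beta matrix_mul_assoc field_simps)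
  next
    case 8 thus ?thesis by (intro *[OF dih(2)]) (auto simp: u_def v_def Form_alpha Form_beta matrix_mul_assoc field_simps)
  qed
qed

text \<open>
  The arcs under the sides of the octagon cover the boundary: folded into the sector of the triangle, a
  boundary point lies under \<open>E\<^sub>0\<close>.
\<close>
lemma wall_covers:
  assumes "r \<noteq> 0" obtains d where "d \<in> dih" "wall (r v* d) \<le> 0"
proof -
  define N :: "real^2^2" where "N = (\<chi> i. r)"
  obtain d where d: "d \<in> dih" "wall_alpha (N ** d) \<ge> 0" "wall_beta (N ** d) \<ge> 0"
    using fold_sector by blast
  define m n where "m = (r v* d)$1" and "n = (r v* d)$2"
  have mn: "m * n \<le> 0" "n\<^sup>2 + 2 * m * n - m\<^sup>2 \<ge> 0"
    using d(2,3) by (simp_all add: Form_def row_mult N_def form_def m_def n_def)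
  have "wall (r v* d) \<le> 0"
  proof (rule ccontr)
    assume "\<not> ?thesis"
    hence pos: "m * (n + (1 + sqrt 2) * m) > 0"
      by (simp add: form_def m_def n_def power2_eq_square algebra_simps)
    have "m\<^sup>2 * (n\<^sup>2 + 2 * m * n - m\<^sup>2) = (m * (n + (1 + sqrt 2) * m)) * (m * (n + (1 - sqrt 2) * m))"
      by (simp add: power2_eq_square algebra_simps)
    moreover have "m\<^sup>2 * (n\<^sup>2 + 2 * m * n - m\<^sup>2) \<ge> 0" using mn by simp
    ultimately have "m * (n + (1 - sqrt 2) * m) \<ge> 0"
      using pos by (simp add: zero_le_mult_iff)
    moreover have "m * (n + (1 - sqrt 2) * m) = m * n - (sqrt 2 - 1) * m\<^sup>2"
      by (simp add: power2_eq_square algebra_simps)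
    moreover have "m \<noteq> 0" using pos by auto
    hence "(sqrt 2 - 1) * m\<^sup>2 > 0" using sqrt2_bounds by simp
    ultimately show False using mn(1) by linarith
  qed
  with d(1) that show ?thesis by blast
qed

definition tri :: "real^2^2 \<Rightarrow> bool" where
  "tri N \<longleftrightarrow> wall_alpha N \<ge> 0 \<and> wall_beta N \<ge> 0 \<and> Wall N \<ge> 0"

lemma triangle_pt: assumes "unimodular N" shows "pt N \<in> triangle \<longleftrightarrow> tri N"
proof -
  have D: "Form_D N > 0" and c: "coordA (pt N) = Form_A N"
    using Form_pos[OF assms] coord_pt[OF assms] by auto
  have cm: "(cmod (pt N))\<^sup>2 = Form_A N / Form_D N"
    using c D by (simp add: coordA_def pt_def field_simps)
  have "(cmod (pt N - 1))\<^sup>2 = (cmod (pt N))\<^sup>2 - 2 * Re (pt N) + 1"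
    unfolding cmod_power2 by (simp add: power2_eq_square algebra_simps)
  hence "(cmod (pt N - 1))\<^sup>2 = (Form_A N - 2 * Form_B N + Form_D N) / Form_D N"
    using D unfolding cm by (simp add: pt_def field_simps)
  hence 2: "(cmod (pt N - 1))\<^sup>2 \<le> 2 \<longleftrightarrow> wall_beta N \<ge> 0"
    using D by (subst Form_expand) (auto simp: pos_divide_le_eq)
  have 1: "Re (pt N) \<le> 0 \<longleftrightarrow> wall_alpha N \<ge> 0"
    using D by (subst Form_expand) (simp add: pt_def divide_le_0_iff)
  have "(1 + sqrt 2) * (cmod (pt N))\<^sup>2 + Re (pt N) = Wall N / Form_D N"
    unfolding cm by (subst Form_expand) (simp add: pt_def add_divide_distrib)
  hence 3: "(1 + sqrt 2) * (cmod (pt N))\<^sup>2 + Re (pt N) \<ge> 0 \<longleftrightarrow> Wall N \<ge> 0"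
    using D by (simp add: zero_le_divide_iff)
  show ?thesis using coord_pt(4)[OF assms] by (auto simp: triangle_def tri_def 1 2 3)
qed

lemma nu_forms:
  "Form_A (N ** nu 1) = (Form_A N + 2 * Form_B N + Form_D N)/2" "Form_B (N ** nu 1) = (Form_A N - Form_D N)/2"
    "Form_D (N ** nu 1) = (Form_A N - 2 * Form_B N + Form_D N)/2"
  "Form_A (N ** nu 2) = (Form_A N - 2 * Form_B N + Form_D N)/2" "Form_B (N ** nu 2) = (Form_A N - Form_D N)/2"
    "Form_D (N ** nu 2) = (Form_A N + 2 * Form_B N + Form_D N)/2"
  "Form_A (N ** nu 3) = Form_D N" "Form_B (N ** nu 3) = Form_B N" "Form_D (N ** nu 3) = Form_A N"
  "Form_A (N ** nu 4) = Form_D N" "Form_B (N ** nu 4) = - Form_B N" "Form_D (N ** nu 4) = Form_A N"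
  "Form_A (N ** nu 5) = (Form_A N - 2 * Form_B N + Form_D N)/2" "Form_B (N ** nu 5) = (Form_D N - Form_A N)/2"
    "Form_D (N ** nu 5) = (Form_A N + 2 * Form_B N + Form_D N)/2"
  "Form_A (N ** nu 6) = (Form_A N + 2 * Form_B N + Form_D N)/2" "Form_B (N ** nu 6) = (Form_D N - Form_A N)/2"
    "Form_D (N ** nu 6) = (Form_A N - 2 * Form_B N + Form_D N)/2"
  "Form_A (N ** nu 7) = Form_A N" "Form_B (N ** nu 7) = - Form_B N" "Form_D (N ** nu 7) = Form_D N"
  by (simp_all add: Form_def form_def matrix_mult_nth power2_eq_square field_simps del: One_nat_def)

lemma dih_Form_trace: assumes "d \<in> dih" shows "Form_A (N ** d) + Form_D (N ** d) = Form_A N + Form_D N"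
  using assms
proof (induction arbitrary: N rule: dih.induct)
  case (alpha d)
  have "Form_A ((N ** d) ** alpha) + Form_D ((N ** d) ** alpha) = Form_A (N ** d) + Form_D (N ** d)"
    by (simp add: Form_alpha)
  thus ?case using alpha by (simp add: matrix_mul_assoc)
next
  case (beta d)
  have "Form_A ((N ** d) ** beta) + Form_D ((N ** d) ** beta) = Form_A (N ** d) + Form_D (N ** d)"
    by (simp add: Form_beta field_simps)
  thus ?case using beta by (simp add: matrix_mul_assoc)
qed simp

text \<open>
  Among its dihedral images a point of the triangle is the closest one to \<open>E\<^sub>0\<close>: for the other images the
  value of \<open>Wall\<close> is larger by a nonnegative combination of the other two forms.
\<close>
lemma tri_octagon: assumes "tri N" shows "octagon N"
  unfolding octagon_def
proof
  fix d assume "d \<in> dih"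
  then obtain i where i: "i \<le> 7" "d = nu i \<or> d = - nu i" using dih_nu_ex by blast
  have "Form_B N \<le> 0" "Form_D N + 2 * Form_B N - Form_A N \<ge> 0" "(1 + sqrt 2) * Form_A N + Form_B N \<ge> 0"
    using assms unfolding tri_def by (subst (asm) (1 2 3) Form_expand, simp)+
  moreover from this have "sqrt 2 * Form_B N \<le> 0" "sqrt 2 * (Form_D N + 2 * Form_B N - Form_A N) \<ge> 0"
    by (auto simp: mult_le_0_iff)
  ultimately have "Wall (N ** nu i) \<ge> 0"
    using i(1) unfolding le7_cases Form_expand[of "1 + sqrt 2"]
    by (elim disjE; simp add: nu_forms nu_0 algebra_simps del: One_nat_def; argo)
  thus "Wall (N ** d) \<ge> 0" using i(2) by auto
qed

text \<open>
  A whole geodesic \<open>E\<^sub>0\<close> is a side of the triangle, and it does not meet the two other sides, because it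
  has only ideal points in common with them.
\<close>
lemma tri_on_Wall: assumes N: "unimodular N" and W: "Wall N = 0" 
  shows "wall_alpha N > 0" "wall_beta N > 0" "tri N"
proof -
  have pos: "Form_A N > 0" "Form_D N > 0" "Form_A N * Form_D N = (Form_B N)\<^sup>2 + 1"
    using Form_pos[OF N] Form_unimodular[OF N] by simp_all
  have B: "Form_B N = - ((1 + sqrt 2) * Form_A N)"
    using W by (subst (asm) Form_expand) simp
  have "(1 + sqrt 2) * Form_A N > 0" using pos sqrt2_bounds by simp
  thus 1: "wall_alpha N > 0" using B by (subst Form_expand) simp
  have "Form_A N * wall_beta N = (Form_B N)\<^sup>2 + 1 + 2 * Form_A N * Form_B N - (Form_A N)\<^sup>2"
    unfolding pos(3)[symmetric] by (subst Form_expand) (simp add: power2_eq_square algebra_simps)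
  also have "\<dots> = 1" unfolding B by (simp add: power2_eq_square algebra_simps)
  finally have "Form_A N * wall_beta N > 0" by simp
  thus 2: "wall_beta N > 0" using pos(1) by (simp add: zero_less_mult_iff)
  show "tri N" using 1 2 W by (simp add: tri_def)
qed

text \<open>
  For a base point in the triangle this is, up to sign, the group generated by the reflections in those
  sides that contain the point. The last case is the vertex \<open>\<i>\<close>.
\<close>
definition stab :: "real^2^2 \<Rightarrow> (real^2^2) set" where
  "stab N = {g. g = mat 1 \<or> g = - mat 1
     \<or> (g = alpha \<or> g = - alpha) \<and> wall_alpha N = 0
     \<or> (g = beta \<or> g = - beta) \<and> wall_beta N = 0
     \<or> (g = gamma \<or> g = - gamma) \<and> Wall N = 0
     \<or> g \<in> dih \<and> wall_alpha N = 0 \<and> wall_beta N = 0}"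

lemma stab_pt: assumes N: "unimodular N" and g: "g \<in> stab N" shows "pt (N ** g) = pt N"
proof -
  have a: "pt (N ** alpha) = pt N" if "wall_alpha N = 0"
    using that N by (intro pt_eqI) (auto simp: Form_alpha unimodular_mult, subst (asm) (1) Form_expand, simp)
  have b: "pt (N ** beta) = pt N" if "wall_beta N = 0"
    using that N by (intro pt_eqI) (auto simp: Form_beta unimodular_mult, (subst (asm) (1) Form_expand, simp)+)
  have c: "pt (N ** gamma) = pt N" if "Wall N = 0"
  proof (rule pt_eqI)
    have "Form_A (N ** gamma) = Form_A N" "Form_B (N ** gamma) = - 2 * (1 + sqrt 2) * Form_A N - Form_B N"
      by (simp_all add: Form_def form_def matrix_mult_nth power2_eq_square algebra_simps)
    moreover have "(1 + sqrt 2) * Form_A N + Form_B N = 0" using that by (subst (asm) Form_expand) simp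
    ultimately show "Form_B (N ** gamma) = Form_B N" "Form_A (N ** gamma) = Form_A N \<or> Form_D (N ** gamma) = Form_D N"
      by (auto simp: algebra_simps)
  qed (use N in \<open>auto simp: unimodular_mult\<close>)
  have d: "pt (N ** g) = pt N" if w: "wall_alpha N = 0" "wall_beta N = 0" and gd: "g \<in> dih"
  proof (rule pt_eqI)
    have z: "Form_B N = 0" "Form_D N = Form_A N"
      using w by ((subst (asm) (1 2) Form_expand), simp)+
    obtain i where i: "i \<le> 7" "g = nu i \<or> g = - nu i" using dih_nu_ex gd by blast
    have "Form_B (N ** nu i) = Form_B N \<and> Form_A (N ** nu i) = Form_A N"
      using i(1) unfolding le7_cases by (elim disjE) (simp_all add: nu_forms z nu_0 del: One_nat_def)
    thus "Form_B (N ** g) = Form_B N" "Form_A (N ** g) = Form_A N \<or> Form_D (N ** g) = Form_D N"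
      using i(2) by auto
  qed (use N gd in \<open>auto simp: unimodular_mult unimodular_dih\<close>)
  show ?thesis using g a b c d by (auto simp: stab_def)
qed

text \<open>
  A finite check. The rotations leave only the center of the sector in place, because the image of the
  sector meets the sector in its apex.
\<close>
lemma dih_strict:
  assumes N: "unimodular N" and d: "d \<in> dih" and t: "tri N" "tri (N ** d)"
  shows "d \<in> stab N"
proof -
  obtain i where i: "i \<le> 7" "d = nu i \<or> d = - nu i" using dih_nu_ex d by blast
  have t1: "Form_B N \<le> 0" "Form_D N + 2 * Form_B N - Form_A N \<ge> 0"
    using t(1) unfolding tri_def by (subst (asm) (1 2 3) Form_expand, simp)+
  have "tri (N ** nu i)" using t(2) i(2) by (auto simp: tri_def)
  hence t2: "Form_B (N ** nu i) \<le> 0" "Form_D (N ** nu i) + 2 * Form_B (N ** nu i) - Form_A (N ** nu i) \<ge> 0"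
    unfolding tri_def by (subst (asm) (1 2 3) Form_expand, simp)+
  have z: "wall_alpha N = - Form_B N" "wall_beta N = Form_D N + 2 * Form_B N - Form_A N"
    by (subst Form_expand, simp)+
  have c: "wall_alpha N = 0 \<and> wall_beta N = 0 \<Longrightarrow> d \<in> stab N" using d by (simp add: stab_def)
  have n7: "nu 7 = - alpha" by (simp add: matrix_eq_iff)
  consider "i = 0" | "i = 1" | "i = 7" | "i = 2 \<or> i = 3 \<or> i = 4 \<or> i = 5 \<or> i = 6"
    using i(1) by linarith
  thus ?thesis
  proof cases
    case 1 thus ?thesis using i(2) nu_0 by (auto simp: stab_def)
  next
    case 2
    have "wall_beta N = 0" using t1 t2 unfolding 2 nu_forms z by argo
    thus ?thesis using 2 i(2) nu_products(1) by (auto simp: stab_def simp del: One_nat_def)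
  next
    case 3
    hence "wall_alpha N = 0" using t1 t2 by (simp add: nu_forms z)
    thus ?thesis using 3 i(2) n7 by (auto simp: stab_def)
  next
    case 4
    hence "Form_B N = 0 \<and> Form_D N = Form_A N" using t1 t2
      by (elim disjE; hypsubst; simp only: nu_forms; intro conjI; argo)
    thus ?thesis using c z by simp
  qed
qed

section \<open>Normal forms\<close>

text \<open>
  \<open>reduced g e\<close> says that \<open>g\<close> is a word \<open>d\<^sub>0 \<gamma> d\<^sub>1 \<gamma> \<dots> \<gamma> e\<close> with at least one \<open>\<gamma>\<close> whose inner dihedral
  letters are not \<open>\<plusminus>1\<close>. The last letter is recorded because it decides whether another \<open>\<gamma>\<close> cancels.
\<close>
inductive reduced :: "real^2^2 \<Rightarrow> real^2^2 \<Rightarrow> bool" where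
  base: "d \<in> dih \<Longrightarrow> e \<in> dih \<Longrightarrow> reduced (d ** gamma ** e) e"
| step: "reduced g d \<Longrightarrow> d \<noteq> mat 1 \<Longrightarrow> d \<noteq> - mat 1 \<Longrightarrow> e \<in> dih \<Longrightarrow> reduced (g ** gamma ** e) e"

definition normal_form :: "real^2^2 \<Rightarrow> bool" where
  "normal_form g \<longleftrightarrow> g \<in> dih \<or> (\<exists>e. reduced g e)"

lemma reduced_last: "reduced g e \<Longrightarrow> e \<in> dih"
  by (induction rule: reduced.induct) auto

lemma reduced_dih: "reduced g e \<Longrightarrow> d \<in> dih \<Longrightarrow> reduced (g ** d) (e ** d)"
  by (induction rule: reduced.induct)
    (metis dih_mult matrix_mul_assoc reduced.base, metis dih_mult matrix_mul_assoc reduced.step)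

lemma normal_form_dih: "normal_form g \<Longrightarrow> d \<in> dih \<Longrightarrow> normal_form (g ** d)"
  unfolding normal_form_def using reduced_dih dih_mult by blast

lemma normal_form_gamma: assumes "normal_form g" shows "normal_form (g ** gamma)"
proof (cases "g \<in> dih")
  case True
  hence "reduced (g ** gamma ** mat 1) (mat 1)" by (intro reduced.base) auto
  thus ?thesis by (auto simp: normal_form_def)
next
  case False
  then obtain e where e: "reduced g e" using assms by (auto simp: normal_form_def)
  show ?thesis
  proof (cases "e = mat 1 \<or> e = - mat 1")
    case False
    with e have "reduced (g ** gamma ** mat 1) (mat 1)" by (intro reduced.step) auto
    thus ?thesis by (auto simp: normal_form_def)
  next
    case True
    have "\<exists>x. normal_form x \<and> g = x ** gamma ** e"
      using e by (cases rule: reduced.cases) (auto simp: normal_form_def)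
    then obtain x where x: "normal_form x" "g = x ** gamma ** e" by blast
    have "x ** gamma ** gamma = x" by (simp flip: matrix_mul_assoc)
    hence "g ** gamma = x \<or> g ** gamma = x ** (- mat 1)" using True x(2) by auto
    thus ?thesis using x(1) normal_form_dih[OF x(1) minus_one_dih] by auto
  qed
qed

text \<open>
  The statement is proved for multiplication by \<open>g\<close> and by its inverse simultaneously, since \<open>V\<^sub>P\<close> is
  generated with inverses.
\<close>
lemma V_P_normal_form: assumes "g \<in> V_P" shows "normal_form g"
proof -
  have "(\<forall>w. normal_form w \<longrightarrow> normal_form (w ** g)) \<and> (\<forall>w. normal_form w \<longrightarrow> normal_form (w ** matrix_inv g))"
    using assms
  proof (induction rule: V_P.induct)
    case one
    thus ?case by (simp add: matrix_inv_generators)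
  next
    case (gen g)
    thus ?case
      by (auto simp: matrix_inv_generators normal_form_gamma normal_form_dih)
  next
    case (mult g h)
    thus ?case by (simp add: matrix_inv_mult V_P_unimodular matrix_mul_assoc)
  next
    case (inv g)
    thus ?case by (simp add: matrix_inv_inv V_P_unimodular)
  qed
  moreover have "normal_form (mat 1)" by (simp add: normal_form_def)
  ultimately have "normal_form (mat 1 ** g)" by blast
  thus ?thesis by simp
qed

lemma matrix_inv_cancel: "unimodular d \<Longrightarrow> M ** d ** matrix_inv d = M" "unimodular d \<Longrightarrow> M ** matrix_inv d ** d = M"
  by (simp_all add: unimodular_inv flip: matrix_mul_assoc)

lemma gamma_V_P: "gamma \<in> V_P" by (simp add: V_P.gen)

lemma reduced_V_P: "reduced g e \<Longrightarrow> g \<in> V_P"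
  by (induction rule: reduced.induct) (simp_all add: V_P.mult dih_V_P gamma_V_P)

text \<open>
  Ping-pong: a reduced word whose last letter is \<open>d\<close> moves the octagon beyond the side \<open>E\<^sub>0 d\<close>. An inner letter
  moves this half plane off the one beyond \<open>E\<^sub>0\<close> (\<open>Wall_disjoint_strict\<close>), and \<open>\<gamma>\<close> exchanges the two sides of
  \<open>E\<^sub>0\<close>. Only a single \<open>\<gamma>\<close> can leave a point on the boundary.
\<close>
lemma reduced_Wall:
  assumes "reduced g d" "unimodular N" "octagon N"
  shows "Wall (N ** g ** matrix_inv d) < 0 \<or>
    (\<exists>d1\<in>dih. g = d1 ** gamma ** d \<and> Wall (N ** d1) = 0 \<and> Wall (N ** g ** matrix_inv d) = 0)"
  using assms(1)
proof (induction rule: reduced.induct)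
  case (base d e)
  have "N ** (d ** gamma ** e) ** matrix_inv e = N ** d ** gamma"
    using base by (simp add: matrix_mul_assoc matrix_inv_cancel unimodular_dih)
  moreover have "Wall (N ** d) \<ge> 0" using assms(3) base(1) by (simp add: octagon_def)
  ultimately show ?case using base by force
next
  case (step g d e)
  have d: "d \<in> dih" using reduced_last step by blast
  have "unimodular (N ** g ** matrix_inv d)"
    using assms(2) V_P_unimodular[OF reduced_V_P[OF step(1)]] unimodular_inv unimodular_dih d
    by (intro unimodular_mult) auto
  hence "Wall (N ** g ** matrix_inv d ** d) > 0"
    using Wall_disjoint_strict[OF d step(2,3)] step.IH by fastforce
  hence "Wall (N ** g ** gamma) < 0" using d by (simp add: matrix_inv_cancel unimodular_dih)
  thus ?case using step by (simp add: matrix_mul_assoc matrix_inv_cancel unimodular_dih)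
qed

text \<open>
  If a word with a letter \<open>\<gamma>\<close> leads from the triangle to the triangle, then by ping-pong it is
  \<open>d\<^sub>1 \<gamma> e\<close>, and the point lies on \<open>E\<^sub>0\<close> after \<open>d\<^sub>1\<close>. Points of \<open>E\<^sub>0\<close> belong to the triangle and have no
  dihedral stabilizer, so \<open>d\<^sub>1\<close> and \<open>e\<close> are \<open>\<plusminus>1\<close>.
\<close>
theorem strict_fundamental_domain:
  assumes N: "unimodular N" and g: "g \<in> V_P" and t: "tri N" "tri (N ** g)"
  shows "g \<in> stab N"
proof (cases "g \<in> dih")
  case True
  thus ?thesis using dih_strict N t by blast
next
  case False
  then obtain e where e: "reduced g e" using V_P_normal_form[OF g] by (auto simp: normal_form_def)
  hence ed: "e \<in> dih" by (rule reduced_last)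
  have "Wall (N ** g ** matrix_inv e) \<ge> 0"
    using tri_octagon[OF t(2)] dih_inv[OF ed] by (simp add: octagon_def)
  then obtain d1 where d1: "d1 \<in> dih" "g = d1 ** gamma ** e" "Wall (N ** d1) = 0"
    using reduced_Wall[OF e N tri_octagon[OF t(1)]] by fastforce
  have u1: "unimodular (N ** d1)" using N d1(1) by (simp add: unimodular_mult unimodular_dih)
  have only_one: "d = mat 1 \<or> d = - mat 1"
    if "unimodular M" "d \<in> stab M" "d \<in> dih" "Wall M = 0" for M d
  proof -
    have "wall_alpha M > 0" "wall_beta M > 0" using tri_on_Wall that by blast+
    moreover have "d \<noteq> gamma" "d \<noteq> - gamma"
      using that(3) dih_Form_trace[OF that(3), of "mat 1"] sqrt2_bounds
      by (auto simp: Form_def form_def power2_eq_square algebra_simps)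
    ultimately show ?thesis using that(2) by (auto simp: stab_def)
  qed
  have "d1 \<in> stab N" using dih_strict[OF N d1(1) t(1)] tri_on_Wall(3)[OF u1 d1(3)] by simp
  hence "pt (N ** d1) = pt N" by (rule stab_pt[OF N])
  hence "Form_A (N ** d1) = Form_A N" "Form_B (N ** d1) = Form_B N"
    using coord_pt[OF N] coord_pt[OF u1] by metis+
  hence WN: "Wall N = 0" using d1(3) by (metis Form_expand mult_zero_left)
  have s1: "d1 = mat 1 \<or> d1 = - mat 1"
    using only_one[OF N \<open>d1 \<in> stab N\<close> d1(1) WN] .
  have u2: "unimodular (N ** gamma)" using N by (simp add: unimodular_mult)
  have "tri (N ** gamma ** e)" using t(2) s1 by (auto simp: d1(2) matrix_mul_assoc tri_def)
  hence "e \<in> stab (N ** gamma)"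
    using dih_strict[OF u2 ed] tri_on_Wall(3)[OF u2] WN by simp
  hence "e = mat 1 \<or> e = - mat 1" using only_one[OF u2 _ ed] WN by simp
  thus ?thesis using s1 d1(2) WN by (auto simp: stab_def)
qed

section \<open>Covering\<close>

lemma Form_gamma_trace: "Form_A (N ** gamma) + Form_D (N ** gamma) = Form_A N + Form_D N + 4 * (1 + sqrt 2) * Wall N"
  by (simp add: Form_def form_def matrix_mult_nth power2_eq_square algebra_simps)

text \<open>
  Descent on \<open>2 cosh\<close> of the distance from \<open>\<i>\<close>, which is the sum of the squares of the entries. It is
  invariant under the dihedral group, and \<open>\<gamma>\<close> changes it by a multiple of \<open>Wall\<close>. A point far beyond \<open>E\<^sub>0\<close>
  therefore loses at least a fixed amount, while a point close to \<open>E\<^sub>0\<close> is reflected into the octagon,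
  because it cannot be close to any other side.
\<close>
lemma octagon_reached:
  assumes "unimodular N" obtains g where "g \<in> V_P" "octagon (N ** g)"
proof -
  define c where "c = 1 + sqrt 2"
  define H where "H = Form_A N + Form_D N"
  \<comment> \<open>The lower bound of \<open>wall_disjoint\<close> for all points that are at most as far from \<open>\<i>\<close> as the given one.\<close>
  define \<delta> where "\<delta> = 2 * c / H"
  have c: "c > 0" using sqrt2_bounds by (simp add: c_def)
  have H: "H > 0" using Form_pos[OF assms] by (simp add: H_def)
  have \<delta>: "\<delta> > 0" using c H by (simp add: \<delta>_def)
  have "\<exists>g\<in>V_P. octagon (M ** g)"
    if "unimodular M" "Form_A M + Form_D M \<le> H" "Form_A M + Form_D M < real k * (4 * c * \<delta>)" for k M
    using that
  proof (induction k arbitrary: M)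
    case 0
    thus ?case using Form_pos[OF 0(1)] by simp
  next
    case (Suc k)
    show ?case
    proof (cases "octagon M")
      case True
      thus ?thesis using V_P.one by (metis matrix_mul_rid)
    next
      case False
      then obtain d where d: "d \<in> dih" "Wall (M ** d) < 0" by (auto simp: octagon_def not_le)
      define M1 where "M1 = M ** d ** gamma"
      have dg: "d ** gamma \<in> V_P" using d(1) by (intro V_P.mult dih_V_P gamma_V_P)
      have u1: "unimodular M1" using Suc.prems(1) d(1) by (simp add: M1_def unimodular_mult unimodular_dih)
      have h1: "Form_A M1 + Form_D M1 = Form_A M + Form_D M + 4 * c * Wall (M ** d)"
        unfolding M1_def Form_gamma_trace dih_Form_trace[OF d(1)] c_def ..
      have W1: "Wall M1 = - Wall (M ** d)" by (simp add: M1_def)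
      have neg: "4 * c * Wall (M ** d) < 0" using c d(2) by (simp add: mult_less_0_iff)
      have "\<exists>g\<in>V_P. octagon (M1 ** g)"
      proof (cases "- Wall (M ** d) \<le> \<delta>")
        case True
        have "octagon M1" unfolding octagon_def
        proof
          fix e assume e: "e \<in> dih"
          show "Wall (M1 ** e) \<ge> 0"
          proof (cases "e = mat 1 \<or> e = - mat 1")
            case True
            thus ?thesis using W1 d(2) by auto
          next
            case False
            have "Wall M1 + Wall (M1 ** e) \<ge> 2 * c / (Form_A M1 + Form_D M1)"
              using wall_disjoint(2)[OF e _ _ u1] False by (simp add: c_def)
            moreover have "2 * c / (Form_A M1 + Form_D M1) \<ge> \<delta>"
              unfolding \<delta>_def
            proof (rule divide_left_mono)
              have p1: "Form_A M1 + Form_D M1 > 0" using Form_pos[OF u1] by simp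
              show "Form_A M1 + Form_D M1 \<le> H" using h1 neg Suc.prems(2) by linarith
              show "0 \<le> 2 * c" using c by simp
              show "0 < H * (Form_A M1 + Form_D M1)" using H p1 by simp
            qed
            ultimately show ?thesis using W1 True \<open>- Wall (M ** d) \<le> \<delta>\<close> by linarith
          qed
        qed
        thus ?thesis using V_P.one by (metis matrix_mul_rid)
      next
        case False
        hence "4 * c * (- Wall (M ** d)) > 4 * c * \<delta>" using c by (intro mult_strict_left_mono) auto
        moreover have "real (Suc k) * (4 * c * \<delta>) = real k * (4 * c * \<delta>) + 4 * c * \<delta>"
          by (simp add: distrib_right)
        moreover have "4 * c * (- Wall (M ** d)) = - (4 * c * Wall (M ** d))" by simp
        ultimately have "Form_A M1 + Form_D M1 < real k * (4 * c * \<delta>)"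
          using h1 Suc.prems(3) by linarith
        moreover have "Form_A M1 + Form_D M1 \<le> H" using h1 neg Suc.prems(2) by linarith
        ultimately show ?thesis using Suc.IH[OF u1] by blast
      qed
      then obtain g where "g \<in> V_P" "octagon (M1 ** g)" by blast
      hence "octagon (M ** (d ** gamma ** g))" by (simp add: M1_def matrix_mul_assoc)
      thus ?thesis using V_P.mult[OF dg \<open>g \<in> V_P\<close>] by blast
    qed
  qed
  moreover obtain k where "H < real k * (4 * c * \<delta>)"
    using reals_Archimedean3[of "4 * c * \<delta>"] c \<delta> by auto
  ultimately show ?thesis using assms that by (auto simp: H_def)
qed

lemma triangle_in_octagon:
  assumes "octagon N" obtains d where "d \<in> dih" "tri (N ** d)"
proof -
  obtain d where d: "d \<in> dih" "wall_alpha (N ** d) \<ge> 0" "wall_beta (N ** d) \<ge> 0"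
    using fold_sector by blast
  thus ?thesis using that assms by (auto simp: tri_def octagon_def)
qed

lemma triangle_reached:
  assumes "unimodular N" obtains g where "g \<in> V_P" "tri (N ** g)"
proof -
  obtain g where g: "g \<in> V_P" "octagon (N ** g)" using octagon_reached[OF assms] .
  obtain d where d: "d \<in> dih" "tri (N ** g ** d)" using triangle_in_octagon[OF g(2)] .
  show ?thesis using that[of "g ** d"] V_P.mult[OF g(1) dih_V_P[OF d(1)]] d(2) by (simp add: matrix_mul_assoc)
qed

section \<open>Boundary arcs\<close>

lemma bpt_surj: obtains r where "r \<noteq> 0" "x = bpt r"
proof (cases x)
  case None
  show ?thesis
    by (rule that[of "vector [1, 0]"]) (auto simp: None bpt_def vec_eq_iff forall_2)
next
  case (Some u)
  show ?thesis
    by (rule that[of "vector [u, 1]"]) (auto simp: Some bpt_def vec_eq_iff forall_2)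
qed

lemma vector_mult_nonzero:
  assumes "r \<noteq> 0" "unimodular g" shows "r v* g \<noteq> 0"
proof
  assume "r v* g = 0"
  hence "r v* g v* matrix_inv g = 0" by (simp add: vec_eq_iff vector_mult_nth)
  moreover have "r v* g v* matrix_inv g = r v* (g ** matrix_inv g)"
    by (simp add: vec_eq_iff vector_mult_nth matrix_mult_nth algebra_simps)
  ultimately show False using assms unimodular_inv(1)[OF assms(2)] by simp
qed

lemma vector_mult_assoc: "r v* g v* h = r v* (g ** h)" for r :: "real^2" and g h :: "real^2^2"
  by (simp add: vec_eq_iff vector_mult_nth matrix_mult_nth algebra_simps)

lemma bdry_act_mult:
  assumes "unimodular g" "unimodular h" shows "bdry_act (bdry_act x g) h = bdry_act x (g ** h)"
proof -
  obtain r where "r \<noteq> 0" "x = bpt r" by (rule bpt_surj)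
  thus ?thesis using assms
    by (simp add: bdry_act_bpt vector_mult_nonzero unimodular_mult vector_mult_assoc)
qed

lemma bdry_act_one [simp]: "bdry_act x (mat 1) = x"
proof -
  obtain r where "r \<noteq> 0" "x = bpt r" by (rule bpt_surj)
  thus ?thesis by (simp add: bdry_act_bpt)
qed

lemma E_ends_0: "E_ends 0 = {Some 0, Some (1 - sqrt 2)}"
  by (simp add: E_ends_def nu_0)

lemma bpt_E_ends_0: assumes "r \<noteq> 0" shows "bpt r \<in> E_ends 0 \<longleftrightarrow> wall r = 0"
proof (cases "r$2 = 0")
  case True
  hence "r$1 \<noteq> 0" using assms by (auto simp: vec_eq_iff forall_2)
  hence "wall r \<noteq> 0" using True sqrt2_bounds by (simp add: form_def)
  thus ?thesis using True by (simp add: E_ends_0 bpt_def)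
next
  case False
  have "wall r = r$1 * ((1 + sqrt 2) * r$1 + r$2)" by (simp add: form_def power2_eq_square algebra_simps)
  moreover have "(1 + sqrt 2) * r$1 + r$2 = (1 + sqrt 2) * (r$1 - (1 - sqrt 2) * r$2)"
    by (simp add: algebra_simps)
  moreover have "1 + sqrt 2 \<noteq> 0" using sqrt2_bounds by simp
  ultimately show ?thesis using False by (auto simp: E_ends_0 bpt_def divide_eq_eq)
qed

lemma bpt_E_ends:
  assumes "r \<noteq> 0" "i \<le> 7" shows "bpt r \<in> E_ends i \<longleftrightarrow> wall (r v* matrix_inv (nu i)) = 0"
proof -
  have u: "unimodular (nu i)" using nu_dih[OF assms(2)] by (rule unimodular_dih)
  have r': "r v* matrix_inv (nu i) \<noteq> 0" using vector_mult_nonzero assms(1) unimodular_inv(3)[OF u] by blast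
  have "bpt r \<in> E_ends i \<longleftrightarrow> (\<exists>x\<in>E_ends 0. bpt r = bdry_act x (nu i))"
    unfolding E_ends_0 by (auto simp: E_ends_def)
  also have "\<dots> \<longleftrightarrow> bdry_act (bpt r) (matrix_inv (nu i)) \<in> E_ends 0"
    using u unimodular_inv[OF u] by (metis bdry_act_mult bdry_act_one)
  also have "\<dots> \<longleftrightarrow> wall (r v* matrix_inv (nu i)) = 0"
    using bdry_act_bpt[OF assms(1) unimodular_inv(3)[OF u]] bpt_E_ends_0[OF r'] by simp
  finally show ?thesis .
qed

text \<open>
  The vertices are the boundary points that lie on some side of the octagon.
\<close>
lemma bpt_oct_vertices:
  assumes "r \<noteq> 0" shows "bpt r \<in> oct_vertices \<longleftrightarrow> (\<exists>d\<in>dih. wall (r v* d) = 0)"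
proof -
  have "bpt r \<in> oct_vertices \<longleftrightarrow> (\<exists>i\<le>7. wall (r v* matrix_inv (nu i)) = 0)"
    using bpt_E_ends[OF assms] by (auto simp: oct_vertices_def)
  also have "\<dots> \<longleftrightarrow> (\<exists>d\<in>dih. wall (r v* d) = 0)"
  proof
    show "\<exists>i\<le>7. wall (r v* matrix_inv (nu i)) = 0 \<Longrightarrow> \<exists>d\<in>dih. wall (r v* d) = 0"
      using nu_dih dih_inv by blast
  next
    assume "\<exists>d\<in>dih. wall (r v* d) = 0"
    then obtain d where d: "d \<in> dih" "wall (r v* d) = 0" by blast
    then obtain i where i: "i \<le> 7" "matrix_inv d = nu i \<or> matrix_inv d = - nu i"
      using dih_nu_ex dih_inv by blast
    have "nu i ** d = mat 1 \<or> nu i ** d = - mat 1"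
      using i(2) unimodular_inv(2)[OF unimodular_dih[OF d(1)]] by (metis matrix_minus_mult(1) minus_minus)
    hence "matrix_inv (nu i) = d \<or> matrix_inv (nu i) = - d"
      using inv_unique[OF unimodular_dih[OF nu_dih[OF i(1)]]] by (metis matrix_minus_mult(2) minus_minus)
    thus "\<exists>i\<le>7. wall (r v* matrix_inv (nu i)) = 0" using d(2) i(1) by auto
  qed
  finally show ?thesis .
qed

lemma bdry_act_SomeI:
  assumes "n$1$2 * u + n$2$2 \<noteq> 0" "n$1$1 * u + n$2$1 = w * (n$1$2 * u + n$2$2)"
  shows "bdry_act (Some u) n = Some w"
  using assms by (simp add: bdry_act_def transpose_def)

lemma bdry_act_NoneI: "n$1$2 * u + n$2$2 = 0 \<Longrightarrow> bdry_act (Some u) n = None"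
  by (simp add: bdry_act_def transpose_def)

lemma E_ends_eq:
  "E_ends 1 = {Some (-1), Some (1 - sqrt 2)}"
  "E_ends 2 = {Some (-(1 + sqrt 2)), Some (-1)}"
  "E_ends 3 = {None, Some (-(1 + sqrt 2))}"
  "E_ends 4 = {Some (1 + sqrt 2), None}"
  "E_ends 5 = {Some 1, Some (1 + sqrt 2)}"
  "E_ends 6 = {Some (sqrt 2 - 1), Some 1}"
  "E_ends 7 = {Some 0, Some (sqrt 2 - 1)}"
proof -
  have s: "sqrt 2 \<noteq> 1" "sqrt 2 \<noteq> 2" using sqrt2_bounds by auto
  have "bdry_act (Some 0) (nu 1) = Some (-1)" "bdry_act (Some (1 - sqrt 2)) (nu 1) = Some (1 - sqrt 2)"
    "bdry_act (Some 0) (nu 2) = Some (-1)" "bdry_act (Some (1 - sqrt 2)) (nu 2) = Some (-(1 + sqrt 2))"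
    "bdry_act (Some 0) (nu 3) = None" "bdry_act (Some (1 - sqrt 2)) (nu 3) = Some (-(1 + sqrt 2))"
    "bdry_act (Some 0) (nu 4) = None" "bdry_act (Some (1 - sqrt 2)) (nu 4) = Some (1 + sqrt 2)"
    "bdry_act (Some 0) (nu 5) = Some 1" "bdry_act (Some (1 - sqrt 2)) (nu 5) = Some (1 + sqrt 2)"
    "bdry_act (Some 0) (nu 6) = Some 1" "bdry_act (Some (1 - sqrt 2)) (nu 6) = Some (sqrt 2 - 1)"
    "bdry_act (Some 0) (nu 7) = Some 0" "bdry_act (Some (1 - sqrt 2)) (nu 7) = Some (sqrt 2 - 1)"
    by (rule bdry_act_SomeI bdry_act_NoneI; use s in \<open>simp add: field_simps del: One_nat_def\<close>)+
  thus "E_ends 1 = {Some (-1), Some (1 - sqrt 2)}" "E_ends 2 = {Some (-(1 + sqrt 2)), Some (-1)}"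
    "E_ends 3 = {None, Some (-(1 + sqrt 2))}" "E_ends 4 = {Some (1 + sqrt 2), None}"
    "E_ends 5 = {Some 1, Some (1 + sqrt 2)}" "E_ends 6 = {Some (sqrt 2 - 1), Some 1}"
    "E_ends 7 = {Some 0, Some (sqrt 2 - 1)}"
    unfolding E_ends_def by auto
qed

lemma oct_vertices_eq: "oct_vertices = {Some 0, Some (1 - sqrt 2), Some (-1), Some (-(1 + sqrt 2)), None,
    Some (1 + sqrt 2), Some 1, Some (sqrt 2 - 1)}"
proof -
  have "{0..7::nat} = {0, 1, 2, 3, 4, 5, 6, 7}" by auto
  thus ?thesis unfolding oct_vertices_def by (simp add: E_ends_eq E_ends_0 del: One_nat_def) blast
qed

text \<open>
  The two end points bound two arcs; a further vertex \<open>v\<close> on one of them singles out the other one.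
\<close>
lemma E_arc_eqI:
  assumes "E_ends i = {x, y}" "bdry_arc x y \<inter> oct_vertices = {x, y}"
    and "v \<in> bdry_arc y x" "v \<in> oct_vertices" "v \<noteq> x" "v \<noteq> y"
  shows "E_arc i = bdry_arc x y"
  unfolding E_arc_def
proof (rule the_equality)
  show "(\<exists>x' y'. E_ends i = {x', y'} \<and> bdry_arc x y = bdry_arc x' y') \<and> bdry_arc x y \<inter> oct_vertices = E_ends i"
    using assms by blast
next
  fix A assume A: "(\<exists>x' y'. E_ends i = {x', y'} \<and> A = bdry_arc x' y') \<and> A \<inter> oct_vertices = E_ends i"
  then obtain x' y' where xy: "{x, y} = {x', y'}" "A = bdry_arc x' y'" using assms(1) by auto
  hence "A = bdry_arc x y \<or> A = bdry_arc y x" by (auto simp: doubleton_eq_iff)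
  moreover have "A \<noteq> bdry_arc y x"
  proof
    assume "A = bdry_arc y x"
    hence "v \<in> A \<inter> oct_vertices" using assms(3,4) by simp
    hence "v \<in> {x, y}" using A assms(1) by simp
    thus False using assms(5,6) by simp
  qed
  ultimately show "A = bdry_arc x y" by blast
qed

lemma E_arc_eq:
  "E_arc 0 = Some ` {1 - sqrt 2..0}"
  "E_arc 1 = Some ` {-1..1 - sqrt 2}"
  "E_arc 2 = Some ` {-(1 + sqrt 2)..-1}"
  "E_arc 3 = insert None (Some ` {..-(1 + sqrt 2)})"
  "E_arc 4 = insert None (Some ` {1 + sqrt 2..})"
  "E_arc 5 = Some ` {1..1 + sqrt 2}"
  "E_arc 6 = Some ` {sqrt 2 - 1..1}"
  "E_arc 7 = Some ` {0..sqrt 2 - 1}"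
proof -
  note b = sqrt2_bounds
  have "E_arc 0 = bdry_arc (Some (1 - sqrt 2)) (Some 0)"
    by (rule E_arc_eqI[where v = None]) (use b in \<open>auto simp: E_ends_0 oct_vertices_eq\<close>)
  thus "E_arc 0 = Some ` {1 - sqrt 2..0}" using b by simp
  have "E_arc 1 = bdry_arc (Some (-1)) (Some (1 - sqrt 2))"
    by (rule E_arc_eqI[where v = None]) (use b in \<open>auto simp: E_ends_eq oct_vertices_eq simp del: One_nat_def\<close>)
  thus "E_arc 1 = Some ` {-1..1 - sqrt 2}" using b by simp
  have "E_arc 2 = bdry_arc (Some (-(1 + sqrt 2))) (Some (-1))"
    by (rule E_arc_eqI[where v = None]) (use b in \<open>auto simp: E_ends_eq oct_vertices_eq\<close>)
  thus "E_arc 2 = Some ` {-(1 + sqrt 2)..-1}" using b by simp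
  have "E_arc 3 = bdry_arc None (Some (-(1 + sqrt 2)))"
    by (rule E_arc_eqI[where v = "Some 0"]) (use b in \<open>auto simp: E_ends_eq oct_vertices_eq\<close>)
  thus "E_arc 3 = insert None (Some ` {..-(1 + sqrt 2)})" by simp
  have "E_arc 4 = bdry_arc (Some (1 + sqrt 2)) None"
    by (rule E_arc_eqI[where v = "Some 0"]) (use b in \<open>auto simp: E_ends_eq oct_vertices_eq\<close>)
  thus "E_arc 4 = insert None (Some ` {1 + sqrt 2..})" by simp
  have "E_arc 5 = bdry_arc (Some 1) (Some (1 + sqrt 2))"
    by (rule E_arc_eqI[where v = None]) (use b in \<open>auto simp: E_ends_eq oct_vertices_eq\<close>)
  thus "E_arc 5 = Some ` {1..1 + sqrt 2}" using b by simp
  have "E_arc 6 = bdry_arc (Some (sqrt 2 - 1)) (Some 1)"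
    by (rule E_arc_eqI[where v = None]) (use b in \<open>auto simp: E_ends_eq oct_vertices_eq\<close>)
  thus "E_arc 6 = Some ` {sqrt 2 - 1..1}" using b by simp
  have "E_arc 7 = bdry_arc (Some 0) (Some (sqrt 2 - 1))"
    by (rule E_arc_eqI[where v = None]) (use b in \<open>auto simp: E_ends_eq oct_vertices_eq\<close>)
  thus "E_arc 7 = Some ` {0..sqrt 2 - 1}" using b by simp
qed

lemma E_arc_union: "(\<Union>i\<in>{1..7}. E_arc i) = insert None (Some ` {u. u \<le> 1 - sqrt 2 \<or> u \<ge> 0})"
proof -
  have "{1..7::nat} = {1, 2, 3, 4, 5, 6, 7}" by auto
  thus ?thesis using sqrt2_bounds by (auto simp: E_arc_eq image_iff simp del: One_nat_def)
qed

lemma wall_factor: "wall r = (1 + sqrt 2) * (r$1 * (r$1 - (1 - sqrt 2) * r$2))"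
  by (simp add: form_def power2_eq_square algebra_simps)

lemma bpt_arcs:
  assumes "r \<noteq> 0"
  shows "bpt r \<in> E_arc 0 \<longleftrightarrow> wall r \<le> 0" "bpt r \<in> (\<Union>i\<in>{1..7}. E_arc i) \<longleftrightarrow> wall r \<ge> 0"
proof -
  have c: "1 + sqrt 2 > 0" "1 - sqrt 2 < 0" using sqrt2_bounds by auto
  have "(bpt r \<in> E_arc 0 \<longleftrightarrow> wall r \<le> 0) \<and> (bpt r \<in> (\<Union>i\<in>{1..7}. E_arc i) \<longleftrightarrow> wall r \<ge> 0)"
  proof (cases "r$2 = 0")
    case True
    hence "r$1 \<noteq> 0" using assms by (auto simp: vec_eq_iff forall_2)
    hence "(r$1)\<^sup>2 > 0" by simp
    hence "(1 + sqrt 2) * (r$1)\<^sup>2 > 0" by (rule mult_pos_pos[OF c(1)])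
    hence "wall r > 0" using True by (simp add: form_def)
    thus ?thesis
      using True unfolding E_arc_union by (auto simp: E_arc_eq bpt_def)
  next
    case False
    have sg: "K * x \<le> 0 \<longleftrightarrow> x \<le> 0" "0 \<le> K * x \<longleftrightarrow> 0 \<le> x" if "0 < K" for K x :: real
      using that by (auto simp: mult_le_0_iff zero_le_mult_iff)
    define u where "u = r$1 / r$2"
    have b: "bpt r = Some u" using False by (simp add: bpt_def u_def)
    have "wall r = ((1 + sqrt 2) * (r$2)\<^sup>2) * (u * (u - (1 - sqrt 2)))"
      unfolding wall_factor u_def using False by (simp add: field_simps power2_eq_square)
    moreover have "(r$2)\<^sup>2 > 0" using False by simp
    hence "(1 + sqrt 2) * (r$2)\<^sup>2 > 0" by (rule mult_pos_pos[OF c(1)])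
    ultimately have w: "wall r \<le> 0 \<longleftrightarrow> u * (u - (1 - sqrt 2)) \<le> 0" "wall r \<ge> 0 \<longleftrightarrow> u * (u - (1 - sqrt 2)) \<ge> 0"
      by (simp_all only: sg)
    have "bpt r \<in> E_arc 0 \<longleftrightarrow> wall r \<le> 0"
      unfolding w b using sqrt2_bounds by (auto simp: E_arc_eq mult_le_0_iff)
    moreover have "bpt r \<in> (\<Union>i\<in>{1..7}. E_arc i) \<longleftrightarrow> wall r \<ge> 0"
      unfolding w b E_arc_union using sqrt2_bounds by (auto simp: zero_le_mult_iff)
    ultimately show ?thesis ..
  qed
  thus "bpt r \<in> E_arc 0 \<longleftrightarrow> wall r \<le> 0" "bpt r \<in> (\<Union>i\<in>{1..7}. E_arc i) \<longleftrightarrow> wall r \<ge> 0"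
    by blast+
qed

section \<open>The lifted section\<close>

lemma row_nonzero: "unimodular N \<Longrightarrow> N$i \<noteq> 0"
  using unimodular_row_nonzero[of N i] by auto

lemma pt_E_0: assumes N: "unimodular N" shows "pt N \<in> E_0 \<longleftrightarrow> Wall N = 0"
proof
  assume "pt N \<in> E_0"
  then obtain c t where c: "geodesic c" "tends_to_bdry c at_bot (Some 0)"
      "tends_to_bdry c at_top (Some (1 - sqrt 2))" "pt N = c t"
    by (auto simp: E_0_def geodesic_line_def)
  obtain M where M: "unimodular M" "c = geo M" using geodesic_is_geo[OF c(1)] .
  have "bpt (M$2) = Some 0" "bpt (M$1) = Some (1 - sqrt 2)"
    using tends_to_bdry_unique geo_tendsto_at_bot[OF M(1)] geo_tendsto_at_top[OF M(1)] c(2,3) M(2)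
      trivial_limit_at_bot_linorder trivial_limit_at_top_linorder by blast+
  hence "wall (M$1) = 0" "wall (M$2) = 0"
    using bpt_E_ends_0[OF row_nonzero[OF M(1)]] by (simp_all flip: bpt_E_ends_0[OF row_nonzero[OF M(1)]] add: E_ends_0)
  hence "Wall (flow_mat t ** M) = 0" by (simp add: Form_flow)
  moreover have "pt N = pt (flow_mat t ** M)" using c(4) M(2) by (simp add: geo_def)
  hence "Form_A N = Form_A (flow_mat t ** M)" "Form_B N = Form_B (flow_mat t ** M)"
    using coord_pt[OF N] coord_pt[OF unimodular_mult[OF unimodular_flow M(1)]] by metis+
  ultimately show "Wall N = 0" by (metis Form_expand mult_zero_left)
next
  assume W: "Wall N = 0"
  define a where "a = sqrt (Form_A N)"
  have a: "a > 0" "a\<^sup>2 = Form_A N" using Form_pos[OF N] by (simp_all add: a_def)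
  have s: "sqrt 2 - 1 \<noteq> 0" using sqrt2_bounds by simp
  \<comment> \<open>The geodesic \<open>E\<^sub>0\<close> from \<open>0\<close> to \<open>1 - \<surd>2\<close>, started at the point with coordinate \<open>A = a\<^sup>2\<close>.\<close>
  define M where "M = mat22 (- a) ((1 + sqrt 2) * a) 0 (1 / a)"
  have M: "unimodular M" using a by (simp add: unimodular_square M_def)
  have "Form_A M = Form_A N" "Form_B M = - (1 + sqrt 2) * Form_A N"
    unfolding a(2)[symmetric] by (simp_all add: Form_def form_def M_def power2_eq_square algebra_simps)
  moreover have "Form_B N = - (1 + sqrt 2) * Form_A N"
    using W by (subst (asm) Form_expand) (simp add: algebra_simps)
  ultimately have "pt N = geo M 0" using pt_eqI[OF M N] by simp
  moreover have "bpt (M$1) = Some (1 - sqrt 2)" "bpt (M$2) = Some 0"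
  proof -
    have "1 + sqrt 2 > 0" using sqrt2_bounds by simp
    hence nz: "(1 + sqrt 2) * a \<noteq> 0" using a(1) by (metis mult_pos_pos less_irrefl)
    have "- a = (1 - sqrt 2) * ((1 + sqrt 2) * a)" by (simp add: algebra_simps)
    hence "- a / ((1 + sqrt 2) * a) = 1 - sqrt 2" using nz by (metis nonzero_mult_div_cancel_right)
    with nz show "bpt (M$1) = Some (1 - sqrt 2)" "bpt (M$2) = Some 0" using a(1) by (auto simp: bpt_def M_def)
  qed
  ultimately show "pt N \<in> E_0"
    using geodesic_geo[OF M] geo_tendsto_at_top[OF M] geo_tendsto_at_bot[OF M]
    unfolding E_0_def geodesic_line_def by (metis (mono_tags, lifting) mem_Collect_eq rangeI)
qed

text \<open>
  On \<open>E\<^sub>0\<close> the values of the form at both ends add up to zero, so the condition on the backward end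
  follows from the one on the forward end.
\<close>
lemma frame_lifted_section:
  assumes N: "unimodular N"
  shows "frame N \<in> lifted_section \<longleftrightarrow> Wall N = 0 \<and> wall (N$1) \<ge> 0"
  unfolding lifted_section_def mem_Collect_eq fst_frame fwd_end_frame[OF N] bwd_end_frame[OF N]
    bpt_arcs[OF row_nonzero[OF N]] pt_E_0[OF N]
  using frame_T1[OF N] by (auto simp: Form_def)

lemma stab_on_Wall:
  assumes "unimodular N" "Wall N = 0" "g \<in> stab N"
  shows "g = mat 1 \<or> g = - mat 1 \<or> g = gamma \<or> g = - gamma"
  using tri_on_Wall[OF assms(1,2)] assms(3) by (auto simp: stab_def)

lemma frame_gamma_tangent:
  assumes N: "unimodular N" and w: "wall (N$1) = 0" "wall (N$2) = 0"
  shows "frame (N ** gamma) = frame N"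
proof -
  have "form_B (r v* gamma) = form_B r - 2 * wall r" "form_D (r v* gamma) = form_D r + 4 * (1 + sqrt 2) * wall r + (0::real)" for r
    by (simp_all add: form_def vector_mult_nth power2_eq_square algebra_simps)
  moreover have "unimodular (N ** gamma)" using N by (simp add: unimodular_mult)
  ultimately show ?thesis
    using w frame_eq_iff[OF _ N] by (simp add: forall_2 row_mult)
qed

text \<open>
  By strictness two lifts of the same vector differ by \<open>\<plusminus>1\<close> or \<open>\<plusminus>\<gamma>\<close>. The reflection \<open>\<gamma>\<close> exchanges the
  two sides of \<open>E\<^sub>0\<close>, so it preserves the section only for vectors tangent to \<open>E\<^sub>0\<close>, and these it fixes.
\<close>
lemma lifted_section_unique:
  assumes "p \<in> lifted_section" "q \<in> lifted_section" "proj p = proj q" shows "p = q"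
proof -
  obtain M N where M: "unimodular M" "p = frame M" and N: "unimodular N" "q = frame N"
    using assms(1,2) T1_frame unfolding lifted_section_def by (metis (lifting) mem_Collect_eq)
  obtain g where g: "g \<in> V_P" "frame M = frame (N ** g)"
    using assms(3) M N proj_frame_eq_iff by blast
  have u: "unimodular (N ** g)" using N(1) g(1) by (simp add: unimodular_mult V_P_unimodular)
  have W: "Wall N = 0" "wall (N$1) \<ge> 0" "Wall (N ** g) = 0" "wall ((N ** g)$1) \<ge> 0"
    using assms(1,2) g(2) M N u by (auto simp: frame_lifted_section)
  have "g \<in> stab N"
    using strict_fundamental_domain[OF N(1) g(1)] tri_on_Wall(3)[OF N(1)] tri_on_Wall(3)[OF u] W by blast
  hence "g = mat 1 \<or> g = - mat 1 \<or> g = gamma \<or> g = - gamma"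
    using stab_on_Wall N(1) W(1) by blast
  moreover have "frame (N ** gamma) = frame N" if "g = gamma \<or> g = - gamma"
  proof -
    have "wall (N$1) = 0" using W(2,4) that by (auto simp: row_mult)
    moreover from this have "wall (N$2) = 0" using W(1) by (simp add: Form_def)
    ultimately show ?thesis using frame_gamma_tangent N(1) by blast
  qed
  ultimately have "frame (N ** g) = frame N" by auto
  thus ?thesis using g M N by simp
qed

lemma lift_proj: "p \<in> lifted_section \<Longrightarrow> lift (proj p) = p"
  unfolding lift_def by (intro the_equality) (auto intro: lifted_section_unique)

lemma lifted_section_frame:
  assumes "p \<in> lifted_section"
  obtains N where "unimodular N" "p = frame N" "Wall N = 0" "wall (N$1) \<ge> 0" "wall (N$2) \<le> 0"
proof -
  obtain N where N: "unimodular N" "p = frame N"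
    using T1_frame assms unfolding lifted_section_def by blast
  moreover have "Wall N = 0" "wall (N$1) \<ge> 0" using assms N frame_lifted_section by auto
  ultimately show ?thesis using that by (simp add: Form_def)
qed

lemma proj_frame_cross_section:
  assumes N: "unimodular N"
  shows "proj (frame N) \<in> cross_section \<longleftrightarrow> (\<exists>g\<in>V_P. Wall (N ** g) = 0)"
proof
  assume "proj (frame N) \<in> cross_section"
  then obtain p where "p \<in> lifted_section" "proj (frame N) = proj p" by (auto simp: cross_section_def)
  then obtain M where M: "unimodular M" "proj (frame M) = proj (frame N)" "Wall M = 0"
    by (metis lifted_section_frame)
  then obtain g where g: "g \<in> V_P" "frame M = frame (N ** g)" using proj_frame_eq_iff N by blast
  have u: "unimodular (N ** g)" using N g(1) by (simp add: unimodular_mult V_P_unimodular)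
  have "Wall (N ** g) = 0" using M(3) g(2) by (metis M(1) fst_frame pt_E_0 u)
  thus "\<exists>g\<in>V_P. Wall (N ** g) = 0" using g(1) by blast
next
  assume "\<exists>g\<in>V_P. Wall (N ** g) = 0"
  then obtain g where g: "g \<in> V_P" "Wall (N ** g) = 0" by blast
  have "\<exists>h\<in>V_P. Wall (N ** h) = 0 \<and> wall ((N ** h)$1) \<ge> 0"
  proof (cases "wall ((N ** g)$1) \<ge> 0")
    case True thus ?thesis using g by blast
  next
    case False
    have "N ** (g ** gamma) = N ** g ** gamma" by (simp add: matrix_mul_assoc)
    hence "Wall (N ** (g ** gamma)) = 0 \<and> wall ((N ** (g ** gamma))$1) \<ge> 0"
      using g(2) False by (simp add: row_mult[of "N ** g"])
    thus ?thesis using V_P.mult[OF g(1) gamma_V_P] by blast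
  qed
  then obtain h where h: "h \<in> V_P" "Wall (N ** h) = 0" "wall ((N ** h)$1) \<ge> 0" by blast
  have "frame (N ** h) \<in> lifted_section"
    using h N by (subst frame_lifted_section) (auto simp: unimodular_mult V_P_unimodular)
  thus "proj (frame N) \<in> cross_section"
    unfolding cross_section_def using proj_frame_mult[OF N h(1)] by blast
qed

text \<open>
  A point of the orbit of \<open>E\<^sub>0\<close> in the octagon lies on a side of it: folded into the triangle it is a
  point of \<open>E\<^sub>0\<close>, by strictness.
\<close>
lemma inner_octagon_not_cross_section:
  assumes N: "unimodular N" and oct: "\<And>d. d \<in> dih \<Longrightarrow> Wall (N ** d) > 0"
  shows "proj (frame N) \<notin> cross_section"
proof
  assume "proj (frame N) \<in> cross_section"
  then obtain g where g: "g \<in> V_P" "Wall (N ** g) = 0" using proj_frame_cross_section[OF N] by blast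
  have "octagon N" using oct by (force simp: octagon_def)
  then obtain d where d: "d \<in> dih" "tri (N ** d)" by (rule triangle_in_octagon)
  have ud: "unimodular (N ** d)" and ug: "unimodular (N ** g)"
    using N d(1) g(1) by (auto simp: unimodular_mult V_P_unimodular unimodular_dih)
  have eq: "N ** d ** (matrix_inv d ** g) = N ** g"
    by (simp add: matrix_mul_assoc matrix_inv_cancel unimodular_dih[OF d(1)])
  have V: "matrix_inv d ** g \<in> V_P" by (rule V_P.mult[OF V_P.inv[OF dih_V_P[OF d(1)]] g(1)])
  have "matrix_inv d ** g \<in> stab (N ** d)"
    using strict_fundamental_domain[OF ud V d(2)] tri_on_Wall(3)[OF ug g(2)] eq by simp
  hence "pt (N ** g) = pt (N ** d)" using stab_pt[OF ud] eq by metis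
  hence "Wall (N ** d) = 0" using pt_E_0[OF ug] pt_E_0[OF ud] g(2) by simp
  thus False using oct[OF d(1)] by simp
qed

section \<open>First return\<close>

text \<open>
  A boundary point strictly under one side of the octagon is strictly on the inner side of all others.
\<close>
lemma wall_ratio:
  assumes "d \<in> dih" "e \<in> dih" "wall (r v* d) < 0" "e \<noteq> d" "e \<noteq> - d"
  shows "wall (r v* e) > 0"
proof -
  define f where "f = matrix_inv d ** e"
  have e: "e = d ** f" by (simp add: f_def matrix_mul_assoc unimodular_inv unimodular_dih[OF assms(1)])
  have "f \<in> dih" using assms by (simp add: f_def dih_mult dih_inv)
  moreover have "f \<noteq> mat 1" "f \<noteq> - mat 1" using assms(4,5) e by auto
  ultimately have "wall (r v* d) + wall (r v* d v* f) \<ge> 0" by (rule wall_disjoint(1))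
  thus ?thesis using assms(3) by (simp add: vector_mult_assoc flip: e)
qed

lemma first_return_time_unique:
  "first_return_time \<phi> S x s \<Longrightarrow> first_return_time \<phi> S x t \<Longrightarrow> s = t"
  unfolding first_return_time_def by (metis linorder_neqE_linordered_idom)

lemma first_return_eq: "first_return_time \<phi> S x t \<Longrightarrow> first_return \<phi> S x = \<phi> t x"
  unfolding first_return_def using first_return_time_unique by (metis the_equality)

lemma Wall_flow_mult: "Wall (flow_mat t ** N ** d) = exp t * wall (N$1 v* d) + exp (-t) * wall (N$2 v* d)"
  for N d :: "real^2^2"
  unfolding matrix_mul_assoc[symmetric] Form_flow by (simp add: row_mult)

text \<open>
  The hypothesis on \<open>e\<close> says that the geodesic ends strictly beyond the side \<open>E\<^sub>0 e\<^sup>-\<^sup>1\<close>. Along the geodesic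
  the form of this side changes sign exactly once, at time \<open>t = ln (b / a) / 2\<close>. The form of \<open>E\<^sub>0\<close> is zero at
  time \<open>0\<close> and positive afterwards, and all other sides have both ends on their inner side.
\<close>
lemma section_returns:
  assumes N: "unimodular N" and W: "Wall N = 0" "wall (N$1) > 0"
    and e: "e \<in> dih" "wall (N$1 v* e) < 0"
  obtains t where "first_return_time quot_flow cross_section (proj (frame N)) t"
    "quot_flow t (proj (frame N)) = proj (frame (flow_mat t ** N ** (e ** gamma)))"
    "frame (flow_mat t ** N ** (e ** gamma)) \<in> lifted_section"
proof -
  define a b where "a = - wall (N$1 v* e)" and "b = wall (N$2 v* e)"
  have W2: "wall (N$2) = - wall (N$1)" using W by (simp add: Form_def)
  hence w2: "wall (N$2) < 0" using W by simp
  have e1: "e \<noteq> mat 1" "e \<noteq> - mat 1" using e(2) W(2) by auto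
  have "Wall (N ** e) > 0" using Wall_disjoint_strict[OF e(1) e1 N] W(1) by simp
  hence ab: "b > a" "a > 0" using e(2) by (auto simp: a_def b_def Form_def row_mult)
  define t where "t = ln (b / a) / 2"
  have t: "t > 0" using ab by (simp add: t_def)
  have et: "exp (2 * t) = b / a" using ab by (simp add: t_def)
  have We: "Wall (flow_mat s ** N ** e) = exp (-s) * (b - exp (2 * s) * a)" for s
  proof -
    have "exp s = exp (-s) * exp (2 * s)" by (simp flip: exp_add)
    thus ?thesis unfolding Wall_flow_mult a_def b_def by (simp add: algebra_simps)
  qed
  have u: "unimodular (flow_mat s ** N)" for s using N by (simp add: unimodular_mult)
  have g: "e ** gamma \<in> V_P" using e(1) by (intro V_P.mult dih_V_P gamma_V_P)
  have Wt: "Wall (flow_mat t ** N ** (e ** gamma)) = 0"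
    using We[of t] et ab by (simp add: matrix_mul_assoc)
  have "(flow_mat t ** N ** (e ** gamma))$1 = (flow_mat t ** N)$1 v* e v* gamma"
    by (simp add: row_mult vector_mult_assoc flip: matrix_mul_assoc)
  moreover have "(flow_mat t ** N)$1 v* e = (flow_mat t ** (N ** e))$1"
    by (simp add: row_mult vector_mult_assoc)
  ultimately have "wall ((flow_mat t ** N ** (e ** gamma))$1) = - wall ((flow_mat t ** (N ** e))$1)"
    by simp
  also have "\<dots> = exp t * a" by (simp only: form_flow) (simp add: row_mult a_def)
  finally have wt: "wall ((flow_mat t ** N ** (e ** gamma))$1) \<ge> 0" using ab by simp
  have lifted: "frame (flow_mat t ** N ** (e ** gamma)) \<in> lifted_section"
    using Wt wt by (subst frame_lifted_section) (auto intro!: unimodular_mult u V_P_unimodular[OF g])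
  have ret: "quot_flow t (proj (frame N)) = proj (frame (flow_mat t ** N ** (e ** gamma)))"
    using quot_flow_proj[OF N] proj_frame_mult[OF u g] by simp
  have no: "quot_flow s (proj (frame N)) \<notin> cross_section" if s: "0 < s" "s < t" for s
    unfolding quot_flow_proj[OF N]
  proof (rule inner_octagon_not_cross_section[OF u])
    fix d assume d: "d \<in> dih"
    consider "d = mat 1 \<or> d = - mat 1" | "d = e \<or> d = - e" | "d \<noteq> mat 1" "d \<noteq> - mat 1" "d \<noteq> e" "d \<noteq> - e"
      by blast
    thus "Wall (flow_mat s ** N ** d) > 0"
    proof cases
      case 1
      have "Wall (flow_mat s ** N) = (exp s - exp (-s)) * wall (N$1)"
        using W2 by (simp add: Form_flow algebra_simps)
      moreover have "(exp s - exp (-s)) * wall (N$1) > 0" using s(1) W(2) by simp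
      ultimately show ?thesis using 1 by auto
    next
      case 2
      have "exp (2 * s) * a < exp (2 * t) * a" using s ab by simp
      hence "b - exp (2 * s) * a > 0" using et ab by simp
      hence "Wall (flow_mat s ** N ** e) > 0" unfolding We by simp
      thus ?thesis using 2 by auto
    next
      case 3
      have "wall (N$1 v* d) > 0" using wall_ratio[OF e(1) d e(2)] 3 by blast
      moreover have "wall (N$2 v* d) > 0"
        using wall_ratio[of "mat 1" d "N$2"] d w2 3 by simp
      ultimately show ?thesis unfolding Wall_flow_mult by (simp add: add_pos_pos)
    qed
  qed
  have "first_return_time quot_flow cross_section (proj (frame N)) t"
    unfolding first_return_time_def
    using t no lifted ret by (auto simp: cross_section_def)
  with ret lifted that show ?thesis by blast
qed

text \<open>
  If the forward end is strictly inside \<open>E\<^sub>0\<close> and not strictly beyond any other side, the geodesic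
  stays inside the octagon; if it is on \<open>E\<^sub>0\<close>, so is the whole geodesic, and all its vectors belong to the
  section.
\<close>
lemma section_no_return:
  assumes N: "unimodular N" and W: "Wall N = 0" "wall (N$1) \<ge> 0"
    and v: "\<And>d. d \<in> dih \<Longrightarrow> wall (N$1 v* d) \<ge> 0"
  shows "\<not> returns quot_flow cross_section (proj (frame N))"
proof
  assume "returns quot_flow cross_section (proj (frame N))"
  then obtain t where t: "0 < t" "quot_flow t (proj (frame N)) \<in> cross_section"
    "\<And>s. 0 < s \<Longrightarrow> s < t \<Longrightarrow> quot_flow s (proj (frame N)) \<notin> cross_section"
    by (auto simp: returns_def first_return_time_def)
  have u: "unimodular (flow_mat s ** N)" for s using N by (simp add: unimodular_mult)
  show False
  proof (cases "wall (N$1) = 0")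
    case True
    hence "Wall (flow_mat (t/2) ** N) = 0" using W by (simp add: Form_flow) (simp add: Form_def)
    hence "quot_flow (t/2) (proj (frame N)) \<in> cross_section"
      unfolding quot_flow_proj[OF N] proj_frame_cross_section[OF u]
      by (intro bexI[OF _ V_P.one]) simp
    thus False using t(1) t(3)[of "t/2"] by simp
  next
    case False
    have W2: "wall (N$2) = - wall (N$1)" using W by (simp add: Form_def)
    with False have w1: "wall (N$1) > 0" and w2: "wall (N$2) < 0" using W by auto
    have "proj (frame (flow_mat t ** N)) \<notin> cross_section"
    proof (rule inner_octagon_not_cross_section[OF u])
      fix d assume d: "d \<in> dih"
      show "Wall (flow_mat t ** N ** d) > 0"
      proof (cases "d = mat 1 \<or> d = - mat 1")
        case True
        have "Wall (flow_mat t ** N) = (exp t - exp (-t)) * wall (N$1)"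
          using W2 by (simp add: Form_flow algebra_simps)
        moreover have "(exp t - exp (-t)) * wall (N$1) > 0" using t(1) w1 by simp
        ultimately show ?thesis using True by auto
      next
        case False
        have "wall (N$2 v* d) > 0" using wall_ratio[of "mat 1" d "N$2"] d w2 False by simp
        thus ?thesis using v[OF d] unfolding Wall_flow_mult by (simp add: add_nonneg_pos)
      qed
    qed
    thus False using t(2) quot_flow_proj[OF N] by simp
  qed
qed

lemma exit_side:
  assumes r: "r \<noteq> 0" and v: "bpt r \<notin> oct_vertices"
  obtains e where "e \<in> dih" "wall (r v* e) < 0"
proof -
  obtain d where "d \<in> dih" "wall (r v* d) \<le> 0" using wall_covers[OF r] .
  moreover have "wall (r v* d) \<noteq> 0" using v bpt_oct_vertices[OF r] \<open>d \<in> dih\<close> by blast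
  ultimately show ?thesis using that by fastforce
qed

lemma returns_iff:
  assumes "p \<in> lifted_section"
  shows "returns quot_flow cross_section (proj p) \<longleftrightarrow> fwd_end p \<notin> oct_vertices"
proof -
  obtain N where N: "unimodular N" "p = frame N" "Wall N = 0" "wall (N$1) \<ge> 0"
    using lifted_section_frame[OF assms] by blast
  note r = row_nonzero[OF N(1)]
  have f: "fwd_end p = bpt (N$1)" using N by (simp add: fwd_end_frame)
  show ?thesis
  proof
    assume "fwd_end p \<notin> oct_vertices"
    hence v: "bpt (N$1) \<notin> oct_vertices" using f by simp
    hence "wall (N$1 v* mat 1) \<noteq> 0" using bpt_oct_vertices[OF r] generators_dih(1) by blast
    hence "wall (N$1) > 0" using N(4) by simp
    moreover obtain e where "e \<in> dih" "wall (N$1 v* e) < 0" using exit_side[OF r v] .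
    ultimately show "returns quot_flow cross_section (proj p)"
      unfolding returns_def N(2) using section_returns N(1,3) by blast
  next
    assume ret: "returns quot_flow cross_section (proj p)"
    show "fwd_end p \<notin> oct_vertices"
    proof
      assume "fwd_end p \<in> oct_vertices"
      then obtain d where d: "d \<in> dih" "wall (N$1 v* d) = 0" using f bpt_oct_vertices[OF r] by auto
      have "wall (N$1 v* e) \<ge> 0" if "e \<in> dih" for e
        using wall_ratio[OF that d(1), of "N$1"] d(2) by fastforce
      thus False using section_no_return[OF N(1,3,4)] ret N(2) by blast
    qed
  qed
qed

section \<open>Directions and sectors\<close>

text \<open>
  The direction with inverse slope \<open>-1 / x\<close> for the boundary point \<open>x\<close> of the row \<open>r\<close>.
\<close>
definition dpt :: "real^2 \<Rightarrow> real option" where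
  "dpt r = (if r$1 = 0 then None else Some (- r$2 / r$1))"

lemma bdry_direction_bpt: "r \<noteq> 0 \<Longrightarrow> bdry_direction (bpt r) = dpt r"
  by (auto simp: bdry_direction_def bpt_def dpt_def vec_eq_iff forall_2)

lemma dpt_scale: "c \<noteq> 0 \<Longrightarrow> dpt (c *\<^sub>R r) = dpt r"
  by (simp add: dpt_def)

text \<open>
  Under \<open>x \<mapsto> -1 / x\<close> the right action of a matrix becomes the left action of its inverse.
\<close>
lemma mobius_dpt:
  assumes "unimodular g" "r \<noteq> 0"
  shows "mobius g (dpt (r v* g)) = dpt r"
proof -
  define a b c d m n where "a = g$1$1" and "b = g$1$2" and "c = g$2$1" and "d = g$2$2"
    and "m = r$1" and "n = r$2"
  have e: "a * d - b * c \<noteq> 0" using assms(1) by (auto simp: unimodular_iff det_2 a_def b_def c_def d_def)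
  have mn: "m \<noteq> 0 \<or> n \<noteq> 0" using assms(2) by (auto simp: m_def n_def vec_eq_iff forall_2)
  define x y where "x = m * a + n * c" and "y = m * b + n * d"
  have xy: "(r v* g)$1 = x" "(r v* g)$2 = y"
    by (simp_all add: x_def y_def vector_mult_nth a_def b_def c_def d_def m_def n_def)
  have 1: "b * x - a * y = - n * (a * d - b * c)" and 2: "d * x - c * y = m * (a * d - b * c)"
    by (simp_all add: x_def y_def algebra_simps)
  show ?thesis
  proof (cases "x = 0")
    case True
    have "y \<noteq> 0" using True 1 2 e mn by auto
    hence "c = 0 \<longleftrightarrow> m = 0" using True 2 e by auto
    moreover have "a / c = - n / m" if "m \<noteq> 0"
    proof -
      have "c \<noteq> 0" using \<open>c = 0 \<longleftrightarrow> m = 0\<close> that by simp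
      thus ?thesis using that True by (simp add: x_def field_simps add_eq_0_iff)
    qed
    ultimately show ?thesis using True
      by (simp add: dpt_def xy flip: a_def b_def c_def d_def m_def n_def)
  next
    case False
    have "c * (- y / x) + d = m * (a * d - b * c) / x" "a * (- y / x) + b = - n * (a * d - b * c) / x"
      unfolding 1[symmetric] 2[symmetric] using False by (simp_all add: field_simps)
    hence "mobius g (Some (- y / x)) = (if m * (a * d - b * c) / x = 0 then None
        else Some ((- n * (a * d - b * c) / x) / (m * (a * d - b * c) / x)))"
      by (simp flip: a_def b_def c_def d_def)
    also have "\<dots> = dpt r" using False e by (simp add: dpt_def flip: m_def n_def)
    finally show ?thesis using False by (simp add: dpt_def[of "r v* g"] xy)
  qed
qed

lemma sector_range:
  assumes "real i * pi / 8 \<le> \<theta>" "\<theta> < real (i + 1) * pi / 8" "i \<le> 7"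
  shows "0 \<le> \<theta>" "\<theta> < pi"
proof -
  have "real (i + 1) * pi / 8 \<le> 8 * pi / 8" using assms(3) by (intro divide_right_mono mult_right_mono) auto
  also have "\<dots> = pi" by simp
  finally show "\<theta> < pi" using assms(2) by (rule less_le_trans[rotated])
  have "0 \<le> real i * pi / 8" by simp
  thus "0 \<le> \<theta>" using assms(1) by (rule order_trans)
qed

text \<open>
  The angle of a direction \<open>u\<close> is \<open>\<pi> / 2 - arctan u\<close>.
\<close>
lemma sector_Some_arctan:
  assumes "i \<le> 7"
  shows "Some u \<in> sector i \<longleftrightarrow>
    real i * pi / 8 \<le> pi / 2 - arctan u \<and> pi / 2 - arctan u < real (i + 1) * pi / 8"
proof
  assume "Some u \<in> sector i"
  then obtain \<theta> where \<theta>: "real i * pi / 8 \<le> \<theta>" "\<theta> < real (i + 1) * pi / 8" "direction \<theta> = Some u"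
    by (auto simp: sector_def)
  have s: "sin \<theta> \<noteq> 0" "cot \<theta> = u" using \<theta>(3) by (auto simp: direction_def split: if_splits)
  from s have "\<theta> \<noteq> 0" by auto
  hence range: "0 < \<theta>" "\<theta> < pi" using sector_range[OF \<theta>(1,2) assms] by auto
  have "tan (pi / 2 - \<theta>) = u" using s by (simp add: tan_cot cot_altdef)
  hence "arctan u = pi / 2 - \<theta>" using range by (intro arctan_unique) auto
  thus "real i * pi / 8 \<le> pi / 2 - arctan u \<and> pi / 2 - arctan u < real (i + 1) * pi / 8" using \<theta> by simp
next
  assume r: "real i * pi / 8 \<le> pi / 2 - arctan u \<and> pi / 2 - arctan u < real (i + 1) * pi / 8"
  have "0 < pi / 2 - arctan u" "pi / 2 - arctan u < pi" using arctan_bounded[of u] by auto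
  hence "sin (pi / 2 - arctan u) > 0" by (rule sin_gt_zero)
  hence "sin (pi / 2 - arctan u) \<noteq> 0" by (rule less_imp_neq[symmetric])
  moreover have "cot (pi / 2 - arctan u) = u" by (simp add: cot_altdef tan_cot tan_arctan)
  ultimately have "direction (pi / 2 - arctan u) = Some u" by (simp add: direction_def)
  moreover have "pi / 2 - arctan u \<in> {real i * pi / 8 ..< real (i + 1) * pi / 8}" using r by simp
  ultimately show "Some u \<in> sector i" unfolding sector_def by (metis imageI)
qed

lemma sector_None: assumes "i \<le> 7" shows "None \<in> sector i \<longleftrightarrow> i = 0"
proof
  assume "None \<in> sector i"
  then obtain \<theta> where \<theta>: "real i * pi / 8 \<le> \<theta>" "\<theta> < real (i + 1) * pi / 8" "direction \<theta> = None"
    by (auto simp: sector_def)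
  have "sin \<theta> = 0" using \<theta>(3) by (auto simp: direction_def split: if_splits)
  hence "\<theta> = 0" using sector_range[OF \<theta>(1,2) assms] sin_gt_zero[of \<theta>] by force
  thus "i = 0" using \<theta>(1) pi_gt_zero by (simp add: mult_le_0_iff)
next
  assume "i = 0"
  have "direction 0 = None" by (simp add: direction_def)
  moreover have "(0::real) \<in> {real i * pi / 8 ..< real (i + 1) * pi / 8}" using \<open>i = 0\<close> by simp
  ultimately show "None \<in> sector i" unfolding sector_def by (metis imageI)
qed

lemma sector_disjoint:
  assumes "x \<in> sector i" "x \<in> sector j" "i \<le> 7" "j \<le> 7" shows "i = j"
proof (cases x)
  case None
  thus ?thesis using assms sector_None by auto
next
  case (Some u)
  define y where "y = (pi / 2 - arctan u) * 8 / pi"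
  have "real k \<le> y \<and> y < real (k + 1)" if "x \<in> sector k" "k \<le> 7" for k
    using that(1) unfolding Some sector_Some_arctan[OF that(2)] y_def
    by (simp add: field_simps)
  from this[OF assms(1,3)] this[OF assms(2,4)] have "real i < real (j + 1)" "real j < real (i + 1)" by linarith+
  thus ?thesis by linarith
qed

text \<open>
  The duplication formula at \<open>\<pi> / 4\<close> gives \<open>t\<^sup>2 + 2 t = 1\<close>.
\<close>
lemma tan_pi_8: "tan (pi / 8) = sqrt 2 - 1"
proof -
  define t where "t = tan (pi / 8)"
  have t: "t > 0" unfolding t_def by (rule tan_gt_zero) auto
  have c: "cos (pi / 8) \<noteq> 0" "cos (2 * (pi / 8)) \<noteq> 0" by (simp_all add: cos_45 less_imp_neq[symmetric] cos_gt_zero)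
  have "tan (2 * (pi / 8)) = 1" using tan_45 by simp
  hence 1: "2 * t / (1 - t\<^sup>2) = 1" using tan_double[OF c] by (simp add: t_def)
  hence "2 * t = 1 - t\<^sup>2" by (cases "1 - t\<^sup>2 = 0") (auto simp: divide_eq_eq)
  hence "(t + 1)\<^sup>2 = 2" by (simp add: power2_eq_square algebra_simps)
  hence "t + 1 = sqrt 2" using t by (metis add_pos_pos less_eq_real_def real_sqrt_unique zero_less_one)
  thus ?thesis by (simp add: t_def)
qed

lemma arctan_values: "arctan (sqrt 2 - 1) = pi / 8" "arctan (1 + sqrt 2) = 3 * pi / 8"
  "arctan (1 - sqrt 2) = - pi / 8" "arctan (- (1 + sqrt 2)) = - 3 * pi / 8" "arctan (-1) = - pi / 4"
proof -
  show 1: "arctan (sqrt 2 - 1) = pi / 8"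
    by (rule arctan_unique) (auto simp: tan_pi_8)
  have "3 * pi / 8 = pi / 2 - pi / 8" by simp
  hence "tan (3 * pi / 8) = inverse (sqrt 2 - 1)" by (simp only: tan_cot tan_pi_8)
  also have "\<dots> = 1 + sqrt 2"
    using sqrt2_bounds by (intro inverse_unique) (simp add: algebra_simps)
  finally have "tan (3 * pi / 8) = 1 + sqrt 2" .
  thus 2: "arctan (1 + sqrt 2) = 3 * pi / 8" by (intro arctan_unique) auto
  show "arctan (1 - sqrt 2) = - pi / 8" using 1 arctan_minus[of "sqrt 2 - 1"] by simp
  show "arctan (- (1 + sqrt 2)) = - 3 * pi / 8" using 2 by (subst arctan_minus) simp
  show "arctan (-1) = - pi / 4" by (simp add: arctan_minus)
qed

lemma sector_eq:
  "sector 0 = insert None (Some ` {1 + sqrt 2<..})"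
  "sector 1 = Some ` {1<..1 + sqrt 2}"
  "sector 2 = Some ` {sqrt 2 - 1<..1}"
  "sector 3 = Some ` {0<..sqrt 2 - 1}"
  "sector 4 = Some ` {1 - sqrt 2<..0}"
  "sector 5 = Some ` {-1<..1 - sqrt 2}"
  "sector 6 = Some ` {-(1 + sqrt 2)<..-1}"
  "sector 7 = Some ` {..-(1 + sqrt 2)}"
proof -
  have le: "u \<le> w \<longleftrightarrow> arctan u \<le> a" "w < u \<longleftrightarrow> a < arctan u" if "arctan w = a" for u w a
    using that arctan_le_iff arctan_less_iff by blast+
  have S: "(\<And>u. Some u \<in> sector i \<longleftrightarrow> u \<in> U) \<Longrightarrow> i \<le> 7 \<Longrightarrow> 0 < i \<Longrightarrow> sector i = Some ` U" for i U
  proof (rule set_eqI)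
    fix x assume "\<And>u. Some u \<in> sector i \<longleftrightarrow> u \<in> U" "i \<le> 7" "0 < i"
    thus "x \<in> sector i \<longleftrightarrow> x \<in> Some ` U" using sector_None by (cases x) auto
  qed
  note l = le[OF arctan_values(1)] le[OF arctan_values(2)] le[OF arctan_values(3)] le[OF arctan_values(4)]
    le[OF arctan_values(5)] le[OF arctan_one] 
  have "Some u \<in> sector 0 \<longleftrightarrow> u \<in> {1 + sqrt 2<..}" for u
    using arctan_bounded[of u] by (simp add: sector_Some_arctan l)
  hence "x \<in> sector 0 \<longleftrightarrow> x \<in> insert None (Some ` {1 + sqrt 2<..})" for x
    using sector_None[of 0] by (cases x) auto
  thus "sector 0 = insert None (Some ` {1 + sqrt 2<..})" by blast
  show "sector 1 = Some ` {1<..1 + sqrt 2}"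
    by (rule S; simp add: sector_Some_arctan l del: One_nat_def; argo)
  show "sector 2 = Some ` {sqrt 2 - 1<..1}"
    by (rule S; simp add: sector_Some_arctan l; argo)
  show "sector 3 = Some ` {0<..sqrt 2 - 1}"
  proof (rule S)
    show "Some u \<in> sector 3 \<longleftrightarrow> u \<in> {0<..sqrt 2 - 1}" for u
      unfolding greaterThanAtMost_iff l(1) zero_less_arctan_iff[of u, symmetric]
      by (simp add: sector_Some_arctan del: zero_less_arctan_iff) argo
  qed simp_all
  show "sector 4 = Some ` {1 - sqrt 2<..0}"
  proof (rule S)
    show "Some u \<in> sector 4 \<longleftrightarrow> u \<in> {1 - sqrt 2<..0}" for u
      unfolding greaterThanAtMost_iff l(6) arctan_le_zero_iff[of u, symmetric]
      by (simp add: sector_Some_arctan del: arctan_le_zero_iff) argo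
  qed simp_all
  show "sector 5 = Some ` {-1<..1 - sqrt 2}"
    by (rule S; simp add: sector_Some_arctan l; argo)
  show "sector 6 = Some ` {-(1 + sqrt 2)<..-1}"
  proof (rule S)
    show "Some u \<in> sector 6 \<longleftrightarrow> u \<in> {-(1 + sqrt 2)<..-1}" for u
      unfolding greaterThanAtMost_iff l(8,9) by (simp add: sector_Some_arctan) argo
  qed simp_all
  have "Some u \<in> sector 7 \<longleftrightarrow> u \<in> {..-(1 + sqrt 2)}" for u
    unfolding atMost_iff l(7) using arctan_bounded[of u] by (simp add: sector_Some_arctan) argo
  thus "sector 7 = Some ` {..-(1 + sqrt 2)}" by (rule S) auto
qed

lemma matrix_inv_nu: "matrix_inv (nu 1) = nu 1" "matrix_inv (nu 2) = - nu 6" "matrix_inv (nu 3) = nu 3"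
  "matrix_inv (nu 4) = - nu 4" "matrix_inv (nu 5) = nu 5" "matrix_inv (nu 6) = - nu 2" "matrix_inv (nu 7) = nu 7"
  by (rule inv_unique[OF unimodular_dih[OF nu_dih]]; simp add: matrix_eq_iff matrix_mult_nth del: One_nat_def)+

text \<open>
  In terms of \<open>u\<close> the form of \<open>E\<^sub>i\<close> is, up to a positive factor, the product of the linear factors that
  vanish at the two ends of the sector.
\<close>
lemma exit_sector:
  assumes i: "1 \<le> i" "i \<le> 7" and w: "wall (r v* matrix_inv (nu i)) < 0"
  shows "dpt r \<in> sector i"
proof -
  define s u where "s = sqrt 2" and "u = - r$2 / r$1"
  have s: "s * s = 2" "s * (s * x) = 2 * x" "s > 7/5" "s < 3/2" for x
    using sqrt2_bounds by (simp_all add: s_def)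
  have i7: "i = 1 \<or> i = 2 \<or> i = 3 \<or> i = 4 \<or> i = 5 \<or> i = 6 \<or> i = 7" using i by linarith
  have m0: "r$1 \<noteq> 0"
  proof
    assume "r$1 = 0"
    hence "wall (r v* matrix_inv (nu i)) \<ge> 0"
      using i7 by (elim disjE; simp add: matrix_inv_nu form_mult power_divide del: One_nat_def; simp add: form_def)
    thus False using w by simp
  qed
  hence n: "r$2 = - (u * r$1)" by (simp add: u_def)
  have "2 * wall (r v* matrix_inv (nu i)) = (r$1 * r$1) *
     (if i = 1 then (1 - u) * s * ((1 + s) - u)
      else if i = 2 then (1 - u) * (2 + s) * ((s - 1) - u)
      else if i = 3 then 2 * u * (1 + s) * (u - (s - 1))
      else if i = 4 then 2 * u * (1 + s) * (u - (1 - s))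
      else if i = 5 then (u + 1) * (2 + s) * (u - (1 - s))
      else if i = 6 then (1 + u) * s * ((1 + s) + u)
      else 2 * ((1 + s) + u))" (is "_ = _ * ?q")
    using i7
    by (elim disjE; simp add: matrix_inv_nu form_mult power_divide del: One_nat_def;
        simp add: form_def n power2_eq_square field_simps s(1,2) flip: s_def)
  moreover have "r$1 * r$1 > 0" using m0 by (simp add: zero_less_mult_iff) linarith
  ultimately have "?q < 0" using w by (metis mult_less_0_iff not_less_iff_gr_or_eq mult_pos_neg zero_less_numeral)
  moreover have "dpt r = Some u" using m0 by (simp add: dpt_def u_def)
  ultimately show ?thesis
    using i7 s(3,4)
    by (elim disjE) (auto simp: sector_eq mult_less_0_iff zero_less_mult_iff image_iff
        simp del: One_nat_def simp flip: s_def)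
qed

section \<open>The return map in end point coordinates\<close>

lemma endpoint_coords_proj:
  assumes N: "unimodular N" and l: "frame N \<in> lifted_section"
  shows "endpoint_coords (proj (frame N)) = (dpt (N$1), dpt (N$2))"
  by (simp add: endpoint_coords_def lift_proj[OF l] fwd_end_frame[OF N] bwd_end_frame[OF N]
      bdry_direction_bpt row_nonzero[OF N])

lemma nu_V_P: "i \<le> 7 \<Longrightarrow> nu i \<in> V_P"
  by (intro dih_V_P nu_dih)

lemma F_hat_sector:
  assumes "x \<in> sector i" "1 \<le> i" "i \<le> 7"
  shows "F_hat (x, y) = (mobius (gamma ** nu i) x, mobius (gamma ** nu i) y)"
proof -
  have "(THE i. i \<in> {1..7} \<and> fst (x, y) \<in> sector i) = i"
    using assms sector_disjoint by (intro the_equality) auto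
  thus ?thesis by (simp add: F_hat_def)
qed

text \<open>
  The matrix \<open>g\<close> is \<open>\<nu>\<^sub>i\<^sup>-\<^sup>1 \<gamma>\<close>, the inverse of the matrix \<open>\<gamma> \<nu>\<^sub>i\<close> in the definition of \<open>F_hat\<close>.
\<close>
lemma first_return_section:
  assumes p: "p \<in> lifted_section" and v: "fwd_end p \<notin> oct_vertices"
  obtains q g where "q \<in> lifted_section" "g \<in> V_P"
    "first_return quot_flow cross_section (proj p) = proj q"
    "endpoint_coords (proj q) = F_hat (endpoint_coords (proj p))"
    "fwd_end q = bdry_act (fwd_end p) g" "bwd_end q = bdry_act (bwd_end p) g"
proof -
  obtain N where N: "unimodular N" "p = frame N" "Wall N = 0" "wall (N$1) \<ge> 0"
    using lifted_section_frame[OF p] by blast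
  note r = row_nonzero[OF N(1)]
  have v: "bpt (N$1) \<notin> oct_vertices" using v N by (simp add: fwd_end_frame)
  hence "wall (N$1 v* mat 1) \<noteq> 0" using bpt_oct_vertices[OF r] generators_dih(1) by blast
  hence w: "wall (N$1) > 0" using N(4) by simp
  obtain e where e: "e \<in> dih" "wall (N$1 v* e) < 0" using exit_side[OF r v] .
  obtain i where i: "i \<le> 7" "matrix_inv e = nu i \<or> matrix_inv e = - nu i"
    using dih_nu_ex[OF dih_inv[OF e(1)]] by blast
  define d where "d = matrix_inv (nu i)"
  have ui: "unimodular (nu i)" using i(1) by (intro unimodular_dih nu_dih)
  have "nu i ** e = mat 1 \<or> nu i ** e = - mat 1"
    using i(2) unimodular_inv(2)[OF unimodular_dih[OF e(1)]] by (metis matrix_minus_mult(1) minus_minus)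
  hence "d = e \<or> d = - e"
    unfolding d_def using inv_unique[OF ui] by (metis matrix_minus_mult(2) minus_minus)
  hence d: "d \<in> dih" "wall (N$1 v* d) < 0" using e minus_dih by auto
  have "i \<noteq> 0"
  proof
    assume "i = 0"
    hence "d = mat 1" by (simp add: d_def nu_0 matrix_inv_generators)
    thus False using d(2) w by simp
  qed
  hence i1: "1 \<le> i" by simp
  have sec: "dpt (N$1) \<in> sector i" using exit_sector[OF i1 i(1)] d(2) by (simp add: d_def)
  obtain t where t: "first_return_time quot_flow cross_section (proj (frame N)) t"
    "quot_flow t (proj (frame N)) = proj (frame (flow_mat t ** N ** (d ** gamma)))"
    "frame (flow_mat t ** N ** (d ** gamma)) \<in> lifted_section"
    using section_returns[OF N(1,3) w d] .
  define M g where "M = flow_mat t ** N ** (d ** gamma)" and "g = d ** gamma"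
  have g: "g \<in> V_P" unfolding g_def using d(1) by (intro V_P.mult dih_V_P gamma_V_P)
  have ug: "unimodular g" using g by (rule V_P_unimodular)
  have M: "unimodular M" using N(1) ug unfolding M_def g_def[symmetric]
    by (simp add: unimodular_mult)
  have rows: "M$1 = exp (t/2) *\<^sub>R (N$1 v* g)" "M$2 = exp (-t/2) *\<^sub>R (N$2 v* g)"
    unfolding M_def g_def[symmetric]
    by (simp_all add: vec_eq_iff matrix_mult_nth vector_mult_nth flow_mat_def algebra_simps)
  have gn: "g ** (gamma ** nu i) = mat 1"
  proof -
    have "g ** (gamma ** nu i) = d ** (gamma ** gamma) ** nu i"
      unfolding g_def by (simp only: matrix_mul_assoc)
    also have "\<dots> = mat 1" using unimodular_inv(2)[OF ui] by (simp add: d_def)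
    finally show ?thesis .
  qed
  have act: "mobius (gamma ** nu i) (dpt s) = dpt (s v* g)" if "s \<noteq> 0" for s
  proof -
    have "s = s v* g v* (gamma ** nu i)" by (simp add: vector_mult_assoc gn)
    thus ?thesis
      using mobius_dpt[OF unimodular_mult[OF unimodular_generators(3) ui] vector_mult_nonzero[OF that ug]] by simp
  qed
  have "endpoint_coords (proj (frame M)) = (dpt (N$1 v* g), dpt (N$2 v* g))"
    using endpoint_coords_proj[OF M] t(3) by (simp add: M_def[symmetric] rows dpt_scale)
  also have "\<dots> = F_hat (dpt (N$1), dpt (N$2))"
    using F_hat_sector[OF sec i1 i(1)] act r by simp
  also have "(dpt (N$1), dpt (N$2)) = endpoint_coords (proj p)"
    using endpoint_coords_proj[OF N(1)] p N(2) by simp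
  finally have ec: "endpoint_coords (proj (frame M)) = F_hat (endpoint_coords (proj p))" .
  have bs: "bpt (c *\<^sub>R s) = bpt s" if "c \<noteq> 0" for c s using that by (simp add: bpt_def)
  show ?thesis
  proof (rule that[of "frame M" g])
    show "frame M \<in> lifted_section" using t(3) by (simp add: M_def)
    show "first_return quot_flow cross_section (proj p) = proj (frame M)"
      using first_return_eq[OF t(1)] t(2) N(2) by (simp add: M_def)
    show "fwd_end (frame M) = bdry_act (fwd_end p) g" "bwd_end (frame M) = bdry_act (bwd_end p) g"
      unfolding N(2) fwd_end_frame[OF N(1)] bwd_end_frame[OF N(1)] fwd_end_frame[OF M] bwd_end_frame[OF M]
      by (simp_all add: rows bs bdry_act_bpt[OF r ug])
  qed (fact g ec)+
qed

lemma cusps_act: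
  assumes g: "g \<in> V_P" shows "bdry_act x g \<in> cusps \<longleftrightarrow> x \<in> cusps"
proof -
  have *: "bdry_act x h \<in> cusps" if x: "x \<in> cusps" and h: "h \<in> V_P" for x h
  proof -
    obtain y k where "y \<in> E_ends 0" "k \<in> V_P" "x = bdry_act y k" using x by (auto simp: cusps_def)
    moreover from this have "bdry_act x h = bdry_act y (k ** h)"
      using bdry_act_mult V_P_unimodular h by simp
    ultimately show ?thesis using V_P.mult h by (auto simp: cusps_def)
  qed
  have "bdry_act (bdry_act x g) (matrix_inv g) = x"
    using V_P_unimodular[OF g] by (simp add: bdry_act_mult unimodular_inv)
  thus ?thesis using *[of _ g] *[of _ "matrix_inv g"] g V_P.inv by metis
qed

lemma E_ends_cusps: "E_ends 0 \<subseteq> cusps" and oct_vertices_cusps: "oct_vertices \<subseteq> cusps"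
proof -
  have "bdry_act x (mat 1) \<in> cusps" if "x \<in> E_ends 0" for x
    unfolding cusps_def using that V_P.one by blast
  thus "E_ends 0 \<subseteq> cusps" by auto
  show "oct_vertices \<subseteq> cusps"
    unfolding oct_vertices_def cusps_def E_ends_0 using nu_V_P
    by (auto simp: E_ends_def) blast+
qed

section \<open>The quotient topology\<close>

lemma openin_quotient_top:
  "openin quotient_top U \<longleftrightarrow> U \<subseteq> proj ` T1 \<and> openin (top_of_set T1) {p \<in> T1. proj p \<in> U}"
proof -
  have "istopology (\<lambda>U. U \<subseteq> proj ` T1 \<and> openin (top_of_set T1) {p \<in> T1. proj p \<in> U})"
    unfolding istopology_def
  proof (intro conjI allI impI)
    fix S T assume "S \<subseteq> proj ` T1 \<and> openin (top_of_set T1) {p \<in> T1. proj p \<in> S}"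
      and "T \<subseteq> proj ` T1 \<and> openin (top_of_set T1) {p \<in> T1. proj p \<in> T}"
    moreover have "{p \<in> T1. proj p \<in> S \<inter> T} = {p \<in> T1. proj p \<in> S} \<inter> {p \<in> T1. proj p \<in> T}" by auto
    ultimately show "S \<inter> T \<subseteq> proj ` T1" "openin (top_of_set T1) {p \<in> T1. proj p \<in> S \<inter> T}"
      by (auto intro: openin_Int)
  next
    fix K assume K: "\<forall>S\<in>K. S \<subseteq> proj ` T1 \<and> openin (top_of_set T1) {p \<in> T1. proj p \<in> S}"
    have "{p \<in> T1. proj p \<in> \<Union>K} = (\<Union>S\<in>K. {p \<in> T1. proj p \<in> S})" by auto
    thus "\<Union>K \<subseteq> proj ` T1" "openin (top_of_set T1) {p \<in> T1. proj p \<in> \<Union>K}" using K by auto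
  qed
  thus ?thesis by (simp add: quotient_top_def topology_inverse')
qed

lemma topspace_quotient_top: "topspace quotient_top = proj ` T1"
proof -
  have "{p \<in> T1. proj p \<in> proj ` T1} = T1" by auto
  hence "openin quotient_top (proj ` T1)" unfolding openin_quotient_top by auto
  thus ?thesis using openin_quotient_top unfolding topspace_def by blast
qed

lemma tangent_act_T1: "p \<in> T1 \<Longrightarrow> g \<in> V_P \<Longrightarrow> tangent_act p g \<in> T1"
  by (metis T1_frame V_P_unimodular frame_T1 tangent_act_frame unimodular_mult)

lemma proj_tangent_act: "p \<in> T1 \<Longrightarrow> g \<in> V_P \<Longrightarrow> proj (tangent_act p g) = proj p"
  by (metis T1_frame V_P_unimodular proj_frame_mult tangent_act_frame)

lemma proj_eq_iff:
  assumes "p \<in> T1" "q \<in> T1" shows "proj p = proj q \<longleftrightarrow> (\<exists>g\<in>V_P. p = tangent_act q g)"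
proof -
  obtain M N where "unimodular M" "p = frame M" "unimodular N" "q = frame N"
    using T1_frame assms by metis
  thus ?thesis using proj_frame_eq_iff tangent_act_frame V_P_unimodular by metis
qed

lemma continuous_on_tangent_act:
  assumes g: "g \<in> V_P" shows "continuous_on T1 (\<lambda>p. tangent_act p g)"
proof -
  have u: "unimodular g" using g by (rule V_P_unimodular)
  have im: "Im (fst p) \<noteq> 0" if "p \<in> T1" for p using that by (auto simp: T1_def)
  have nz: "of_real (g$1$2) * fst p + of_real (g$2$2) \<noteq> 0"
    "of_real (g$1$2) * cnj (fst p) + of_real (g$2$2) \<noteq> 0" if "p \<in> T1" for p
    using hyp_act_denominator[OF u, of "fst p"] hyp_act_denominator[OF u, of "cnj (fst p)"] im[OF that] by simp_all
  have "continuous_on T1 (\<lambda>p. (hyp_act (fst p) g,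
     if det g = 1 then snd p / (of_real (g$1$2) * fst p + of_real (g$2$2))\<^sup>2
     else - cnj (snd p) / (of_real (g$1$2) * cnj (fst p) + of_real (g$2$2))\<^sup>2))"
    using nz by (cases "det g = 1") (auto simp: hyp_act_def Let_def intro!: continuous_intros)
  thus ?thesis
    by (rule continuous_on_eq) (use im u in \<open>simp add: tangent_act_eq\<close>)
qed

text \<open>
  The projection is open, since the preimage of the image of \<open>N\<close> is the union of its translates.
\<close>
lemma openin_proj_image:
  assumes "openin (top_of_set T1) N" shows "openin quotient_top (proj ` N)"
proof -
  have NT: "N \<subseteq> T1" using assms openin_imp_subset by blast
  have "{p \<in> T1. proj p \<in> proj ` N} = (\<Union>g\<in>V_P. {p \<in> T1. tangent_act p g \<in> N})"
  proof (intro equalityI subsetI)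
    fix p assume "p \<in> {p \<in> T1. proj p \<in> proj ` N}"
    then obtain q where q: "p \<in> T1" "q \<in> N" "proj q = proj p" by auto
    then obtain g where "g \<in> V_P" "q = tangent_act p g" using proj_eq_iff NT by blast
    thus "p \<in> (\<Union>g\<in>V_P. {p \<in> T1. tangent_act p g \<in> N})" using q by blast
  next
    fix p assume "p \<in> (\<Union>g\<in>V_P. {p \<in> T1. tangent_act p g \<in> N})"
    then obtain g where "g \<in> V_P" "p \<in> T1" "tangent_act p g \<in> N" by blast
    moreover from this have "proj p = proj (tangent_act p g)" by (simp add: proj_tangent_act)
    ultimately show "p \<in> {p \<in> T1. proj p \<in> proj ` N}" by blast
  qed
  moreover have "openin (top_of_set T1) {p \<in> T1. tangent_act p g \<in> N}" if "g \<in> V_P" for g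
  proof -
    have "continuous_map (top_of_set T1) (top_of_set T1) (\<lambda>p. tangent_act p g)"
      using continuous_on_tangent_act[OF that] tangent_act_T1[OF _ that]
      by (simp add: Pi_iff)
    from openin_continuous_map_preimage[OF this assms] show ?thesis by simp
  qed
  ultimately show ?thesis using NT unfolding openin_quotient_top by auto
qed

section \<open>End points as continuous coordinates\<close>

text \<open>
  The derivatives of the coordinates \<open>B\<close>, \<open>D\<close> and \<open>A\<close> of the base point in the direction of the vector; the
  formula for \<open>A\<close> comes from differentiating \<open>A D - B\<^sup>2 = 1\<close>. Together with the coordinates they give the null
  vectors of both ends, and thereby the ends as continuous functions on the unit tangent bundle.
\<close>
definition velB :: "complex \<times> complex \<Rightarrow> real" where
  "velB p = Re (snd p) / Im (fst p) - Re (fst p) * Im (snd p) / (Im (fst p))\<^sup>2"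
definition velD :: "complex \<times> complex \<Rightarrow> real" where
  "velD p = - Im (snd p) / (Im (fst p))\<^sup>2"
definition velA :: "complex \<times> complex \<Rightarrow> real" where
  "velA p = (2 * coordB (fst p) * velB p - coordA (fst p) * velD p) / coordD (fst p)"

definition fwd_u :: "complex \<times> complex \<Rightarrow> real" where
  "fwd_u p = - (coordB (fst p) + velB p) / (coordA (fst p) + velA p)"
definition bwd_u :: "complex \<times> complex \<Rightarrow> real" where
  "bwd_u p = - (coordB (fst p) - velB p) / (coordA (fst p) - velA p)"

lemma vel_frame:
  assumes N: "unimodular N"
  shows "velA (frame N) = form_A (N$1) - form_A (N$2)" "velB (frame N) = form_B (N$1) - form_B (N$2)"
proof -
  define B' D' where "B' = form_B (N$1) - form_B (N$2)" and "D' = form_D (N$1) - form_D (N$2)"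
  define A B D where "A = Form_A N" and "B = Form_B N" and "D = Form_D N"
  have D0: "D > 0" using Form_pos[OF N] by (simp add: D_def)
  have f: "frame N = (Complex (B / D) (1 / D), Complex ((B' * D - B * D') / D\<^sup>2) (- D' / D\<^sup>2))"
    by (simp only: frame_def pt_def Let_def A_def B_def D_def B'_def D'_def)
  show vB: "velB (frame N) = form_B (N$1) - form_B (N$2)"
    unfolding B'_def[symmetric] using D0 by (simp add: velB_def f field_simps power2_eq_square)
  have vD: "velD (frame N) = D'" using D0 by (simp add: velD_def f field_simps power2_eq_square)
  have "D * (form_A (N$1) - form_A (N$2)) = 2 * B * B' - A * D'"
    unfolding A_def B_def D_def B'_def D'_def Form_def by (simp add: form_def power2_eq_square algebra_simps)
  hence "form_A (N$1) - form_A (N$2) = (2 * B * B' - A * D') / D" using D0 by (simp add: field_simps)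
  thus "velA (frame N) = form_A (N$1) - form_A (N$2)"
    by (simp add: velA_def vD vB coord_pt[OF N] flip: A_def B_def D_def B'_def)
qed

lemma end_u_frame:
  assumes N: "unimodular N"
  shows "coordA (fst (frame N)) + velA (frame N) = 2 * (N$1$1)\<^sup>2"
    "coordA (fst (frame N)) - velA (frame N) = 2 * (N$2$1)\<^sup>2"
    "N$1$1 \<noteq> 0 \<Longrightarrow> fwd_u (frame N) = - N$1$2 / N$1$1"
    "N$2$1 \<noteq> 0 \<Longrightarrow> bwd_u (frame N) = - N$2$2 / N$2$1"
  by (simp_all add: fwd_u_def bwd_u_def vel_frame[OF N] coord_pt[OF N] Form_def form_def
      power2_eq_square field_simps)

lemma continuous_on_coords:
  "continuous_on T1 (\<lambda>p. coordA (fst p))" "continuous_on T1 (\<lambda>p. coordB (fst p))"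
  "continuous_on T1 (\<lambda>p. coordD (fst p))" "continuous_on T1 velA" "continuous_on T1 velB"
proof -
  have im: "Im (fst p) \<noteq> 0" if "p \<in> T1" for p using that by (auto simp: T1_def)
  show A: "continuous_on T1 (\<lambda>p. coordA (fst p))" and B: "continuous_on T1 (\<lambda>p. coordB (fst p))"
    and D: "continuous_on T1 (\<lambda>p. coordD (fst p))"
    unfolding coordA_def coordB_def coordD_def using im by (auto intro!: continuous_intros)
  show vB: "continuous_on T1 velB"
    unfolding velB_def[abs_def] using im by (auto intro!: continuous_intros)
  have vD: "continuous_on T1 velD"
    unfolding velD_def[abs_def] using im by (auto intro!: continuous_intros)
  have D0: "coordD (fst p) \<noteq> 0" if "p \<in> T1" for p using im[OF that] by (simp add: coordD_def)
  show "continuous_on T1 velA"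
    unfolding velA_def[abs_def] by (intro continuous_intros A B D vB vD) (use D0 in auto)
qed

section \<open>The homeomorphism\<close>

definition uv_domain :: "(real \<times> real) set" where
  "uv_domain = {..<1 + sqrt 2} \<times> {1 + sqrt 2<..}"

lemma wall_u: "r$1 \<noteq> 0 \<Longrightarrow> wall r = (r$1)\<^sup>2 * ((1 + sqrt 2) - (- r$2 / r$1))"
  by (simp add: form_def field_simps power2_eq_square)

lemma section_avoiding_E_ends:
  "section_avoiding (E_ends 0) = {proj (frame N) | N. unimodular N \<and> Wall N = 0 \<and> wall (N$1) > 0}"
proof (intro equalityI subsetI)
  fix x assume "x \<in> section_avoiding (E_ends 0)"
  then obtain p where p: "p \<in> lifted_section" "fwd_end p \<notin> E_ends 0" "x = proj p"
    by (auto simp: section_avoiding_def)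
  obtain N where N: "unimodular N" "p = frame N" "Wall N = 0" "wall (N$1) \<ge> 0"
    using lifted_section_frame[OF p(1)] by blast
  have "wall (N$1) \<noteq> 0" using p(2) N bpt_E_ends_0[OF row_nonzero[OF N(1)]] by (simp add: fwd_end_frame)
  thus "x \<in> {proj (frame N) | N. unimodular N \<and> Wall N = 0 \<and> wall (N$1) > 0}"
    using N p(3) by fastforce
next
  fix x assume "x \<in> {proj (frame N) | N. unimodular N \<and> Wall N = 0 \<and> wall (N$1) > 0}"
  then obtain N where N: "unimodular N" "Wall N = 0" "wall (N$1) > 0" "x = proj (frame N)" by blast
  have "wall (N$2) < 0" using N by (simp add: Form_def)
  moreover have "frame N \<in> lifted_section" using N by (simp add: frame_lifted_section)
  ultimately show "x \<in> section_avoiding (E_ends 0)"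
    unfolding section_avoiding_def using N bpt_E_ends_0[OF row_nonzero[OF N(1)]]
    by (intro image_eqI[of _ proj "frame N"]) (auto simp: fwd_end_frame bwd_end_frame)
qed

lemma Sigma_sectors_eq: "Sigma_sectors = Some ` {..1 + sqrt 2}"
proof -
  have "{1..7::nat} = {1, 2, 3, 4, 5, 6, 7}" by auto
  thus ?thesis unfolding Sigma_sectors_def using sqrt2_bounds
    by (auto simp: sector_eq image_iff simp del: One_nat_def)
qed

lemma domain_avoiding_E_ends:
  "domain_avoiding (E_ends 0) = {(Some u, Some v) | u v. (u, v) \<in> uv_domain}"
proof -
  have "1 - sqrt 2 \<noteq> 0" using sqrt2_bounds by simp
  moreover have "- 1 = (1 + sqrt 2) * (1 - sqrt 2)" by (simp add: algebra_simps)
  ultimately have "- 1 / (1 - sqrt 2) = 1 + sqrt 2" by (metis nonzero_mult_div_cancel_right)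
  hence "bdry_direction ` E_ends 0 = {None, Some (1 + sqrt 2)}"
    using sqrt2_bounds by (auto simp: E_ends_0 bdry_direction_def)
  thus ?thesis
    unfolding domain_avoiding_def Sigma_sectors_eq sector_eq(1) uv_domain_def by auto
qed

lemma endpoint_coords_section:
  assumes N: "unimodular N" "Wall N = 0" "wall (N$1) > 0"
  shows "endpoint_coords (proj (frame N)) = (Some (fwd_u (frame N)), Some (bwd_u (frame N)))"
    "(fwd_u (frame N), bwd_u (frame N)) \<in> uv_domain" "N$1$1 \<noteq> 0" "N$2$1 \<noteq> 0"
proof -
  have w2: "wall (N$2) < 0" using N by (simp add: Form_def)
  show nz: "N$1$1 \<noteq> 0" "N$2$1 \<noteq> 0" using N(3) w2 by (auto simp: form_def)
  have l: "frame N \<in> lifted_section" using N by (simp add: frame_lifted_section)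
  show "endpoint_coords (proj (frame N)) = (Some (fwd_u (frame N)), Some (bwd_u (frame N)))"
    using nz by (simp add: endpoint_coords_proj[OF N(1) l] end_u_frame[OF N(1)] dpt_def)
  have "(N$1$1)\<^sup>2 > 0" "(N$2$1)\<^sup>2 > 0" using nz by simp_all
  hence "- N$1$2 / N$1$1 < 1 + sqrt 2" "- N$2$2 / N$2$1 > 1 + sqrt 2"
    using N(3) w2 unfolding wall_u[OF nz(1)] wall_u[OF nz(2)]
    by (simp_all only: zero_less_mult_iff mult_less_0_iff) auto
  thus "(fwd_u (frame N), bwd_u (frame N)) \<in> uv_domain"
    using nz by (simp add: uv_domain_def end_u_frame[OF N(1)])
qed

text \<open>
  The vector of the section with given ends. The rows are \<open>a (1, -u)\<close> and \<open>b (1, -v)\<close>; the base point is on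
  \<open>E\<^sub>0\<close> and the determinant is \<open>-1\<close> if and only if \<open>a\<^sup>2 (c - u) = b\<^sup>2 (v - c)\<close> and \<open>a b (v - u) = 1\<close>.
\<close>
definition section_frame :: "real \<times> real \<Rightarrow> real^2^2" where
  "section_frame uv = (let u = fst uv; v = snd uv; c = 1 + sqrt 2;
      a = sqrt (sqrt ((v - c) / (c - u)) / (v - u)); b = sqrt (sqrt ((c - u) / (v - c)) / (v - u))
    in mat22 a (- u * a) b (- v * b))"

lemma section_frame:
  assumes "(u, v) \<in> uv_domain"
  defines "N \<equiv> section_frame (u, v)"
  shows "unimodular N" "Wall N = 0" "wall (N$1) > 0" "N$1$2 = - u * N$1$1" "N$2$2 = - v * N$2$1"
    "(N$1$1)\<^sup>2 = sqrt ((v - (1 + sqrt 2)) / ((1 + sqrt 2) - u)) / (v - u)"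
    "(N$2$1)\<^sup>2 = sqrt (((1 + sqrt 2) - u) / (v - (1 + sqrt 2))) / (v - u)"
proof -
  define c where "c = 1 + sqrt 2"
  define p q where "p = c - u" and "q = v - c"
  have pq: "p > 0" "q > 0" "v - u = p + q" using assms(1) by (auto simp: uv_domain_def p_def q_def c_def)
  define a b where "a = sqrt (sqrt (q / p) / (p + q))" and "b = sqrt (sqrt (p / q) / (p + q))"
  have N: "N = mat22 a (- u * a) b (- v * b)"
    unfolding N_def section_frame_def Let_def fst_conv snd_conv
    by (simp add: a_def b_def pq(3)[symmetric]) (simp add: p_def q_def c_def)
  have a2: "a\<^sup>2 = sqrt (q / p) / (p + q)" and b2: "b\<^sup>2 = sqrt (p / q) / (p + q)"
    using pq by (simp_all add: a_def b_def)
  have pos: "a > 0" "b > 0" using pq by (simp_all add: a_def b_def)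
  have "sqrt (q / p) * sqrt (p / q) = 1" using pq by (simp flip: real_sqrt_mult)
  moreover have "a\<^sup>2 * b\<^sup>2 * (p + q)\<^sup>2 = (sqrt (q / p) * sqrt (p / q)) * ((p + q)\<^sup>2 / ((p + q) * (p + q)))"
    by (simp only: a2 b2 times_divide_eq_left times_divide_eq_right divide_divide_eq_left mult_ac)
  ultimately have ab2: "a\<^sup>2 * b\<^sup>2 * (p + q)\<^sup>2 = 1" using pq by (simp add: power2_eq_square)
  have "(a * (- v * b) - - u * a * b)\<^sup>2 = a\<^sup>2 * b\<^sup>2 * (v - u)\<^sup>2"
    by (simp add: power2_eq_square algebra_simps)
  hence "(a * (- v * b) - - u * a * b)\<^sup>2 = 1" using ab2 pq(3) by simp
  thus "unimodular N" by (simp add: unimodular_square N)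
  have w: "wall (N$1) = a\<^sup>2 * p" "wall (N$2) = - b\<^sup>2 * q"
    by (simp_all add: form_def N p_def q_def c_def power2_eq_square algebra_simps)
  have e: "sqrt (q / p) * p = sqrt (p * q)" "sqrt (p / q) * q = sqrt (p * q)"
  proof -
    have "sqrt (x / y) * y = sqrt (x * y)" if "x > 0" "y > 0" for x y :: real
    proof -
      have "sqrt (x / y) * y = sqrt x * (y / sqrt y)" by (simp add: real_sqrt_divide)
      thus ?thesis using that by (simp add: real_div_sqrt real_sqrt_mult)
    qed
    from this[OF pq(2,1)] this[OF pq(1,2)]
    show "sqrt (q / p) * p = sqrt (p * q)" "sqrt (p / q) * q = sqrt (p * q)" by (simp_all add: mult.commute)
  qed
  show "Wall N = 0" unfolding Form_def w a2 b2 using e by (simp add: field_simps)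
  show "wall (N$1) > 0" unfolding w using pos pq by simp
  show "N$1$2 = - u * N$1$1" "N$2$2 = - v * N$2$1" by (simp_all add: N)
  show "(N$1$1)\<^sup>2 = sqrt ((v - (1 + sqrt 2)) / ((1 + sqrt 2) - u)) / (v - u)"
    "(N$2$1)\<^sup>2 = sqrt (((1 + sqrt 2) - u) / (v - (1 + sqrt 2))) / (v - u)"
    using a2 b2 by (simp_all add: N pq(3)) (simp_all add: p_def q_def c_def)
qed

lemma section_frame_coords:
  assumes "(u, v) \<in> uv_domain"
  shows "endpoint_coords (proj (frame (section_frame (u, v)))) = (Some u, Some v)"
proof -
  note s = section_frame[OF assms]
  note e = endpoint_coords_section[OF s(1-3)]
  show ?thesis unfolding e(1) using e(3,4) by (simp add: end_u_frame[OF s(1)] s(4,5))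
qed

lemma section_frame_inverse:
  assumes N: "unimodular N" "Wall N = 0" "wall (N$1) > 0"
  shows "frame (section_frame (fwd_u (frame N), bwd_u (frame N))) = frame N"
proof -
  define u v where "u = fwd_u (frame N)" and "v = bwd_u (frame N)"
  note e = endpoint_coords_section[OF N]
  have uv: "(u, v) \<in> uv_domain" using e(2) by (simp add: u_def v_def)
  note s = section_frame[OF uv]
  define c m k where "c = 1 + sqrt 2" and "m = (N$1$1)\<^sup>2" and "k = (N$2$1)\<^sup>2"
  have pos: "m > 0" "k > 0" using e(3,4) by (simp_all add: m_def k_def)
  have d: "c - u > 0" "v - c > 0" "v - u > 0" using uv by (auto simp: uv_domain_def c_def)
  have n: "N$1$2 = - u * N$1$1" "N$2$2 = - v * N$2$1"
    using e(3,4) by (simp_all add: u_def v_def end_u_frame[OF N(1)])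
  have "wall (N$1) = m * (c - u)" "wall (N$2) = k * (c - v)"
    by (simp_all add: form_def n m_def k_def c_def power2_eq_square algebra_simps)
  hence W: "m * (c - u) = k * (v - c)" using N(2) by (simp add: Form_def algebra_simps)
  have U: "m * k * (v - u)\<^sup>2 = 1"
  proof -
    have "(N$1$1 * N$2$2 - N$1$2 * N$2$1)\<^sup>2 = m * k * (v - u)\<^sup>2"
      by (simp add: n m_def k_def power2_eq_square algebra_simps)
    thus ?thesis using N(1) by (simp add: unimodular_square)
  qed
  have sq: "(y * (v - u))\<^sup>2 = q / p" if "y * p = z * q" "y * z * (v - u)\<^sup>2 = 1" "p > 0" for y z p q
  proof -
    have "(y * (v - u))\<^sup>2 * p = (y * (v - u)\<^sup>2) * (y * p)" by (simp add: power2_eq_square algebra_simps)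
    also have "\<dots> = (y * z * (v - u)\<^sup>2) * q" unfolding that(1) by (simp add: algebra_simps)
    finally show ?thesis using that by (simp add: nonzero_eq_divide_eq)
  qed
  have m2: "(m * (v - u))\<^sup>2 = (v - c) / (c - u)" using sq[OF W U d(1)] .
  have k2: "(k * (v - u))\<^sup>2 = (c - u) / (v - c)" using sq[OF W[symmetric] _ d(2)] U by (simp add: mult.commute)
  have "sqrt ((v - c) / (c - u)) = m * (v - u)" "sqrt ((c - u) / (v - c)) = k * (v - u)"
    using m2 k2 pos d by (simp_all add: real_sqrt_unique)
  hence ab: "(section_frame (u, v)$1$1)\<^sup>2 = m" "(section_frame (u, v)$2$1)\<^sup>2 = k"
    using s(6,7) d by (simp_all add: c_def)
  have "frame (section_frame (u, v)) = frame N"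
    unfolding frame_eq_iff[OF s(1) N(1)] forall_2
    using ab s(4,5) n by (simp add: form_def m_def k_def power_mult_distrib power2_eq_square)
  thus ?thesis by (simp add: u_def v_def)
qed

lemma continuous_section_frame: "continuous_on uv_domain (\<lambda>x. frame (section_frame x))"
proof -
  define c where "c = 1 + sqrt 2"
  define a where "a x = sqrt (sqrt ((snd x - c) / (c - fst x)) / (snd x - fst x))" for x
  define b where "b x = sqrt (sqrt ((c - fst x) / (snd x - c)) / (snd x - fst x))" for x
  have d: "c - fst x > 0" "snd x - c > 0" "snd x - fst x > 0" if "x \<in> uv_domain" for x
    using that by (auto simp: uv_domain_def c_def)
  have ca: "continuous_on uv_domain a" and cb: "continuous_on uv_domain b"
    unfolding a_def[abs_def] b_def[abs_def] using d by (force intro!: continuous_intros)+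
  have sf: "section_frame x = mat22 (a x) (- fst x * a x) (b x) (- snd x * b x)" for x
    by (simp add: section_frame_def Let_def a_def b_def c_def)
  have cf: "continuous_on uv_domain (\<lambda>x. form p q r (section_frame x $ i))" for p q r i
  proof -
    from exhaust_2[of i] show ?thesis
      by (elim disjE; hypsubst; unfold sf form_def mat22_nth; intro continuous_intros ca cb)
  qed
  hence cF: "continuous_on uv_domain (\<lambda>x. Form p q r (section_frame x))" for p q r
    unfolding Form_def by (intro continuous_intros)
  have D: "Form_D (section_frame x) \<noteq> 0" if "x \<in> uv_domain" for x
    using Form_pos(2) section_frame(1) that by (cases x) fastforce
  show ?thesis
    unfolding frame_def Let_def pt_def by (intro continuous_intros cf cF) (use D in auto)
qed

text \<open>
  The continuity of the end points on the section, read in the quotient. The neighbourhood consists of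
  vectors over the triangle and its reflection in \<open>E\<^sub>0\<close>, away from the other sides, with ends near the given
  ones. A vector of the section in the orbit of such a vector is the vector itself: strictness leaves
  only \<open>\<plusminus>1\<close> and \<open>\<plusminus>\<gamma>\<close>, and \<open>\<gamma>\<close> is excluded by the position of the forward end.
\<close>
lemma section_neighbourhood:
  assumes N: "unimodular N" "Wall N = 0" "wall (N$1) > 0"
    and U: "open U" "(fwd_u (frame N), bwd_u (frame N)) \<in> U"
  obtains W where "openin quotient_top W" "proj (frame N) \<in> W"
    "\<And>M. unimodular M \<Longrightarrow> Wall M = 0 \<Longrightarrow> wall (M$1) > 0 \<Longrightarrow> proj (frame M) \<in> W \<Longrightarrow>
      (fwd_u (frame M), bwd_u (frame M)) \<in> U"
proof -
  define lin where "lin a b d p = a * coordA (fst p) + b * coordB (fst p) + d * coordD (fst p)"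
    for a b d :: real and p :: "complex \<times> complex"
  have clin: "continuous_on T1 (lin a b d)" for a b d
    unfolding lin_def by (intro continuous_intros continuous_on_coords)
  have lin: "lin a b d (frame M) = Form a b d M" if "unimodular M" for a b d M
    using that by (simp add: lin_def coord_pt Form_expand[of a b d])
  \<comment> \<open>The conditions for \<open>N \<gamma>\<close> are linear in the coordinates of \<open>N\<close> as well.\<close>
  obtain a1 b1 d1 where g1: "\<And>M. wall_alpha (M ** gamma) = Form a1 b1 d1 M" using Form_mult by blast
  obtain a2 b2 d2 where g2: "\<And>M. wall_beta (M ** gamma) = Form a2 b2 d2 M" using Form_mult by blast
  define T where "T = {p \<in> T1. coordA (fst p) + velA p > 0 \<and> coordA (fst p) - velA p > 0}"
  define H where "H p = (fwd_u p, bwd_u p)" for p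
  define G where "G = {p \<in> T1. lin 0 (-1) 0 p > 0} \<inter> {p \<in> T1. lin (-1) 2 1 p > 0}
     \<inter> {p \<in> T1. lin a1 b1 d1 p > 0} \<inter> {p \<in> T1. lin a2 b2 d2 p > 0}"
  have op: "openin (top_of_set T1) {p \<in> T1. f p > 0}" if "continuous_on T1 f" for f :: "complex \<times> complex \<Rightarrow> real"
  proof -
    have "{p \<in> T1. f p > 0} = T1 \<inter> f -` {0<..}" by auto
    thus ?thesis using continuous_openin_preimage_gen[OF that open_greaterThan] by simp
  qed
  have "openin (top_of_set T1) {p \<in> T1. coordA (fst p) + velA p > 0}"
    "openin (top_of_set T1) {p \<in> T1. coordA (fst p) - velA p > 0}"
    by (intro op continuous_intros continuous_on_coords)+
  moreover have "T = {p \<in> T1. coordA (fst p) + velA p > 0} \<inter> {p \<in> T1. coordA (fst p) - velA p > 0}"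
    by (auto simp: T_def)
  ultimately have oT: "openin (top_of_set T1) T" by (simp only: openin_Int)
  have oG: "openin (top_of_set T1) G" unfolding G_def by (intro openin_Int op clin)
  have TT: "T \<subseteq> T1" by (auto simp: T_def)
  have "continuous_on T H"
    unfolding H_def fwd_u_def bwd_u_def
    by (intro continuous_intros continuous_on_subset[OF continuous_on_coords(1) TT]
      continuous_on_subset[OF continuous_on_coords(2) TT] continuous_on_subset[OF continuous_on_coords(4) TT]
      continuous_on_subset[OF continuous_on_coords(5) TT]) (auto simp: T_def)
  moreover have "open uv_domain" by (auto simp: uv_domain_def intro!: open_Times)
  ultimately have "openin (top_of_set T) (T \<inter> H -` (U \<inter> uv_domain))"
    using U(1) by (intro continuous_openin_preimage_gen) auto
  hence oH: "openin (top_of_set T1) (T \<inter> H -` (U \<inter> uv_domain))"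
    using openin_trans oT by blast
  define V where "V = T \<inter> H -` (U \<inter> uv_domain) \<inter> G"
  have oV: "openin (top_of_set T1) V" unfolding V_def by (intro openin_Int oH oG)
  have uG: "unimodular (M ** gamma)" if "unimodular M" for M using that by (simp add: unimodular_mult)
  have inG: "frame M \<in> G \<longleftrightarrow> wall_alpha M > 0 \<and> wall_beta M > 0 \<and> wall_alpha (M ** gamma) > 0 \<and> wall_beta (M ** gamma) > 0"
    if "unimodular M" for M
    using frame_T1[OF that] by (auto simp: G_def lin[OF that] g1 g2)
  have NV: "frame N \<in> V"
  proof -
    note e = endpoint_coords_section[OF N]
    have "frame N \<in> T" using frame_T1[OF N(1)] e(3,4) unfolding T_def by (simp only: end_u_frame[OF N(1)] mem_Collect_eq) simp
    moreover have "frame N \<in> G"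
      unfolding inG[OF N(1)] using tri_on_Wall[OF N(1,2)] tri_on_Wall[OF uG[OF N(1)]] N(2) by simp
    ultimately show ?thesis using U(2) e(2) by (simp add: V_def H_def)
  qed
  show ?thesis
  proof (rule that[of "proj ` V"])
    show "openin quotient_top (proj ` V)" using oV by (rule openin_proj_image)
    show "proj (frame N) \<in> proj ` V" using NV by blast
    fix M assume M: "unimodular M" "Wall M = 0" "wall (M$1) > 0" "proj (frame M) \<in> proj ` V"
    then obtain p where p: "p \<in> V" "proj (frame M) = proj p" by blast
    hence "p \<in> T1" using oV openin_imp_subset by blast
    then obtain K where K: "unimodular K" "p = frame K" by (rule T1_frame)
    obtain g where g: "g \<in> V_P" "frame M = frame (K ** g)"
      using p(2) K proj_frame_eq_iff M(1) by blast
    define L where "L = K ** g"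
    have L: "unimodular L" unfolding L_def using K(1) g(1) by (simp add: unimodular_mult V_P_unimodular)
    have eqL: "frame M = frame L" using g(2) by (simp add: L_def)
    have WL: "Wall L = 0" using M(1,2) L eqL pt_E_0 fst_frame by metis
    have lL: "frame L \<in> lifted_section" using M eqL frame_lifted_section[OF M(1)] by simp
    have Kp: "wall_alpha K > 0" "wall_beta K > 0" "wall_alpha (K ** gamma) > 0" "wall_beta (K ** gamma) > 0"
      using p(1) K inG by (auto simp: V_def)
    have uK: "fwd_u (frame K) < 1 + sqrt 2" "K$1$1 \<noteq> 0"
    proof -
      show "fwd_u (frame K) < 1 + sqrt 2" using p(1) K by (auto simp: V_def H_def uv_domain_def)
      have "frame K \<in> T" using p(1) K by (simp add: V_def)
      thus "K$1$1 \<noteq> 0" unfolding T_def using end_u_frame[OF K(1)] by auto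
    qed
    have wK: "wall (K$1) > 0"
      unfolding wall_u[OF uK(2)] using uK by (intro mult_pos_pos) (auto simp: end_u_frame[OF K(1)])
    have triL: "tri L" using tri_on_Wall(3)[OF L WL] .
    have "g = mat 1 \<or> g = - mat 1"
    proof (cases "Wall K \<ge> 0")
      case True
      hence "tri K" using Kp by (simp add: tri_def)
      hence "g \<in> stab K" using strict_fundamental_domain[OF K(1) g(1)] triL by (simp add: L_def)
      hence "g = mat 1 \<or> g = - mat 1 \<or> g = gamma \<or> g = - gamma" using Kp by (auto simp: stab_def)
      moreover have "\<not> (g = gamma \<or> g = - gamma)"
      proof
        assume "g = gamma \<or> g = - gamma"
        hence "wall (L$1) = - wall (K$1)" by (auto simp: L_def row_mult)
        thus False using lL wK L by (simp add: frame_lifted_section)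
      qed
      ultimately show ?thesis by blast
    next
      case False
      hence "tri (K ** gamma)" using Kp by (simp add: tri_def)
      moreover have "K ** gamma ** (gamma ** g) = L"
        by (simp add: L_def matrix_mul_assoc) (simp flip: matrix_mul_assoc[of K gamma gamma])
      ultimately have "gamma ** g \<in> stab (K ** gamma)"
        using strict_fundamental_domain[OF uG[OF K(1)] V_P.mult[OF gamma_V_P g(1)]] triL by simp
      hence "gamma ** g = mat 1 \<or> gamma ** g = - mat 1" using Kp False by (auto simp: stab_def)
      hence "gamma ** (gamma ** g) = gamma \<or> gamma ** (gamma ** g) = - gamma" by auto
      hence "g = gamma \<or> g = - gamma" by (simp add: matrix_mul_assoc)
      hence "Wall L = - Wall K" by (auto simp: L_def)
      thus ?thesis using WL False by simp
    qed
    hence "frame L = frame K" by (auto simp: L_def)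
    thus "(fwd_u (frame M), bwd_u (frame M)) \<in> U"
      using p(1) K(2) eqL by (simp add: V_def H_def)
  qed
qed

theorem endpoint_coords_homeomorphic:
  "homeomorphic_map (subtopology quotient_top (section_avoiding (E_ends 0)))
     (subtopology (prod_topology RP1 RP1) (domain_avoiding (E_ends 0))) endpoint_coords"
proof -
  define S where "S = section_avoiding (E_ends 0)"
  define D where "D = domain_avoiding (E_ends 0)"
  let ?R = "prod_topology RP1 RP1"
  let ?X = "subtopology quotient_top S" and ?Y = "subtopology ?R D"
  define h where "h x = (the (fst x), the (snd x))" for x :: "real option \<times> real option"
  define k where "k x = proj (frame (section_frame (h x)))" for x
  have Sx: "\<exists>N. unimodular N \<and> Wall N = 0 \<and> wall (N$1) > 0 \<and> x = proj (frame N)" if "x \<in> S" for x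
    using that by (auto simp: S_def section_avoiding_E_ends)
  have Dx: "\<exists>u v. (u, v) \<in> uv_domain \<and> y = (Some u, Some v)" if "y \<in> D" for y
    using that by (auto simp: D_def domain_avoiding_E_ends)
  have DI: "(Some u, Some v) \<in> D" if "(u, v) \<in> uv_domain" for u v
    using that by (auto simp: D_def domain_avoiding_E_ends)
  have S_sub: "S \<subseteq> proj ` T1" using Sx frame_T1 by blast
  have tS: "topspace ?X = S"
    using S_sub by (simp add: topspace_quotient_top Int_absorb1)
  have tR: "topspace RP1 = UNIV"
  proof -
    have "x \<in> insert None (range Some)" for x :: "real option" by (cases x) auto
    thus ?thesis by (auto simp: RP1_def)
  qed
  have tD: "topspace ?Y = D" by (simp add: tR)
  have S_in: "proj (frame (section_frame uv)) \<in> S" if "uv \<in> uv_domain" for uv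
    using section_frame(1-3)[of "fst uv" "snd uv"] that unfolding S_def section_avoiding_E_ends by auto
  have cont_h: "continuous_map ?Y (top_of_set uv_domain) h"
  proof (rule continuous_map_into_subtopology)
    show "h \<in> topspace ?Y \<rightarrow> uv_domain"
      unfolding tD using Dx by (fastforce simp: h_def)
    have "continuous_map ?Y euclideanreal (the \<circ> f)"
      if f: "continuous_map ?R RP1 f" "\<And>y. y \<in> D \<Longrightarrow> f y \<noteq> None" for f
      unfolding continuous_map_def
    proof (intro conjI allI impI)
      fix U :: "real set" assume "openin euclideanreal U"
      hence "openin RP1 (Some ` U)" by (simp add: RP1_def)
      hence "openin ?R {y \<in> topspace ?R. f y \<in> Some ` U}"
        using f(1) openin_continuous_map_preimage by blast
      moreover have "{y \<in> topspace ?Y. (the \<circ> f) y \<in> U} =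
          D \<inter> {y \<in> topspace ?R. f y \<in> Some ` U}"
        unfolding tD using f(2) by (auto simp: tR image_iff) (metis option.sel)
      ultimately show "openin ?Y
          {y \<in> topspace ?Y. (the \<circ> f) y \<in> U}"
        by (simp add: openin_subtopology_Int2)
    qed simp
    from this[OF continuous_map_fst] this[OF continuous_map_snd]
    have "continuous_map ?Y (prod_topology euclideanreal euclideanreal) h"
      unfolding continuous_map_pairwise using Dx by (force simp: h_def o_def)
    thus "continuous_map ?Y euclidean h" by simp
  qed
  have cont_s: "continuous_map (top_of_set uv_domain) (top_of_set T1) (\<lambda>x. frame (section_frame x))"
    using continuous_section_frame section_frame(1) frame_T1 by (auto simp: Pi_iff)
  have cont_p: "continuous_map (top_of_set T1) quotient_top proj"
    unfolding continuous_map_def topspace_quotient_top openin_quotient_top by auto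
  have cont_k: "continuous_map ?Y ?X k"
  proof (rule continuous_map_into_subtopology)
    show "continuous_map ?Y quotient_top k"
      using continuous_map_compose[OF continuous_map_compose[OF cont_h cont_s] cont_p]
      by (simp add: o_def k_def[abs_def])
    show "k \<in> topspace ?Y \<rightarrow> S"
      unfolding tD using Dx S_in by (fastforce simp: k_def h_def)
  qed
  have ecS: "endpoint_coords x \<in> D" if x: "x \<in> S" for x
  proof -
    obtain N where N: "unimodular N" "Wall N = 0" "wall (N$1) > 0" "x = proj (frame N)" using Sx[OF x] by blast
    show ?thesis using endpoint_coords_section[OF N(1-3)] N(4) DI by simp
  qed
  have cont_hS: "continuous_map ?X (euclidean :: (real \<times> real) topology) (h \<circ> endpoint_coords)"
    unfolding continuous_map_def
  proof (intro conjI allI impI)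
    fix U :: "(real \<times> real) set" assume "openin euclidean U"
    hence U: "open U" by simp
    show "openin ?X {x \<in> topspace ?X. (h \<circ> endpoint_coords) x \<in> U}"
      unfolding tS
    proof (subst openin_subopen, intro ballI)
      fix x assume x: "x \<in> {x \<in> S. (h \<circ> endpoint_coords) x \<in> U}"
      then obtain N where N: "unimodular N" "Wall N = 0" "wall (N$1) > 0" "x = proj (frame N)" using Sx by blast
      have hM: "(h \<circ> endpoint_coords) (proj (frame M)) = (fwd_u (frame M), bwd_u (frame M))"
        if "unimodular M" "Wall M = 0" "wall (M$1) > 0" for M
        using endpoint_coords_section(1)[OF that] by (simp add: h_def)
      have "(fwd_u (frame N), bwd_u (frame N)) \<in> U" using x hM[OF N(1-3)] N(4) by simp
      then obtain W where W: "openin quotient_top W" "proj (frame N) \<in> W"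
        "\<And>M. unimodular M \<Longrightarrow> Wall M = 0 \<Longrightarrow> wall (M$1) > 0 \<Longrightarrow> proj (frame M) \<in> W \<Longrightarrow>
          (fwd_u (frame M), bwd_u (frame M)) \<in> U"
        using section_neighbourhood[OF N(1-3) U] by metis
      have "openin ?X (S \<inter> W)"
        using W(1) by (rule openin_subtopology_Int2)
      moreover have "S \<inter> W \<subseteq> {x \<in> S. (h \<circ> endpoint_coords) x \<in> U}"
        using Sx W(3) hM by fastforce
      ultimately show "\<exists>T. openin ?X T \<and> x \<in> T \<and> T \<subseteq> {x \<in> S. (h \<circ> endpoint_coords) x \<in> U}"
        using x W(2) N(4) by blast
    qed
  qed simp
  have cont_e: "continuous_map euclidean ?R (\<lambda>(u, v). (Some u, Some v))"
  proof -
    have S: "continuous_map euclideanreal RP1 Some" unfolding RP1_def by (rule continuous_map_Some)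
    have "continuous_map (prod_topology euclideanreal euclideanreal) ?R (\<lambda>x. (Some (fst x), Some (snd x)))"
      using continuous_map_compose[OF continuous_map_fst S] continuous_map_compose[OF continuous_map_snd S]
      by (intro continuous_map_pairedI) (simp_all only: o_def)
    thus ?thesis by (simp add: case_prod_unfold)
  qed
  have cont_ec: "continuous_map ?X ?Y endpoint_coords"
  proof (rule continuous_map_into_subtopology)
    show "endpoint_coords \<in> topspace ?X \<rightarrow> D" unfolding tS using ecS by blast
    have "continuous_map ?X ?R ((\<lambda>(u, v). (Some u, Some v)) \<circ> (h \<circ> endpoint_coords))"
      by (rule continuous_map_compose[OF cont_hS cont_e])
    thus "continuous_map ?X ?R endpoint_coords"
    proof (rule continuous_map_eq)
      fix x assume "x \<in> topspace ?X"
      hence "endpoint_coords x \<in> D" unfolding tS by (rule ecS)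
      thus "((\<lambda>(u, v). (Some u, Some v)) \<circ> (h \<circ> endpoint_coords)) x = endpoint_coords x"
        using Dx by (fastforce simp: h_def)
    qed
  qed
  have ke: "k (endpoint_coords x) = x" if x: "x \<in> S" for x
  proof -
    obtain N where N: "unimodular N" "Wall N = 0" "wall (N$1) > 0" "x = proj (frame N)" using Sx[OF x] by blast
    show ?thesis
      using endpoint_coords_section(1)[OF N(1-3)] section_frame_inverse[OF N(1-3)] N(4) by (simp add: k_def h_def)
  qed
  have ek: "endpoint_coords (k y) = y" if y: "y \<in> D" for y
    using Dx[OF y] section_frame_coords by (auto simp: k_def h_def)
  have "homeomorphic_maps ?X ?Y endpoint_coords k"
    unfolding homeomorphic_maps_def tS tD using cont_ec cont_k ke ek by blast
  thus ?thesis unfolding homeomorphic_map_maps S_def D_def by blast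
qed

section \<open>The billiard\<close>

lemma frame_T1_triangle: "unimodular N \<Longrightarrow> frame N \<in> T1_triangle \<longleftrightarrow> tri N"
  by (simp add: T1_triangle_def frame_T1 triangle_pt)

lemma quot_flow_zero: "p \<in> T1 \<Longrightarrow> quot_flow 0 (proj p) = proj p"
  by (metis T1_frame flow_mat_0 matrix_mul_lid quot_flow_proj)

lemma quot_flow_add:
  assumes "p \<in> T1" shows "quot_flow (s + t) (proj p) = quot_flow t (quot_flow s (proj p))"
proof -
  obtain N where N: "unimodular N" "p = frame N" using T1_frame[OF assms] .
  show ?thesis
    using N by (simp add: quot_flow_proj unimodular_mult matrix_mul_assoc flow_mat_add add.commute)
qed

lemma billiard_quot_flow:
  assumes "billiard p t q" shows "p \<in> T1 \<and> q \<in> T1 \<and> quot_flow t (proj p) = proj q"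
  using assms
proof (induction rule: billiard.induct)
  case (glide p t)
  have p: "p \<in> T1" using glide(1) by (simp add: T1_triangle_def)
  then obtain N where "unimodular N" "p = frame N" by (rule T1_frame)
  thus ?case using p by (simp add: geod_flow_frame quot_flow_proj frame_T1 unimodular_mult)
next
  case (bounce p r)
  have "p \<in> T1" "r \<in> V_P" using bounce V_P.gen by (auto simp: T1_triangle_def)
  thus ?case by (simp add: quot_flow_zero proj_tangent_act tangent_act_T1)
next
  case (comp p s q t r)
  thus ?case by (simp add: quot_flow_add)
qed

lemma billiard_refl: assumes "unimodular N" "tri N" shows "billiard (frame N) 0 (frame N)"
proof -
  have 0: "geod_flow 0 (frame N) = frame N" using assms by (simp add: geod_flow_frame)
  have p: "frame N \<in> T1_triangle" using assms by (simp add: frame_T1_triangle)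
  have "billiard (frame N) 0 (geod_flow 0 (frame N))"
  proof (rule billiard.glide)
    show "\<forall>s. 0 \<le> s \<and> s \<le> 0 \<longrightarrow> geod_flow s (frame N) \<in> T1_triangle"
      using 0 p by (metis order_antisym)
  qed (use p in auto)
  thus ?thesis by (simp add: 0)
qed

lemma billiard_bounce:
  assumes N: "unimodular N" "tri N" and r: "r \<in> {alpha, beta, gamma}" "pt (N ** r) = pt N"
  shows "billiard (frame N) 0 (frame (N ** r))"
proof -
  have u: "unimodular r" using r(1) by auto
  have "billiard (frame N) 0 (tangent_act (frame N) r)"
    using N r u by (intro billiard.bounce) (auto simp: frame_T1_triangle hyp_act_pt)
  thus ?thesis by (simp add: tangent_act_frame N(1) u)
qed

text \<open>
  Two vectors over the triangle that differ by the stabilizer of their base point are the same billiard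
  vector. At the vertex \<open>\<i>\<close> a dihedral element is a product of reflections in the two sides, which
  are performed one after the other.
\<close>
lemma billiard_stab:
  assumes N: "unimodular N" "tri N" and g: "g \<in> stab N"
  shows "billiard (frame N) 0 (frame (N ** g))"
proof -
  have dih: "billiard (frame N) 0 (frame (N ** d))" if v: "wall_alpha N = 0" "wall_beta N = 0" and d: "d \<in> dih" for d
  proof -
    have fixed: "pt (N ** e) = pt N" if "e \<in> dih" for e using stab_pt[OF N(1)] that v by (simp add: stab_def)
    have step: "billiard (frame N) 0 (frame (N ** (e ** r)))"
      if e: "e \<in> dih" "billiard (frame N) 0 (frame (N ** e))" and r: "r \<in> {alpha, beta}" for e r
    proof -
      have u: "unimodular (N ** e)" using N e(1) by (simp add: unimodular_mult unimodular_dih)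
      hence "tri (N ** e)" using N fixed[OF e(1)] triangle_pt by metis
      moreover have "e ** r \<in> dih" using e(1) r by (auto intro: dih.intros)
      hence "pt (N ** e ** r) = pt (N ** e)" using fixed[OF e(1)] fixed[of "e ** r"] by (simp add: matrix_mul_assoc)
      ultimately have "billiard (frame (N ** e)) 0 (frame (N ** e ** r))"
        using u r by (intro billiard_bounce) auto
      from billiard.comp[OF e(2) this] show ?thesis by (simp add: matrix_mul_assoc)
    qed
    show ?thesis using d
      by (induction rule: dih.induct) (auto simp: billiard_refl[OF N] intro: step)
  qed
  have b: "billiard (frame N) 0 (frame (N ** r))" if "r \<in> {alpha, beta, gamma}" "r \<in> stab N" for r
    using billiard_bounce[OF N that(1)] stab_pt[OF N(1) that(2)] by simp
  consider "g = mat 1 \<or> g = - mat 1" | "g \<in> dih" "wall_alpha N = 0" "wall_beta N = 0"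
    | r where "r \<in> {alpha, beta, gamma}" "r \<in> stab N" "g = r \<or> g = - r"
    using g by (auto simp: stab_def)
  thus ?thesis
  proof cases
    case 1 thus ?thesis using billiard_refl[OF N] by auto
  next
    case 2 thus ?thesis using dih by blast
  next
    case 3 thus ?thesis using b[OF 3(1,2)] by auto
  qed
qed

text \<open>
  Either the limit at \<open>0\<close> decides the sign, or \<open>b = -a\<close> and the sum is a multiple of \<open>sinh t\<close>.
\<close>
lemma exp_sum_sign:
  fixes a b :: real
  shows "(\<forall>\<^sub>F t in at_right 0. exp t * a + exp (-t) * b \<ge> 0) \<or> (\<forall>\<^sub>F t in at_right 0. exp t * a + exp (-t) * b < 0)"
proof -
  have lim: "((\<lambda>t. exp t * a + exp (-t) * b) \<longlongrightarrow> exp 0 * a + exp (-0) * b) (at_right 0)"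
    by (intro tendsto_intros)
  have eq: "exp t * a + exp (-t) * b = (exp t - exp (-t)) * a" if "a + b = 0" for t
    using that by (simp add: algebra_simps eq_neg_iff_add_eq_0[symmetric] add_eq_0_iff)
  have pos: "\<forall>\<^sub>F t in at_right (0::real). exp t - exp (-t) > 0"
    using eventually_at_right_less[of 0] by eventually_elim simp
  consider "a + b > 0" | "a + b < 0" | "a + b = 0" "a \<ge> 0" | "a + b = 0" "a < 0" by linarith
  thus ?thesis
  proof cases
    case 1
    hence "\<forall>\<^sub>F t in at_right 0. exp t * a + exp (-t) * b > 0" using order_tendstoD(1)[OF lim, of 0] by simp
    thus ?thesis by (auto elim: eventually_mono)
  next
    case 2
    thus ?thesis using order_tendstoD(2)[OF lim, of 0] by simp
  next
    case 3
    have "\<forall>\<^sub>F t in at_right 0. exp t * a + exp (-t) * b \<ge> 0"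
      using pos by eventually_elim (use 3 eq in simp)
    thus ?thesis ..
  next
    case 4
    have "\<forall>\<^sub>F t in at_right 0. exp t * a + exp (-t) * b < 0"
      using pos by eventually_elim (use 4 eq in \<open>simp add: mult_pos_neg\<close>)
    thus ?thesis ..
  qed
qed

lemma finite_dih: "finite dih"
proof -
  have "dih \<subseteq> nu ` {..7} \<union> (\<lambda>i. - nu i) ` {..7}" using dih_nu_ex by fastforce
  thus ?thesis by (rule finite_subset) auto
qed

lemma Form_flow_tendsto: "((\<lambda>t. Form a b c (flow_mat t ** N)) \<longlongrightarrow> Form a b c N) (at_right 0)"
proof -
  have "((\<lambda>t. exp t * form a b c (N$1) + exp (-t) * form a b c (N$2)) \<longlongrightarrow>
      exp 0 * form a b c (N$1) + exp (-0) * form a b c (N$2)) (at_right 0)"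
    by (intro tendsto_intros)
  thus ?thesis by (simp add: Form_flow) (simp add: Form_def)
qed

lemma tri_eventually:
  "(\<forall>\<^sub>F t in at_right 0. tri (flow_mat t ** N)) \<or> (\<forall>\<^sub>F t in at_right 0. \<not> tri (flow_mat t ** N))"
proof -
  have sign: "(\<forall>\<^sub>F t in at_right 0. Form a b c (flow_mat t ** N) \<ge> 0) \<or>
      (\<forall>\<^sub>F t in at_right 0. \<not> Form a b c (flow_mat t ** N) \<ge> 0)" for a b c
    unfolding Form_flow not_le by (rule exp_sum_sign)
  have conj: "(\<forall>\<^sub>F t in F. P t \<and> Q t) \<or> (\<forall>\<^sub>F t in F. \<not> (P t \<and> Q t))"
    if "(\<forall>\<^sub>F t in F. P t) \<or> (\<forall>\<^sub>F t in F. \<not> P t)" "(\<forall>\<^sub>F t in F. Q t) \<or> (\<forall>\<^sub>F t in F. \<not> Q t)"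
    for P Q and F :: "real filter"
    using that
  proof (elim disjE)
    assume "\<forall>\<^sub>F t in F. P t" "\<forall>\<^sub>F t in F. Q t"
    thus ?thesis by (blast intro: eventually_conj)
  qed (rule disjI2, erule eventually_mono, blast)+
  show ?thesis unfolding tri_def by (intro conj sign)
qed

text \<open>
  This is clear if the initial point lies inside the octagon after some group element. If it lies on a
  side, this side may be assumed to be \<open>E\<^sub>0\<close> with the geodesic not pointing to the outside, by \<open>\<gamma>\<close>; then all
  other sides are at a positive distance.
\<close>
lemma germ_in_octagon:
  assumes N: "unimodular N"
  obtains g where "g \<in> V_P" "\<forall>\<^sub>F t in at_right 0. octagon (flow_mat t ** N ** g)"
proof -
  have near: "\<forall>\<^sub>F t in at_right 0. Wall (flow_mat t ** M ** d) > 0" if "Wall (M ** d) > 0" for M d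
    using order_tendstoD(1)[OF Form_flow_tendsto that] by (simp add: matrix_mul_assoc)
  obtain g0 where g0: "g0 \<in> V_P" "octagon (N ** g0)" using octagon_reached[OF N] .
  show ?thesis
  proof (cases "\<forall>d\<in>dih. Wall (N ** g0 ** d) > 0")
    case True
    hence "\<forall>\<^sub>F t in at_right 0. \<forall>d\<in>dih. Wall (flow_mat t ** (N ** g0) ** d) > 0"
      using near by (intro eventually_ball_finite finite_dih) blast
    hence "\<forall>\<^sub>F t in at_right 0. octagon (flow_mat t ** N ** g0)"
      by eventually_elim (auto simp: octagon_def matrix_mul_assoc intro: less_imp_le)
    thus ?thesis using that g0(1) by blast
  next
    case False
    then obtain d0 where d0: "d0 \<in> dih" "Wall (N ** g0 ** d0) = 0"
      using g0(2) by (force simp: octagon_def)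
    have "\<exists>g\<in>V_P. Wall (N ** g) = 0 \<and> wall ((N ** g)$1) \<ge> 0"
    proof (cases "wall ((N ** (g0 ** d0))$1) \<ge> 0")
      case True
      thus ?thesis using d0 V_P.mult[OF g0(1) dih_V_P[OF d0(1)]]
        by (intro bexI[of _ "g0 ** d0"]) (auto simp: matrix_mul_assoc)
    next
      case False
      have "N ** (g0 ** d0 ** gamma) = N ** (g0 ** d0) ** gamma" by (simp add: matrix_mul_assoc)
      hence "Wall (N ** (g0 ** d0 ** gamma)) = 0 \<and> wall ((N ** (g0 ** d0 ** gamma))$1) \<ge> 0"
        using d0(2) False by (simp add: row_mult[of "N ** (g0 ** d0)"]) (simp add: matrix_mul_assoc)
      thus ?thesis using V_P.mult[OF V_P.mult[OF g0(1) dih_V_P[OF d0(1)]] gamma_V_P] by blast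
    qed
    then obtain g where g: "g \<in> V_P" "Wall (N ** g) = 0" "wall ((N ** g)$1) \<ge> 0" by blast
    define M where "M = N ** g"
    have M: "unimodular M" "Wall M = 0" "wall (M$1) \<ge> 0"
      using N g by (auto simp: M_def unimodular_mult V_P_unimodular)
    have "\<forall>\<^sub>F t in at_right 0. Wall (flow_mat t ** M ** d) \<ge> 0" if d: "d \<in> dih" for d
    proof (cases "d = mat 1 \<or> d = - mat 1")
      case False
      hence "Wall (M ** d) > 0" using Wall_disjoint_strict[OF d _ _ M(1)] M(2) by simp
      from near[OF this] show ?thesis by eventually_elim (rule less_imp_le)
    next
      case True
      have w2: "wall (M$2) = - wall (M$1)" using M(2) by (simp add: Form_def)
      have "\<forall>\<^sub>F t in at_right (0::real). Wall (flow_mat t ** M) \<ge> 0"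
        using eventually_at_right_less[of 0]
      proof eventually_elim
        case (elim t)
        have "Wall (flow_mat t ** M) = (exp t - exp (-t)) * wall (M$1)"
          by (simp add: Form_flow w2 algebra_simps)
        also have "\<dots> \<ge> 0" using elim M(3) by simp
        finally show ?case .
      qed
      thus ?thesis using True by auto
    qed
    hence "\<forall>\<^sub>F t in at_right 0. \<forall>d\<in>dih. Wall (flow_mat t ** M ** d) \<ge> 0"
      by (intro eventually_ball_finite finite_dih) blast
    hence "\<forall>\<^sub>F t in at_right 0. octagon (flow_mat t ** N ** g)"
      by eventually_elim (auto simp: octagon_def M_def matrix_mul_assoc)
    thus ?thesis using that g(1) by blast
  qed
qed

text \<open>
  The octagon is covered by finitely many copies of the triangle, and for small \<open>t > 0\<close> the membership in each
  of them is constant.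
\<close>
lemma germ_in_triangle:
  assumes N: "unimodular N"
  obtains g \<epsilon> where "g \<in> V_P" "\<epsilon> > 0" "\<And>t. 0 \<le> t \<Longrightarrow> t \<le> \<epsilon> \<Longrightarrow> tri (flow_mat t ** N ** g)"
proof -
  obtain g where g: "g \<in> V_P" "\<forall>\<^sub>F t in at_right 0. octagon (flow_mat t ** N ** g)"
    using germ_in_octagon[OF N] .
  have "\<exists>d\<in>dih. \<forall>\<^sub>F t in at_right 0. tri (flow_mat t ** (N ** g ** d))"
  proof (rule ccontr)
    assume "\<not> ?thesis"
    hence "\<forall>d\<in>dih. \<forall>\<^sub>F t in at_right 0. \<not> tri (flow_mat t ** (N ** g ** d))" using tri_eventually by blast
    hence "\<forall>\<^sub>F t in at_right 0. \<forall>d\<in>dih. \<not> tri (flow_mat t ** (N ** g ** d))"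
      by (intro eventually_ball_finite finite_dih)
    with g(2) have "\<forall>\<^sub>F t in at_right (0::real). False"
    proof eventually_elim
      case (elim t)
      obtain d where "d \<in> dih" "tri (flow_mat t ** N ** g ** d)" using triangle_in_octagon[OF elim(1)] .
      thus ?case using elim(2) by (simp add: matrix_mul_assoc)
    qed
    thus False by simp
  qed
  then obtain d where d: "d \<in> dih" "\<forall>\<^sub>F t in at_right 0. tri (flow_mat t ** (N ** g ** d))" by blast
  define h where "h = g ** d"
  have h: "h \<in> V_P" using V_P.mult[OF g(1) dih_V_P[OF d(1)]] by (simp add: h_def)
  have ev: "\<forall>\<^sub>F t in at_right 0. tri (flow_mat t ** (N ** h))" using d(2) by (simp add: h_def matrix_mul_assoc)
  then obtain b where b: "b > 0" "\<And>t. 0 < t \<Longrightarrow> t < b \<Longrightarrow> tri (flow_mat t ** (N ** h))"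
    unfolding eventually_at_right_field by auto
  have lim: "Form x y z (N ** h) \<ge> 0" if "\<forall>\<^sub>F t in at_right 0. Form x y z (flow_mat t ** (N ** h)) \<ge> 0" for x y z
    using tendsto_lowerbound[OF Form_flow_tendsto that] by simp
  have "tri (N ** h)" unfolding tri_def
    using ev by (intro conjI lim) (auto simp: tri_def elim: eventually_mono)
  hence 0: "tri (flow_mat 0 ** (N ** h))" by simp
  show ?thesis
  proof (rule that[OF h, of "b / 2"])
    show "b / 2 > 0" using b(1) by simp
    fix t assume "0 \<le> t" "t \<le> b / 2"
    hence "t = 0 \<or> (0 < t \<and> t < b)" using b(1) by auto
    thus "tri (flow_mat t ** N ** h)" using 0 b(2) by (auto simp: matrix_mul_assoc)
  qed
qed

lemma flow_mat_swap: "flow_mat t ** swap_mat = swap_mat ** flow_mat (-t)"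
  by (simp add: flow_mat_def swap_mat_def mat22_mult)

lemma tri_swap: "tri (swap_mat ** N) \<longleftrightarrow> tri N"
  by (simp add: tri_def Form_def add.commute)

lemma germ_in_triangle_backward:
  assumes N: "unimodular N"
  obtains g \<epsilon> where "g \<in> V_P" "\<epsilon> > 0" "\<And>t. 0 \<le> t \<Longrightarrow> t \<le> \<epsilon> \<Longrightarrow> tri (flow_mat (-t) ** N ** g)"
proof -
  obtain g \<epsilon> where g: "g \<in> V_P" "\<epsilon> > 0" "\<And>t. 0 \<le> t \<Longrightarrow> t \<le> \<epsilon> \<Longrightarrow> tri (flow_mat t ** (swap_mat ** N) ** g)"
    using germ_in_triangle[OF unimodular_mult[OF unimodular_swap N]] by blast
  have "flow_mat t ** (swap_mat ** N) ** g = swap_mat ** (flow_mat (-t) ** N ** g)" for t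
    by (simp add: matrix_mul_assoc flow_mat_swap)
  thus ?thesis using that[OF g(1,2)] g(3) by (simp add: tri_swap)
qed

lemma billiard_glide:
  assumes N: "unimodular N" and t: "0 \<le> t" "\<And>s. 0 \<le> s \<Longrightarrow> s \<le> t \<Longrightarrow> tri (flow_mat s ** N)"
  shows "billiard (frame N) t (frame (flow_mat t ** N))"
proof -
  have fl: "geod_flow s (frame N) = frame (flow_mat s ** N)" for s using N by (rule geod_flow_frame)
  have inT: "frame (flow_mat s ** N) \<in> T1_triangle" if "0 \<le> s" "s \<le> t" for s
    using t(2)[OF that] N by (simp add: frame_T1_triangle unimodular_mult)
  have "billiard (frame N) t (geod_flow t (frame N))"
    using t(1) inT inT[of 0] by (intro billiard.glide) (auto simp: fl)
  thus ?thesis by (simp add: fl)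
qed

lemma same_orbit_billiard:
  assumes N: "unimodular N" and gh: "g \<in> V_P" "h \<in> V_P" "tri (N ** g)" "tri (N ** h)"
  shows "billiard (frame (N ** g)) 0 (frame (N ** h))"
proof -
  have u: "unimodular (N ** g)" using N gh(1) by (simp add: unimodular_mult V_P_unimodular)
  have eq: "N ** g ** (matrix_inv g ** h) = N ** h"
    by (simp add: matrix_mul_assoc matrix_inv_cancel V_P_unimodular[OF gh(1)])
  have "matrix_inv g ** h \<in> stab (N ** g)"
    using strict_fundamental_domain[OF u V_P.mult[OF V_P.inv[OF gh(1)] gh(2)] gh(3)] gh(4) eq by simp
  from billiard_stab[OF u gh(3) this] show ?thesis by (simp add: eq)
qed

text \<open>
  A supremum argument: the set of times that the billiard reaches is closed from the left by
  \<open>germ_in_triangle_backward\<close> and can be prolonged to the right by \<open>germ_in_triangle\<close>. A piece of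
  the geodesic in a translate of the triangle is a glide, after some bounces that pass to the right translate.
\<close>
lemma billiard_follows_flow:
  assumes N: "unimodular N" and tN: "tri N" and T: "0 \<le> T"
  shows "\<exists>g\<in>V_P. tri (flow_mat T ** N ** g) \<and> billiard (frame N) T (frame (flow_mat T ** N ** g))"
proof -
  \<comment> \<open>\<open>R t\<close>: the billiard reaches some representative over the triangle of the vector at time \<open>t\<close>. It need not
    be the same group element as before time \<open>t\<close>.\<close>
  define R where "R t \<longleftrightarrow> (\<exists>g\<in>V_P. tri (flow_mat t ** N ** g) \<and> billiard (frame N) t (frame (flow_mat t ** N ** g)))" for t
  have uf: "unimodular (flow_mat t ** N)" for t using N by (simp add: unimodular_mult)
  have step: "R t" if R: "R s" and g: "g \<in> V_P" and tri: "\<And>r. s \<le> r \<Longrightarrow> r \<le> t \<Longrightarrow> tri (flow_mat r ** N ** g)" and st: "s \<le> t"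
    for s t g
  proof -
    obtain h where h: "h \<in> V_P" "tri (flow_mat s ** N ** h)" "billiard (frame N) s (frame (flow_mat s ** N ** h))"
      using R by (auto simp: R_def)
    have 1: "billiard (frame (flow_mat s ** N ** h)) 0 (frame (flow_mat s ** N ** g))"
      using same_orbit_billiard[OF uf h(1) g h(2)] tri[of s] st by simp
    have fl: "flow_mat r ** (flow_mat s ** N ** g) = flow_mat (r + s) ** N ** g" for r
      by (simp add: matrix_mul_assoc flow_mat_add)
    have "unimodular (flow_mat s ** N ** g)" using uf g by (simp add: unimodular_mult V_P_unimodular)
    hence "billiard (frame (flow_mat s ** N ** g)) (t - s) (frame (flow_mat (t - s) ** (flow_mat s ** N ** g)))"
      using st tri by (intro billiard_glide) (auto simp: fl)
    hence 2: "billiard (frame (flow_mat s ** N ** g)) (t - s) (frame (flow_mat t ** N ** g))"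
      by (simp add: fl)
    have "billiard (frame N) (s + (0 + (t - s))) (frame (flow_mat t ** N ** g))"
      using billiard.comp[OF h(3) billiard.comp[OF 1 2]] .
    thus ?thesis using g tri[of t] st by (auto simp: R_def)
  qed
  have R0: "R 0" unfolding R_def
    by (intro bexI[OF _ V_P.one]) (simp add: tN billiard_refl[OF N tN])
  define S where "S = {t. 0 \<le> t \<and> t \<le> T \<and> (\<forall>s. 0 \<le> s \<and> s \<le> t \<longrightarrow> R s)}"
  define u where "u = Sup S"
  have S0: "0 \<in> S" using T R0 by (auto simp: S_def)
  have bdd: "bdd_above S" by (intro bdd_aboveI[of _ T]) (auto simp: S_def)
  have u: "0 \<le> u" "u \<le> T"
  proof -
    show "0 \<le> u" unfolding u_def by (rule cSup_upper[OF S0 bdd])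
    have "S \<noteq> {}" using S0 by blast
    moreover have "t \<le> T" if "t \<in> S" for t using that by (simp add: S_def)
    ultimately show "u \<le> T" unfolding u_def by (rule cSup_least)
  qed
  have below: "R s" if s: "0 \<le> s" "s < u" for s
  proof -
    have "S \<noteq> {}" using S0 by blast
    then obtain t where "t \<in> S" "s < t" using s(2) less_cSup_iff[OF _ bdd] unfolding u_def by blast
    thus ?thesis using s(1) by (auto simp: S_def)
  qed
  have Ru: "R u"
  proof (cases "u = 0")
    case True thus ?thesis using R0 by simp
  next
    case False
    obtain g \<epsilon> where g: "g \<in> V_P" "\<epsilon> > 0" "\<And>t. 0 \<le> t \<Longrightarrow> t \<le> \<epsilon> \<Longrightarrow> tri (flow_mat (-t) ** (flow_mat u ** N) ** g)"
      using germ_in_triangle_backward[OF uf] by blast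
    have tri: "tri (flow_mat r ** N ** g)" if "u - \<epsilon> \<le> r" "r \<le> u" for r
      using g(3)[of "u - r"] that by (simp add: matrix_mul_assoc flow_mat_add)
    define s where "s = max 0 (u - \<epsilon>)"
    have s: "0 \<le> s" "s < u" "u - \<epsilon> \<le> s" using False u g(2) by (auto simp: s_def)
    show ?thesis using step[OF below[OF s(1,2)] g(1), of u] tri s by auto
  qed
  have "u = T"
  proof (rule ccontr)
    assume "u \<noteq> T"
    hence uT: "u < T" using u by simp
    obtain g \<epsilon> where g: "g \<in> V_P" "\<epsilon> > 0" "\<And>t. 0 \<le> t \<Longrightarrow> t \<le> \<epsilon> \<Longrightarrow> tri (flow_mat t ** (flow_mat u ** N) ** g)"
      using germ_in_triangle[OF uf] by blast
    have tri: "tri (flow_mat r ** N ** g)" if "u \<le> r" "r \<le> u + \<epsilon>" for r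
      using g(3)[of "r - u"] that by (simp add: matrix_mul_assoc flow_mat_add)
    define v where "v = min T (u + \<epsilon>)"
    have v: "u < v" "v \<le> T" "v \<le> u + \<epsilon>" using uT g(2) by (auto simp: v_def)
    have above: "R s" if "u \<le> s" "s \<le> v" for s
      using step[OF Ru g(1), of s] tri that v by auto
    have "R s" if "0 \<le> s" "s \<le> v" for s
      using below[of s] above[of s] that by (cases "s < u") auto
    hence "v \<in> S" using v u by (simp add: S_def)
    hence "v \<le> u" unfolding u_def by (rule cSup_upper[OF _ bdd])
    thus False using v by simp
  qed
  thus ?thesis using Ru by (simp add: R_def)
qed

theorem quotient_flow_is_billiard: "quot_flow_is_billiard"
  unfolding quot_flow_is_billiard_def
proof (intro conjI ballI allI impI)
  show "proj ` T1_triangle = proj ` T1"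
  proof (intro equalityI subsetI)
    show "x \<in> proj ` T1_triangle \<Longrightarrow> x \<in> proj ` T1" for x by (auto simp: T1_triangle_def)
  next
    fix x assume "x \<in> proj ` T1"
    then obtain N where N: "unimodular N" "x = proj (frame N)" using T1_frame by blast
    obtain g where g: "g \<in> V_P" "tri (N ** g)" using triangle_reached[OF N(1)] .
    have "frame (N ** g) \<in> T1_triangle"
      using N g by (simp add: frame_T1_triangle unimodular_mult V_P_unimodular)
    moreover have "x = proj (frame (N ** g))" using proj_frame_mult[OF N(1) g(1)] N(2) by simp
    ultimately show "x \<in> proj ` T1_triangle" by blast
  qed
next
  fix p q and t :: real assume pq: "p \<in> T1_triangle" "q \<in> T1_triangle" "t \<ge> 0"
  show "billiard p t q \<longleftrightarrow> quot_flow t (proj p) = proj q"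
  proof
    show "billiard p t q \<Longrightarrow> quot_flow t (proj p) = proj q" using billiard_quot_flow by blast
  next
    assume fl: "quot_flow t (proj p) = proj q"
    obtain N M where N: "unimodular N" "p = frame N" and M: "unimodular M" "q = frame M"
      using pq T1_frame unfolding T1_triangle_def by (metis (lifting) mem_Collect_eq)
    have tN: "tri N" and tM: "tri M" using pq N M by (simp_all add: frame_T1_triangle)
    have uf: "unimodular (flow_mat t ** N)" using N by (simp add: unimodular_mult)
    have "proj (frame M) = proj (frame (flow_mat t ** N))" using fl N M by (simp add: quot_flow_proj)
    then obtain h where h: "h \<in> V_P" "frame M = frame (flow_mat t ** N ** h)"
      using proj_frame_eq_iff[OF M(1) uf] by blast
    have "unimodular (flow_mat t ** N ** h)" using uf h(1) by (simp add: unimodular_mult V_P_unimodular)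
    hence th: "tri (flow_mat t ** N ** h)" using tM h(2) M(1) frame_T1_triangle by metis
    obtain g where g: "g \<in> V_P" "tri (flow_mat t ** N ** g)" "billiard p t (frame (flow_mat t ** N ** g))"
      using billiard_follows_flow[OF N(1) tN pq(3)] N(2) by blast
    show "billiard p t q"
      using billiard.comp[OF g(3) same_orbit_billiard[OF uf g(1) h(1) g(2) th]] h(2) M(2) by simp
  qed
qed

section \<open>The conjugacy\<close>

lemma section_avoiding_iff:
  assumes "p \<in> lifted_section"
  shows "proj p \<in> section_avoiding N \<longleftrightarrow> fwd_end p \<notin> N \<and> bwd_end p \<notin> N"
proof
  assume "proj p \<in> section_avoiding N"
  then obtain q where q: "q \<in> lifted_section" "fwd_end q \<notin> N" "bwd_end q \<notin> N" "proj p = proj q"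
    by (auto simp: section_avoiding_def)
  have "p = q" using lifted_section_unique[OF assms q(1,4)] .
  thus "fwd_end p \<notin> N \<and> bwd_end p \<notin> N" using q by blast
next
  assume "fwd_end p \<notin> N \<and> bwd_end p \<notin> N"
  thus "proj p \<in> section_avoiding N" using assms by (auto simp: section_avoiding_def)
qed

lemma bdry_direction_involution: "bdry_direction (bdry_direction x) = x"
  by (cases x) (auto simp: bdry_direction_def)

lemma bdry_direction_image: "bdry_direction x \<in> bdry_direction ` N \<longleftrightarrow> x \<in> N"
  by (metis bdry_direction_involution image_iff)

lemma section_avoiding_mono: "M \<subseteq> N \<Longrightarrow> section_avoiding N \<subseteq> section_avoiding M"
  by (auto simp: section_avoiding_def)

lemma domain_avoiding_mono: "M \<subseteq> N \<Longrightarrow> domain_avoiding N \<subseteq> domain_avoiding M"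
  by (auto simp: domain_avoiding_def)

text \<open>
  Restriction of the homeomorphism. Both sides exclude the same vectors because a vector of the section is
  the only lift of its class.
\<close>
lemma endpoint_coords_homeomorphic_avoiding:
  assumes "E_ends 0 \<subseteq> N"
  shows "homeomorphic_map (subtopology quotient_top (section_avoiding N))
     (subtopology (prod_topology RP1 RP1) (domain_avoiding N)) endpoint_coords"
proof -
  let ?X = "subtopology quotient_top (section_avoiding (E_ends 0))"
  let ?Y = "subtopology (prod_topology RP1 RP1) (domain_avoiding (E_ends 0))"
  have "homeomorphic_map (subtopology ?X (section_avoiding N)) (subtopology ?Y (domain_avoiding N)) endpoint_coords"
  proof (rule homeomorphic_map_subtopologies_alt[OF endpoint_coords_homeomorphic])
    fix x assume x: "x \<in> topspace ?X" "endpoint_coords x \<in> topspace ?Y"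
    then obtain p where p: "p \<in> lifted_section" "x = proj p" by (auto simp: section_avoiding_def)
    have e: "endpoint_coords x = (bdry_direction (fwd_end p), bdry_direction (bwd_end p))"
      using p by (simp add: endpoint_coords_def lift_proj)
    have "endpoint_coords x \<in> Sigma_sectors \<times> sector 0" using x(2) by (auto simp: domain_avoiding_def)
    thus "endpoint_coords x \<in> domain_avoiding N \<longleftrightarrow> x \<in> section_avoiding N"
      unfolding p(2) section_avoiding_iff[OF p(1)]
      using e p(2) by (auto simp: domain_avoiding_def bdry_direction_image)
  qed
  thus ?thesis
    using section_avoiding_mono[OF assms] domain_avoiding_mono[OF assms]
    by (simp add: subtopology_subtopology Int_absorb1)
qed

theorem proposition4p8:
  shows
    "conjugacy endpoint_coords
       (subtopology quotient_top (section_avoiding cusps)) (first_return quot_flow cross_section)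
       (subtopology (prod_topology RP1 RP1) (domain_avoiding cusps)) F_hat
     \<and> (\<forall>x\<in>section_avoiding cusps. returns quot_flow cross_section x)
     \<and> homeomorphic_map
         (subtopology quotient_top (section_avoiding (E_ends 0)))
         (subtopology (prod_topology RP1 RP1) (domain_avoiding (E_ends 0))) endpoint_coords
     \<and> (\<forall>x\<in>cross_section.
          returns quot_flow cross_section x \<longleftrightarrow> fwd_end (lift x) \<notin> oct_vertices)
     \<and> (\<forall>x\<in>cross_section. returns quot_flow cross_section x \<longrightarrow>
          endpoint_coords (first_return quot_flow cross_section x) = F_hat (endpoint_coords x))
     \<and> quot_flow_is_billiard"
proof -
  let ?f = "first_return quot_flow cross_section"
  let ?X = "subtopology quotient_top (section_avoiding cusps)"
  let ?Y = "subtopology (prod_topology RP1 RP1) (domain_avoiding cusps)"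
  have ret_iff: "returns quot_flow cross_section x \<longleftrightarrow> fwd_end (lift x) \<notin> oct_vertices"
    if "x \<in> cross_section" for x
    using that returns_iff lift_proj by (auto simp: cross_section_def)
  have eq: "endpoint_coords (?f x) = F_hat (endpoint_coords x)"
    if x: "x \<in> cross_section" "returns quot_flow cross_section x" for x
  proof -
    obtain p where p: "p \<in> lifted_section" "x = proj p" using x(1) by (auto simp: cross_section_def)
    hence "fwd_end p \<notin> oct_vertices" using x returns_iff by blast
    from first_return_section[OF p(1) this] p(2) show ?thesis by metis
  qed
  have sub: "section_avoiding cusps \<subseteq> cross_section"
    by (auto simp: section_avoiding_def cross_section_def)
  have ret: "returns quot_flow cross_section x" if x: "x \<in> section_avoiding cusps" for x
  proof -
    obtain p where "p \<in> lifted_section" "x = proj p" "fwd_end p \<notin> cusps"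
      using x by (auto simp: section_avoiding_def)
    thus ?thesis using returns_iff oct_vertices_cusps by blast
  qed
  have closed: "?f x \<in> section_avoiding cusps" if x: "x \<in> section_avoiding cusps" for x
  proof -
    obtain p where p: "p \<in> lifted_section" "x = proj p" "fwd_end p \<notin> cusps" "bwd_end p \<notin> cusps"
      using x by (auto simp: section_avoiding_def)
    obtain q g where q: "q \<in> lifted_section" "g \<in> V_P" "?f (proj p) = proj q"
      "fwd_end q = bdry_act (fwd_end p) g" "bwd_end q = bdry_act (bwd_end p) g"
      using first_return_section[OF p(1)] p(3) oct_vertices_cusps by (metis subsetD)
    show ?thesis using q p by (simp add: section_avoiding_iff cusps_act)
  qed
  have tX: "topspace ?X = section_avoiding cusps"
  proof -
    have "section_avoiding cusps \<subseteq> proj ` T1" by (auto simp: section_avoiding_def lifted_section_def)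
    thus ?thesis by (simp add: topspace_quotient_top Int_absorb1)
  qed
  have hom: "homeomorphic_map ?X ?Y endpoint_coords"
    by (rule endpoint_coords_homeomorphic_avoiding[OF E_ends_cusps])
  hence im: "endpoint_coords ` section_avoiding cusps = topspace ?Y"
    using homeomorphic_imp_surjective_map tX by metis
  have eqX: "endpoint_coords (?f x) = F_hat (endpoint_coords x)" if "x \<in> section_avoiding cusps" for x
    using eq ret sub that by blast
  have "F_hat y \<in> topspace ?Y" if y: "y \<in> topspace ?Y" for y
  proof -
    have "y \<in> endpoint_coords ` section_avoiding cusps" unfolding im by (rule y)
    then obtain x where x: "x \<in> section_avoiding cusps" "y = endpoint_coords x" by (rule imageE)
    have "endpoint_coords (?f x) \<in> topspace ?Y" unfolding im[symmetric] by (rule imageI[OF closed[OF x(1)]])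
    thus ?thesis unfolding eqX[OF x(1)] x(2) .
  qed
  hence "conjugacy endpoint_coords ?X ?f ?Y F_hat"
    unfolding conjugacy_def tX using hom closed eqX by (intro conjI funcsetI ballI)
  thus ?thesis
    using ret ret_iff eq endpoint_coords_homeomorphic quotient_flow_is_billiard
    by (intro conjI ballI impI)
qed

end
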